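(* The real algebra $B=\mathbb{R}\big[x,y,\frac{x^2}{x^2+y^2},\frac{xy}{x^2+y^2}\big]$ satisfies $\mathrm{psd}=\mathrm{sos}$, that is, every positive semidefinite element of $B$ is a finite sum of squares of elements of $B$.
   Context: $B$ is the subring of the rational function field $\mathbb{R}(x,y)$ generated over $\mathbb{R}$ by $x,\ y,\ \frac{x^2}{x^2+y^2},\ \frac{xy}{x^2+y^2}$. A character of $B$ is a unital $\mathbb{R}$-algebra homomorphism $\chi:B\to\mathbb{R}$. An element $b\in B$ is positive semidefinite (psd) if $\chi(b)\geq 0$ for all characters $\chi$ of $B$. *)

theory Defs
  imports "HOL-Computational_Algebra.Computational_Algebra"
begin

text \<open>
  The rational function field in two variables over the reals is the fraction field of
  \<open>\<real>[x][y]\<close>: the inner polynomial variable is \<open>x\<close>, the outer one is \<open>y\<close>.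
\<close>

type_synonym ratfun = "real poly poly fract"

definition rf_const :: "real \<Rightarrow> ratfun"
  where "rf_const c = to_fract [:[:c:]:]"

definition rf_x :: ratfun
  where "rf_x = to_fract [:[:0, 1:]:]"

definition rf_y :: ratfun
  where "rf_y = to_fract [:0, 1:]"

text \<open>Division by zero is total, so we record that the denominator used below is nonzero.\<close>

lemma rf_denominator_nonzero: "rf_x\<^sup>2 + rf_y\<^sup>2 \<noteq> 0"
proof -
  have "rf_x\<^sup>2 + rf_y\<^sup>2 = to_fract ([:[:0, 1:]:]\<^sup>2 + [:0, 1:]\<^sup>2)"
    by (simp add: rf_x_def rf_y_def power2_eq_square del: mult_pCons_left mult_pCons_right)
  moreover have "[:[:0, 1:]:]\<^sup>2 + [:0, 1:]\<^sup>2 \<noteq> (0 :: real poly poly)"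
    by (simp add: power2_eq_square)
  ultimately show ?thesis
    by (simp only: to_fract_eq_0_iff not_False_eq_True)
qed

inductive_set algB :: "ratfun set" where
  const: "rf_const c \<in> algB"
| x: "rf_x \<in> algB"
| y: "rf_y \<in> algB"
| xx: "rf_x\<^sup>2 / (rf_x\<^sup>2 + rf_y\<^sup>2) \<in> algB"
| xy: "rf_x * rf_y / (rf_x\<^sup>2 + rf_y\<^sup>2) \<in> algB"
| add: "f \<in> algB \<Longrightarrow> g \<in> algB \<Longrightarrow> f + g \<in> algB"
| uminus: "f \<in> algB \<Longrightarrow> - f \<in> algB"
| mult: "f \<in> algB \<Longrightarrow> g \<in> algB \<Longrightarrow> f * g \<in> algB"

text \<open>
  A character is represented by a function on the whole field of which only the
  restriction to \<open>A\<close> matters; nothing is required outside \<open>A\<close>.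
\<close>

definition character :: "ratfun set \<Rightarrow> (ratfun \<Rightarrow> real) \<Rightarrow> bool"
  where "character A \<chi> \<longleftrightarrow>
    \<chi> 1 = 1 \<and>
    (\<forall>f\<in>A. \<forall>g\<in>A. \<chi> (f + g) = \<chi> f + \<chi> g) \<and>
    (\<forall>f\<in>A. \<forall>g\<in>A. \<chi> (f * g) = \<chi> f * \<chi> g) \<and>
    (\<forall>c. \<forall>f\<in>A. \<chi> (rf_const c * f) = c * \<chi> f)"

definition psd :: "ratfun set \<Rightarrow> ratfun set"
  where "psd A = {f \<in> A. \<forall>\<chi>. character A \<chi> \<longrightarrow> 0 \<le> \<chi> f}"

definition sos :: "ratfun set \<Rightarrow> ratfun set"
  where "sos A = {f. \<exists>gs. set gs \<subseteq> A \<and> f = (\<Sum>g\<leftarrow>gs. g\<^sup>2)}"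

end

theory Submission
  imports Defs "HOL-Computational_Algebra.Field_as_Ring"
begin

text \<open>
  In the coordinates \<open>r = x\<close>, \<open>t = y/x\<close> the algebra \<open>B\<close> becomes the set of all
  \<open>\<Sum>\<^sub>i b\<^sub>i r\<^sup>i\<close> with \<open>b\<^sub>i \<in> \<real>[t, 1/(1+t\<^sup>2)]\<close> of degree at most \<open>i\<close>
  in \<open>t\<close>. Leading forms of real squares do not cancel, so the degree condition passes from a
  sum of squares to its summands, and it suffices to show that every \<open>F \<in> \<real>[t,r]\<close> that is
  nonnegative on the plane becomes a sum of squares after multiplication by a power of \<open>1+t\<^sup>2\<close>.
  This concerns functions on a cylinder: \<open>t = tan \<alpha>\<close> lives on a circle.

  If \<open>F\<close> is strictly positive, also at infinity in \<open>t\<close> and in \<open>r\<close>, sampling at equidistant angles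
  with the kernel \<open>cos\<^sup>2\<^sup>m(\<alpha> - \<alpha>\<^sub>j)\<close> writes \<open>F\<close> as a combination, with squares as
  coefficients, of nonnegative polynomials in \<open>r\<close> alone. In general, square factors are split off;
  then a Bezout relation between \<open>F\<close> and \<open>\<partial>F/\<partial>r\<close> bounds \<open>F\<close> below by
  \<open>w(t)\<^sup>2 (1+r\<^sup>2)\<^sup>d\<close>, so \<open>F\<close> degenerates at finitely many angles only, and a
  rotation moves these away from \<open>t = \<infinity>\<close>. Near such a point \<open>F\<close> is a sum of squares over
  \<open>\<real>[[t]]\<close>: a Puiseux root of \<open>F\<close> has a minimal polynomial \<open>Q\<close> over \<open>\<complex>((t))\<close>, and
  \<open>Q\<close> times its conjugate divides \<open>F\<close>, because a root on a real branch is a double root.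
  Truncations of the local representations are combined by the Chinese remainder theorem and
  multiplied by a cutoff; the remainder, divided by \<open>w\<^sup>2\<close>, is strictly positive.
\<close>

subsection \<open>Ring homomorphisms and polynomials\<close>

text \<open>The cylinder is compact in the direction of \<open>t\<close> only. Elements of
  \<open>B\<close> are polynomial in \<open>r\<close>, so a denominator may be a power of
  \<open>1 + t^2\<close> but must not involve \<open>r\<close>. Hence every estimate is made
  relative to \<open>(1 + r^2)^d\<close>, where \<open>2 * d\<close> bounds the degree in
  \<open>r\<close>, and every local representation has to keep degree at most \<open>d\<close> in
  \<open>r\<close>.

  Degeneration also happens at \<open>r = \<infinity>\<close>, where the leading coefficient of
  \<open>F\<close> vanishes; this is why \<open>w\<close> has to account for the zeros of that
  coefficient along with those of the Bezout constant.

  The local part is formal, because only finitely many Taylor coefficients enter the gluing and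
  because Hensel's lemma and the Newton polygon are purely algebraic over power series. What
  \<open>F\<close> then contributes is nonnegativity along formal real curves.

  Of the characters of \<open>B\<close> only the evaluations at points with
  \<open>x \<noteq> 0\<close> are needed: they already make \<open>F\<close> nonnegative off the
  line \<open>r = 0\<close>, and density does the rest.\<close>

locale unital_hom =
  fixes h :: "'a :: idom \<Rightarrow> 'b :: idom"
  assumes zero [simp]: "h 0 = 0"
    and one [simp]: "h 1 = 1"
    and add: "h (a + b) = h a + h b"
    and mult: "h (a * b) = h a * h b"
begin

lemma uminus: "h (- a) = - h a"
  by (metis add add.inverse_unique add.right_inverse zero)

lemma diff: "h (a - b) = h a - h b"
  using add[of a "- b"] by (simp add: uminus)

lemma power: "h (a ^ n) = h a ^ n"
  by (induction n) (simp_all add: mult)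

lemma sum: "h (sum f S) = (\<Sum>i\<in>S. h (f i))"
  by (induction S rule: infinite_finite_induct) (simp_all add: add)

lemma prod: "h (prod f S) = (\<Prod>i\<in>S. h (f i))"
  by (induction S rule: infinite_finite_induct) (simp_all add: mult)

lemma of_nat: "h (of_nat n) = of_nat n"
  by (induction n) (simp_all add: add)

lemma map_poly_hom: "unital_hom (map_poly h)"
proof
  show "map_poly h (p + q) = map_poly h p + map_poly h q" for p q
    by (intro poly_eqI) (simp add: coeff_map_poly add)
  show "map_poly h (p * q) = map_poly h p * map_poly h q" for p q
    by (intro poly_eqI) (simp add: coeff_map_poly coeff_mult sum mult)
qed simp_all

lemma poly_map_poly: "poly (map_poly h p) (h x) = h (poly p x)"
  by (induction p) (simp_all add: map_poly_pCons add mult)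

lemma poly_hom: "unital_hom (\<lambda>p. poly (map_poly h p) x)"
proof -
  interpret m: unital_hom "map_poly h" by (rule map_poly_hom)
  show ?thesis by standard (simp_all add: m.add m.mult)
qed

lemma map_poly_linear: "map_poly h [:- a, 1:] = [:- h a, 1:]"
  by (simp add: map_poly_pCons uminus)

lemma map_poly_pcompose: "map_poly h (pcompose p q) = pcompose (map_poly h p) (map_poly h q)"
proof -
  interpret m: unital_hom "map_poly h" by (rule map_poly_hom)
  show ?thesis
    by (induction p) (simp_all add: pcompose_pCons map_poly_pCons m.add m.mult)
qed

lemma pderiv_map_poly: "pderiv (map_poly h p) = map_poly h (pderiv p)"
  by (intro poly_eqI) (simp add: coeff_pderiv coeff_map_poly mult of_nat add)

lemma degree_map_poly_monic:
  assumes "lead_coeff p = 1"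
  shows "degree (map_poly h p) = degree p" "lead_coeff (map_poly h p) = 1"
proof -
  show 1: "degree (map_poly h p) = degree p"
    using assms by (intro map_poly_degree_eq) simp
  show "lead_coeff (map_poly h p) = 1"
    using assms unfolding 1 by (simp add: coeff_map_poly)
qed

end

lemma monic_mult:
  fixes p q :: "'a :: idom poly"
  assumes "lead_coeff p = 1" "lead_coeff q = 1"
  shows "lead_coeff (p * q) = 1" "degree (p * q) = degree p + degree q"
proof -
  have "p \<noteq> 0" "q \<noteq> 0" using assms by auto
  then show "degree (p * q) = degree p + degree q" by (simp add: degree_mult_eq)
  show "lead_coeff (p * q) = 1" by (simp add: lead_coeff_mult assms)
qed

lemma monic_cofactor:
  fixes p q :: "'a :: idom poly"
  assumes "lead_coeff (p * q) = 1" "lead_coeff p = 1"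
  shows "lead_coeff q = 1"
  using assms by (simp add: lead_coeff_mult)

text \<open>Pseudo-division multiplies by a power of the leading coefficient, which is 1 here. So
  division with remainder is available over power series, where no Euclidean structure on
  polynomials is at hand.\<close>

lemma monic_division:
  fixes f g :: "'a :: idom poly"
  assumes "lead_coeff g = 1"
  obtains q r where "f = g * q + r" "r = 0 \<or> degree r < degree g"
proof -
  obtain q r where qr: "pseudo_divmod f g = (q, r)" by fastforce
  have "g \<noteq> 0" using assms by auto
  from pseudo_divmod[OF this qr] assms have "f = g * q + r" "r = 0 \<or> degree r < degree g"
    by auto
  then show thesis by (rule that)
qed

subsection \<open>Hensel factorization\<close>

text \<open>Any Bezout solution is reduced modulo \<open>g\<close> in its first component; comparing
  degrees in the equation then forces the bound on the second one.\<close>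

lemma bezout_degree_bound:
  fixes g h p :: "'a :: field_gcd poly"
  assumes "coprime g h" "degree p < degree g + degree h" "degree g > 0" "degree h > 0"
  obtains u v where "u * h + g * v = p" "degree u < degree g" "degree v < degree h"
proof -
  obtain a b where ab: "a * g + b * h = 1"
    using assms(1) bezout_coefficients_fst_snd[of g h] by (auto simp: coprime_iff_gcd_eq_1)
  define u where "u = (p * b) mod g"
  define w where "w = p * a + (p * b) div g * h"
  have "g \<noteq> 0" using assms by auto
  have "p = p * (a * g + b * h)" by (simp add: ab)
  also have "\<dots> = (p * b) * h + g * (p * a)" by (simp add: algebra_simps)
  also have "(p * b) = (p * b) div g * g + u" by (simp add: u_def)
  finally have eq: "u * h + g * w = p" by (simp add: w_def algebra_simps)
  have du: "degree u < degree g"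
    using degree_mod_less'[OF \<open>g \<noteq> 0\<close>, of "p * b"] assms(3) by (cases "u = 0") (auto simp: u_def)
  have "degree (u * h) < degree g + degree h"
    using du degree_mult_le[of u h] by linarith
  moreover have "g * w = p - u * h" using eq by (simp add: algebra_simps)
  ultimately have "degree (g * w) < degree g + degree h"
    by (metis assms(2) degree_diff_less)
  then have "degree w < degree h"
    using \<open>g \<noteq> 0\<close> assms(4) by (cases "w = 0") (auto simp: degree_mult_eq)
  with eq du that show thesis by blast
qed

definition red0 :: "'a :: comm_ring_1 fps poly \<Rightarrow> 'a poly"
  where "red0 = map_poly (\<lambda>a. a $ 0)"

text \<open>The factors are built order by order in the power series variable. The pair of order
  \<open>k\<close> enters the equation only linearly, as \<open>g k * h0 + g0 * h k\<close>; all
  other products involve earlier pairs, so a Bezout equation for the coprime residues provides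
  it.\<close>

lemma hensel_coefficients:
  fixes F :: "nat \<Rightarrow> 'a :: field_gcd poly"
  assumes "F 0 = g0 * h0" "coprime g0 h0" "degree g0 > 0" "degree h0 > 0"
    and deg: "\<And>k. k > 0 \<Longrightarrow> degree (F k) < degree g0 + degree h0"
  obtains g h where "g 0 = g0" "h 0 = h0" "\<And>k. k > 0 \<Longrightarrow> degree (g k) < degree g0"
    "\<And>k. k > 0 \<Longrightarrow> degree (h k) < degree h0" "\<And>k. (\<Sum>i\<le>k. g i * h (k - i)) = F k"
proof -
  define P where "P f k r \<longleftrightarrow> (if k = 0 then r = (g0, h0) else
      degree (fst r) < degree g0 \<and> degree (snd r) < degree h0 \<and>
      fst r * h0 + g0 * snd r = F k - (\<Sum>i\<in>{1..<k}. fst (f i) * snd (f (k - i))))"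
    for f :: "nat \<Rightarrow> 'a poly \<times> 'a poly" and k r
  \<comment> \<open>The choice at \<open>k\<close> depends on all earlier pairs, hence choice along
    a well-founded relation.\<close>
  have "\<exists>f. \<forall>x. P f x (f x)"
  proof (rule dependent_wf_choice[of "{(a, b). a < b}"])
    show "wf {(a, b). a < (b :: nat)}" by (rule wf)
    fix f g :: "nat \<Rightarrow> 'a poly \<times> 'a poly" and x r
    assume "\<And>z. (z, x) \<in> {(a, b). a < b} \<Longrightarrow> f z = g z"
    then have "(\<Sum>i\<in>{1..<x}. fst (f i) * snd (f (x - i))) = (\<Sum>i\<in>{1..<x}. fst (g i) * snd (g (x - i)))"
      by (intro sum.cong) auto
    then show "P f x r = P g x r" by (simp add: P_def)
  next
    fix x and f :: "nat \<Rightarrow> 'a poly \<times> 'a poly"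
    assume IH: "\<And>y. (y, x) \<in> {(a, b). a < b} \<Longrightarrow> P f y (f y)"
    show "\<exists>r. P f x r"
    proof (cases "x = 0")
      case False
      have "degree (fst (f i) * snd (f (x - i))) < degree g0 + degree h0" if "i \<in> {1..<x}" for i
      proof -
        have "P f i (f i)" "P f (x - i) (f (x - i))" using IH that by auto
        then show ?thesis using that degree_mult_le[of "fst (f i)" "snd (f (x - i))"]
          by (auto simp: P_def)
      qed
      then have "degree (\<Sum>i\<in>{1..<x}. fst (f i) * snd (f (x - i))) < degree g0 + degree h0"
        using assms(3) by (intro degree_sum_less) auto
      then have "degree (F x - (\<Sum>i\<in>{1..<x}. fst (f i) * snd (f (x - i)))) < degree g0 + degree h0"
        using deg[of x] False by (intro degree_diff_less) auto
      from bezout_degree_bound[OF assms(2) this assms(3,4)]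
      obtain u v where "u * h0 + g0 * v = F x - (\<Sum>i\<in>{1..<x}. fst (f i) * snd (f (x - i)))"
        "degree u < degree g0" "degree v < degree h0" by blast
      then have "P f x (u, v)" using False by (simp add: P_def)
      then show ?thesis ..
    qed (auto simp: P_def)
  qed
  then obtain f where f: "\<And>k. P f k (f k)" by blast
  have f0: "f 0 = (g0, h0)" using f[of 0] by (simp add: P_def)
  have eq: "(\<Sum>i\<le>k. fst (f i) * snd (f (k - i))) = F k" for k
  proof (cases "k = 0")
    case False
    have "{..k} = insert 0 (insert k {1..<k})" using False by auto
    then have "(\<Sum>i\<le>k. fst (f i) * snd (f (k - i))) =
        g0 * snd (f k) + (fst (f k) * h0 + (\<Sum>i\<in>{1..<k}. fst (f i) * snd (f (k - i))))"
      using False by (simp add: f0)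
    then show ?thesis using f[of k] False by (simp add: P_def algebra_simps)
  qed (simp add: f0 assms(1))
  show thesis
  proof (rule that[of "fst \<circ> f" "snd \<circ> f"])
    show "degree ((fst \<circ> f) k) < degree g0" if "k > 0" for k using f[of k] that by (simp add: P_def)
    show "degree ((snd \<circ> f) k) < degree h0" if "k > 0" for k using f[of k] that by (simp add: P_def)
  qed (simp_all add: f0 eq)
qed

text \<open>Transposes a series of polynomials into a polynomial over series. The degree drop at
  positive orders makes the top coefficient the constant series 1.\<close>

lemma monic_from_coefficients:
  fixes g :: "nat \<Rightarrow> 'a :: idom poly"
  assumes "lead_coeff (g 0) = 1" "\<And>k. k > 0 \<Longrightarrow> degree (g k) < degree (g 0)"
  obtains G :: "'a fps poly" where "lead_coeff G = 1" "degree G = degree (g 0)"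
    "\<And>j k. coeff G j $ k = coeff (g k) j"
proof -
  define G where "G = (\<Sum>j\<le>degree (g 0). monom (Abs_fps (\<lambda>k. coeff (g k) j)) j)"
  have cG: "coeff G j $ k = coeff (g k) j" for j k
  proof (cases "j \<le> degree (g 0)")
    case True
    then show ?thesis by (simp add: G_def coeff_sum sum.delta fps_sum_nth if_distrib cong: if_cong)
  next
    case False
    then have "degree (g k) < j" using assms(2)[of k] by (cases "k = 0") auto
    with False show ?thesis by (simp add: G_def coeff_sum coeff_eq_0)
  qed
  have lc: "coeff G (degree (g 0)) = 1"
  proof (rule fps_ext)
    fix k
    show "coeff G (degree (g 0)) $ k = 1 $ k"
      using assms by (cases "k = 0") (auto simp: cG coeff_eq_0)
  qed
  have "degree G = degree (g 0)"
  proof (rule antisym)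
    show "degree G \<le> degree (g 0)" unfolding G_def
      by (intro degree_sum_le) (auto intro: order.trans[OF degree_monom_le])
    show "degree (g 0) \<le> degree G" by (rule le_degree) (simp add: lc)
  qed
  with lc cG that show thesis by metis
qed

theorem hensel_factorization:
  fixes f :: "'a :: field_gcd fps poly"
  assumes "lead_coeff f = 1" "red0 f = g0 * h0" "coprime g0 h0" "lead_coeff g0 = 1" "lead_coeff h0 = 1"
    and "degree g0 > 0" "degree h0 > 0"
  obtains G H where "f = G * H" "lead_coeff G = 1" "degree G = degree g0"
    "lead_coeff H = 1" "degree H = degree h0"
proof -
  define F where "F k = map_poly (\<lambda>a. a $ k) f" for k
  have cF: "coeff (F k) j = coeff f j $ k" for j k by (simp add: F_def coeff_map_poly)
  have F0: "F 0 = g0 * h0" using assms(2) by (simp add: F_def red0_def)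
  have dF: "degree f = degree g0 + degree h0"
  proof -
    have "degree f = degree (F 0)"
      unfolding F_def using assms(1) by (intro map_poly_degree_eq[symmetric]) simp
    then show ?thesis using F0 monic_mult(2)[OF assms(4,5)] by simp
  qed
  have dFk: "degree (F k) < degree g0 + degree h0" if "k > 0" for k
    unfolding F_def using that assms dF
    by (metis map_poly_degree_less add_gr_0 fps_one_nth less_numeral_extra(3))
  obtain g h where gh: "g 0 = g0" "h 0 = h0" "\<And>k. k > 0 \<Longrightarrow> degree (g k) < degree g0"
    "\<And>k. k > 0 \<Longrightarrow> degree (h k) < degree h0" "\<And>k. (\<Sum>i\<le>k. g i * h (k - i)) = F k"
    by (rule hensel_coefficients[where F = F and ?g0.0 = g0 and ?h0.0 = h0])
      (use F0 assms dFk in auto)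
  obtain G where G: "lead_coeff G = 1" "degree G = degree g0" "\<And>j k. coeff G j $ k = coeff (g k) j"
    using monic_from_coefficients[of g] gh assms by auto
  obtain H where H: "lead_coeff H = 1" "degree H = degree h0" "\<And>j k. coeff H j $ k = coeff (h k) j"
    using monic_from_coefficients[of h] gh assms by auto
  have "f = G * H"
  proof (intro poly_eqI fps_ext)
    fix j k
    have "coeff (G * H) j $ k = (\<Sum>a\<le>j. \<Sum>b\<le>k. coeff (g b) a * coeff (h (k - b)) (j - a))"
      by (simp add: coeff_mult fps_sum_nth fps_mult_nth G H atLeast0AtMost)
    also have "\<dots> = (\<Sum>b\<le>k. coeff (g b * h (k - b)) j)"
      unfolding coeff_mult by (rule sum.swap)
    also have "\<dots> = coeff (F k) j" by (simp flip: coeff_sum add: gh)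
    finally show "coeff f j $ k = coeff (G * H) j $ k" by (simp add: cF)
  qed
  with G H that show thesis by blast
qed

subsection \<open>Puiseux roots\<close>

text \<open>For \<open>c = 1\<close> this passes to an \<open>N\<close>-th root of the variable, for
  \<open>N = 1\<close> and a root of unity \<open>c\<close> it is the Galois action on Puiseux
  series, and \<open>c = -1\<close> reaches negative values of the variable.\<close>

definition psub :: "'a :: idom \<Rightarrow> nat \<Rightarrow> 'a fps \<Rightarrow> 'a fps"
  where "psub c N a = a oo (fps_const c * fps_X ^ N)"

lemma psub_hom: "N > 0 \<Longrightarrow> unital_hom (psub c N)"
  by unfold_locales (simp_all add: psub_def fps_compose_add_distrib fps_compose_mult_distrib)

lemma psub_X [simp]: "N > 0 \<Longrightarrow> psub c N fps_X = fps_const c * fps_X ^ N"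
  by (simp add: psub_def)

lemma psub_psub:
  assumes "M > 0" "N > 0"
  shows "psub c N (psub d M a) = psub (d * c ^ M) (M * N) a"
proof -
  have "psub c N (psub d M a) = a oo ((fps_const d * fps_X ^ M) oo (fps_const c * fps_X ^ N))"
    unfolding psub_def by (rule fps_compose_assoc[symmetric]) (use assms in auto)
  also have "(fps_const d * fps_X ^ M) oo (fps_const c * fps_X ^ N) =
      fps_const (d * c ^ M) * fps_X ^ (M * N)"
  proof -
    have "(fps_const d * fps_X ^ M) oo (fps_const c * fps_X ^ N) =
        fps_const d * (fps_const c * fps_X ^ N) ^ M"
      using assms by (simp add: fps_compose_mult_distrib fps_X_power_compose)
    also have "(fps_const c * fps_X ^ N) ^ M = fps_const (c ^ M) * fps_X ^ (M * N)"
      by (simp only: power_mult_distrib fps_const_power mult.commute[of M N] power_mult)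
    finally show ?thesis by (simp only: mult.assoc[symmetric] fps_const_mult)
  qed
  finally show ?thesis by (simp add: psub_def)
qed

lemma psub_nth:
  assumes "N > 0"
  shows "psub c N a $ n = (if N dvd n then c ^ (n div N) * a $ (n div N) else 0)"
proof -
  have "psub c N a $ n = (\<Sum>i=0..n. a $ i * (if n = N * i then c ^ i else 0))"
    unfolding psub_def fps_compose_nth
    by (intro sum.cong) (auto simp: power_mult_distrib fps_const_power simp flip: power_mult)
  also have "\<dots> = (if N dvd n then c ^ (n div N) * a $ (n div N) else 0)"
  proof (cases "N dvd n")
    case True
    then obtain k where k: "n = N * k" ..
    have "(\<Sum>i=0..n. a $ i * (if n = N * i then c ^ i else 0)) =
        (\<Sum>i=0..n. if i = k then a $ k * c ^ k else 0)"
      using assms by (intro sum.cong) (auto simp: k)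
    also have "\<dots> = a $ k * c ^ k" using assms by (simp add: k)
    finally show ?thesis using assms by (simp add: k)
  qed (auto intro!: sum.neutral)
  finally show ?thesis .
qed

lemma psub_nth_mult: "N > 0 \<Longrightarrow> psub c N a $ (N * k) = c ^ k * a $ k"
  by (simp add: psub_nth)

lemma psub_inj:
  fixes c :: "'a :: idom"
  assumes "N > 0" "c \<noteq> 0" "psub c N a = psub c N b"
  shows "a = b"
proof (rule fps_ext)
  fix k
  have "psub c N a $ (N * k) = psub c N b $ (N * k)" using assms by simp
  then show "a $ k = b $ k" using assms(2) unfolding psub_nth_mult[OF assms(1)] by simp
qed

abbreviation psubs :: "'a :: idom \<Rightarrow> nat \<Rightarrow> 'a fps poly \<Rightarrow> 'a fps poly"
  where "psubs c N \<equiv> map_poly (psub c N)"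

lemma psubs_psubs:
  assumes "M > 0" "N > 0"
  shows "psubs c N (psubs d M p) = psubs (d * c ^ M) (M * N) p"
proof -
  interpret a: unital_hom "psub c N" by (rule psub_hom[OF assms(2)])
  interpret b: unital_hom "psub d M" by (rule psub_hom[OF assms(1)])
  show ?thesis
    using assms by (subst map_poly_map_poly) (auto simp: psub_psub o_def)
qed

section \<open>Tschirnhaus shift and Newton polygon\<close>

lemma pcompose_conv_sum: "pcompose p q = (\<Sum>i\<le>degree p. smult (coeff p i) (q ^ i))"
proof -
  have "degree (map_poly (\<lambda>x. [:x:]) p) = degree p" by (intro degree_map_poly) simp
  then show ?thesis by (simp add: pcompose_altdef poly_altdef coeff_map_poly)
qed

text \<open>Serves to choose the shift \<open>c\<close> that makes the subleading coefficient
  vanish.\<close>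

lemma coeff_pcompose_shift:
  fixes p :: "'a :: idom poly"
  assumes "lead_coeff p = 1" "degree p = Suc n"
  shows "coeff (pcompose p [:c, 1:]) n = coeff p n + of_nat (Suc n) * c"
proof -
  have "coeff (pcompose p [:c, 1:]) n = (\<Sum>i\<le>Suc n. coeff p i * coeff ([:c, 1:] ^ i) n)"
    by (simp add: pcompose_conv_sum assms coeff_sum)
  also have "\<dots> = (\<Sum>i<n. coeff p i * coeff ([:c, 1:] ^ i) n) + coeff p n + of_nat (Suc n) * c"
    using assms by (simp add: coeff_linear_poly_power coeff_linear_power flip: lessThan_Suc_atMost del: power_Suc)
  also have "(\<Sum>i<n. coeff p i * coeff ([:c, 1:] ^ i) n) = 0"
    by (intro sum.neutral) (simp add: coeff_eq_0 degree_linear_power)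
  finally show ?thesis by simp
qed

lemma fps_X_power_cofactor:
  fixes a :: "'a :: comm_ring_1 fps"
  assumes "\<And>j. j < n \<Longrightarrow> a $ j = 0"
  shows "a = fps_X ^ n * fps_shift n a"
  by (rule fps_ext) (simp add: fps_X_power_mult_nth assms)

text \<open>The full power of one root is split off. If nothing remained, \<open>p\<close> would be
  the \<open>n\<close>-th power of a linear factor, and the vanishing subleading coefficient would
  force the root to be 0, contrary to \<open>p \<noteq> monom 1 n\<close>.\<close>

lemma split_off_root:
  fixes p :: "complex poly"
  assumes "lead_coeff p = 1" "degree p = n" "n > 0" "coeff p (n - 1) = 0" "p \<noteq> monom 1 n"
  obtains g h where "p = g * h" "coprime g h" "lead_coeff g = 1" "lead_coeff h = 1"
    "degree g > 0" "degree h > 0"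
proof -
  have p0: "p \<noteq> 0" using assms by auto
  have "\<not> constant (poly p)" using assms by (simp add: constant_degree)
  then obtain z where z: "poly p z = 0" using fundamental_theorem_of_algebra by blast
  obtain h where h: "p = [:- z, 1:] ^ order z p * h" "\<not> [:- z, 1:] dvd h"
    using order_decomp[OF p0] by blast
  define g where "g = [:- z, 1:] ^ order z p"
  have op: "order z p > 0" using z p0 by (simp add: order_root)
  have lg: "lead_coeff g = 1" "degree g = order z p"
    by (simp_all add: g_def degree_linear_power coeff_linear_power)
  have lh: "lead_coeff h = 1" using monic_cofactor[of g h] h lg assms(1) by (simp add: g_def)
  have cop: "coprime g h"
  proof -
    have irr: "irreducible [:- z, 1:]" by (rule irreducible_linear_field_poly) simp
    have "coprime [:- z, 1:] h"
    proof (rule coprimeI)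
      fix d assume d: "d dvd [:- z, 1:]" "d dvd h"
      then obtain e where e: "[:- z, 1:] = d * e" by blast
      show "is_unit d"
        using irreducibleD[OF irr e] d h(2) unfolding e by (metis mult_unit_dvd_iff)
    qed
    then show ?thesis unfolding g_def by (rule coprime_power_left_iff[THEN iffD2, OF disjI1])
  qed
  have "degree h > 0"
  proof (rule ccontr)
    assume "\<not> degree h > 0"
    then have "h = 1" using lh by (metis degree_eq_zeroE lead_coeff_pCons(2) neq0_conv one_pCons)
    then have pz: "p = [:- z, 1:] ^ n" using h(1) lg assms(2) by (simp add: g_def)
    have "coeff p (n - 1) = of_nat n * (- z)"
      unfolding pz using \<open>n > 0\<close> coeff_linear_poly_power[of "n - 1" n "- z" 1]
      by (cases n) (simp_all del: power_Suc)
    then have "z = 0" using assms by simp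
    then have "p = monom 1 n" using pz by (simp add: monom_altdef)
    then show False using assms by simp
  qed
  with that[of g h] h lg lh cop op show thesis by (simp add: g_def)
qed

text \<open>\<open>Q\<close> comes from \<open>P\<close> by substituting the \<open>q\<close>-th
  power for the variable, scaling the unknown by the \<open>p\<close>-th power, and dividing by the
  common factor. Roots of \<open>Q\<close> are transported back by undoing the scaling.\<close>

lemma poly_psubs_scale:
  fixes P Q :: "'a :: idom fps poly"
  assumes "N > 0" "q > 0" "degree Q = n" "degree P = n"
    and "\<forall>i\<le>n. psub 1 q (coeff P i) = fps_X ^ (p * (n - i)) * coeff Q i"
    and "poly (psubs 1 N Q) \<phi> = 0"
  shows "poly (psubs 1 (q * N) P) (fps_X ^ (N * p) * \<phi>) = 0"
proof -
  interpret N: unital_hom "psub (1 :: 'a) N" using assms by (intro psub_hom)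
  interpret qN: unital_hom "psub (1 :: 'a) (q * N)" using assms by (intro psub_hom) simp
  have poly_sum: "poly (map_poly h R) x = (\<Sum>i\<le>n. h (coeff R i) * x ^ i)"
    if "h 0 = 0" "degree R = n" for h and R :: "'a fps poly" and x :: "'a fps"
  proof -
    have "degree (map_poly h R) \<le> n" using that map_poly_degree_leq[of h R] by simp
    then have "poly (map_poly h R) x = (\<Sum>i\<le>n. coeff (map_poly h R) i * x ^ i)"
      unfolding poly_altdef by (intro sum.mono_neutral_left) (auto simp: coeff_eq_0)
    then show ?thesis using that by (simp add: coeff_map_poly)
  qed
  have "psub 1 (q * N) (coeff P i) * (fps_X ^ (N * p) * \<phi>) ^ i =
      fps_X ^ (N * p * n) * (psub 1 N (coeff Q i) * \<phi> ^ i)" if "i \<le> n" for i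
  proof -
    have "psub 1 (q * N) (coeff P i) = psub 1 N (psub 1 q (coeff P i))"
      using assms by (simp add: psub_psub)
    also have "\<dots> = fps_X ^ (N * (p * (n - i))) * psub 1 N (coeff Q i)"
      using assms that by (simp add: N.mult N.power power_mult)
    finally have "psub 1 (q * N) (coeff P i) * (fps_X ^ (N * p) * \<phi>) ^ i =
       (fps_X ^ (N * (p * (n - i))) * (fps_X ^ (N * p)) ^ i) * (psub 1 N (coeff Q i) * \<phi> ^ i)"
      by (simp add: power_mult_distrib)
    also have "fps_X ^ (N * (p * (n - i))) * (fps_X ^ (N * p)) ^ i = (fps_X ^ (N * p * n) :: 'a fps)"
    proof -
      have "N * (p * (n - i)) + N * p * i = N * p * n"
        using that by (metis add_mult_distrib2 le_add_diff_inverse2 mult.assoc)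
      then show ?thesis by (simp only: power_mult[symmetric] power_add[symmetric])
    qed
    finally show ?thesis .
  qed
  then have "poly (psubs 1 (q * N) P) (fps_X ^ (N * p) * \<phi>) =
      fps_X ^ (N * p * n) * poly (psubs 1 N Q) \<phi>"
    using assms by (simp add: poly_sum flip: sum_distrib_left)
  then show ?thesis using assms by simp
qed

text \<open>The slope \<open>p / q\<close> is the least ratio of order to codegree among the nonzero
  lower coefficients. Minimality makes every coefficient divisible by the required power, and the
  index where the minimum is attained keeps a nonzero coefficient in the reduction.\<close>

lemma minimal_slope:
  fixes P :: "'a :: idom fps poly"
  assumes "lead_coeff P = 1" "degree P = n" "P \<noteq> monom 1 n"
  obtains p q Q where "q > 0" "lead_coeff Q = 1" "degree Q = n"
    "\<forall>i\<le>n. psub 1 q (coeff P i) = fps_X ^ (p * (n - i)) * coeff Q i"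
    "red0 Q \<noteq> monom 1 n"
proof -
  define I where "I = {i. i < n \<and> coeff P i \<noteq> 0}"
  have "I \<noteq> {}"
  proof
    assume I: "I = {}"
    have "coeff P i = coeff (monom 1 n) i" for i
    proof -
      consider "i < n" | "i = n" | "i > n" by linarith
      then show ?thesis using I assms by cases (auto simp: I_def coeff_eq_0)
    qed
    then have "P = monom 1 n" by (intro poly_eqI)
    with assms show False by simp
  qed
  have "finite I" by (simp add: I_def)
  define s where "s i = real (subdegree (coeff P i)) / real (n - i)" for i
  obtain k where k: "k \<in> I" "\<And>i. i \<in> I \<Longrightarrow> s k \<le> s i"
    using arg_min_if_finite[OF \<open>finite I\<close> \<open>I \<noteq> {}\<close>, of s] by (metis not_less)
  define p where "p = subdegree (coeff P k)"
  define q where "q = n - k"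
  have q: "q > 0" using k by (auto simp: q_def I_def)
  interpret q: unital_hom "psub (1 :: 'a) q" using q by (rule psub_hom)
  have ord: "p * (n - i) \<le> subdegree (coeff P i) * q" if "i \<in> I" for i
  proof -
    have "real p / real q \<le> real (subdegree (coeff P i)) / real (n - i)"
      using k(2)[OF that] by (simp add: s_def p_def q_def)
    then have "real p * real (n - i) \<le> real (subdegree (coeff P i)) * real q"
      using that q by (simp add: field_simps I_def)
    then show ?thesis by (simp flip: of_nat_mult)
  qed
  define d where "d i = fps_shift (p * (n - i)) (psub 1 q (coeff P i))" for i
  define Q where "Q = (\<Sum>i\<le>n. monom (d i) i)"
  have cQ: "coeff Q i = d i" if "i \<le> n" for i
    using that by (simp add: Q_def coeff_sum if_distrib sum.delta cong: if_cong)
  have dn: "d n = 1" using assms by (simp add: d_def)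
  have dQ: "degree Q = n"
  proof (rule antisym)
    show "degree Q \<le> n" unfolding Q_def
      by (intro degree_sum_le) (auto intro: order.trans[OF degree_monom_le])
    show "n \<le> degree Q" by (rule le_degree) (simp add: cQ dn)
  qed
  have lQ: "lead_coeff Q = 1" using dQ cQ dn by simp
  have eq: "psub 1 q (coeff P i) = fps_X ^ (p * (n - i)) * coeff Q i" if "i \<le> n" for i
    unfolding cQ[OF that] d_def
  proof (rule fps_X_power_cofactor)
    fix j assume j: "j < p * (n - i)"
    then have "i \<noteq> n" by auto
    show "psub 1 q (coeff P i) $ j = 0"
    proof (cases "i \<in> I")
      case True
      then have "j div q < subdegree (coeff P i)"
        using ord[OF True] j q by (simp add: div_less_iff_less_mult)
      then show ?thesis by (simp add: psub_nth[OF q] nth_less_subdegree_zero)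
    next
      case False
      with that \<open>i \<noteq> n\<close> have "coeff P i = 0" by (simp add: I_def)
      then show ?thesis by simp
    qed
  qed
  have "coeff (red0 Q) k = d k $ 0"
    using k by (simp add: red0_def coeff_map_poly cQ I_def)
  also have "\<dots> = psub 1 q (coeff P k) $ (q * p)" by (simp add: d_def q_def mult.commute)
  also have "\<dots> \<noteq> 0" using k by (simp add: psub_nth_mult[OF q] p_def I_def)
  finally have "red0 Q \<noteq> monom 1 n" using k by (auto simp: I_def)
  with q lQ dQ eq that show thesis by blast
qed

text \<open>After killing the subleading coefficient and rescaling along the minimal slope, the reduction
  has two distinct roots, so Hensel's lemma lowers the degree.\<close>

theorem puiseux_root:
  fixes P :: "complex fps poly"
  assumes "lead_coeff P = 1" "degree P > 0"
  shows "\<exists>N>0. \<exists>\<phi>. poly (psubs 1 N P) \<phi> = 0"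
  using assms
proof (induction "degree P" arbitrary: P rule: less_induct)
  case less
  define n where "n = degree P"
  define c where "c = - coeff P (n - 1) * fps_const (1 / of_nat n)"
  define R where "R = pcompose P [:c, 1:]"
  have n: "n > 0" using less by (simp add: n_def)
  have lR: "lead_coeff R = 1" "degree R = n"
  proof -
    show "degree R = n" by (simp add: R_def n_def degree_pcompose)
    show "lead_coeff R = 1"
      unfolding R_def using less.prems by (subst lead_coeff_comp) auto
  qed
  have cR: "coeff R (n - 1) = 0"
  proof -
    have "degree P = Suc (n - 1)" using n by (simp add: n_def)
    from coeff_pcompose_shift[OF less.prems(1) this, of c]
    have "coeff R (n - 1) = coeff P (n - 1) + of_nat n * c"
      unfolding R_def using n by (simp only: Suc_diff_1)
    also have "of_nat n * c = - coeff P (n - 1) * (of_nat n * fps_const (1 / of_nat n))"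
      by (simp add: c_def)
    also have "of_nat n * fps_const (1 / of_nat n) = (1 :: complex fps)"
      unfolding fps_of_nat[symmetric] fps_const_mult using n by simp
    finally show ?thesis by simp
  qed
  have "\<exists>N>0. \<exists>\<phi>. poly (psubs 1 N R) \<phi> = 0"
  proof (cases "R = monom 1 n")
    case True
    then have "poly (psubs 1 1 R) 0 = 0" using n by (simp add: map_poly_monom psub_def poly_monom)
    then show ?thesis by blast
  next
    case False
    obtain p q Q where Q: "q > 0" "lead_coeff Q = 1" "degree Q = n"
      "\<forall>i\<le>n. psub 1 q (coeff R i) = fps_X ^ (p * (n - i)) * coeff Q i"
      "red0 Q \<noteq> monom 1 n"
      by (rule minimal_slope[OF lR False])
    interpret q: unital_hom "psub (1 :: complex) q" by (rule psub_hom[OF Q(1)])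
    have dr: "degree (red0 Q) = n" "lead_coeff (red0 Q) = 1"
    proof -
      show 1: "degree (red0 Q) = n"
        unfolding red0_def using Q(2,3) by (subst map_poly_degree_eq) simp_all
      show "lead_coeff (red0 Q) = 1" unfolding 1 using Q(2,3) by (simp add: red0_def coeff_map_poly)
    qed
    \<comment> \<open>The rescaling changes each coefficient by a power of the variable only, so the
      effect of the shift is preserved.\<close>
    have "coeff Q (n - 1) = 0"
      using Q(4)[rule_format, of "n - 1"] cR by simp
    then have "coeff (red0 Q) (n - 1) = 0" by (simp add: red0_def coeff_map_poly)
    from split_off_root[OF dr(2) dr(1) n this Q(5)]
    obtain g h where gh: "red0 Q = g * h" "coprime g h" "lead_coeff g = 1" "lead_coeff h = 1"
      "degree g > 0" "degree h > 0" by blast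
    from hensel_factorization[OF Q(2) gh]
    obtain G H where GH: "Q = G * H" "lead_coeff G = 1" "degree G = degree g" "lead_coeff H = 1"
      "degree H = degree h" by blast
    have "degree G < degree P"
      using monic_mult(2)[OF GH(2,4)] GH(1,3,5) gh(5,6) Q(3) by (simp add: n_def)
    from less.hyps[OF this GH(2)]
    obtain N \<phi> where N: "N > 0" "poly (psubs 1 N G) \<phi> = 0" using GH(3) gh(5) by auto
    interpret N: unital_hom "psub (1 :: complex) N" by (rule psub_hom[OF N(1)])
    interpret m: unital_hom "psubs (1 :: complex) N" by (rule N.map_poly_hom)
    have "poly (psubs 1 N Q) \<phi> = 0" using N(2) by (simp add: GH(1) m.mult)
    from poly_psubs_scale[OF N(1) Q(1) Q(3) lR(2) Q(4) this]
    show ?thesis using N(1) Q(1) by (intro exI[of _ "q * N"]) auto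
  qed
  then obtain N \<phi> where N: "N > 0" "poly (psubs 1 N R) \<phi> = 0" by blast
  interpret N: unital_hom "psub (1 :: complex) N" by (rule psub_hom[OF N(1)])
  have "poly (psubs 1 N P) (psub 1 N c + \<phi>) = 0"
    using N(2) by (simp add: R_def N.map_poly_pcompose poly_pcompose map_poly_pCons add.commute)
  with N show ?case by blast
qed

subsection \<open>Formally nonnegative polynomials over the power series ring\<close>

definition fcnj :: "complex fps \<Rightarrow> complex fps"
  where "fcnj a = Abs_fps (\<lambda>n. cnj (a $ n))"

lemma fcnj_nth [simp]: "fcnj a $ n = cnj (a $ n)"
  by (simp add: fcnj_def)

interpretation fcnj: unital_hom fcnj
proof
  show "fcnj 1 = 1" by (rule fps_ext) simp
qed (auto simp: fps_eq_iff fps_mult_nth)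

abbreviation cjp :: "complex fps poly \<Rightarrow> complex fps poly"
  where "cjp \<equiv> map_poly fcnj"

interpretation cjp: unital_hom cjp
  by (rule fcnj.map_poly_hom)

lemma fcnj_fcnj [simp]: "fcnj (fcnj a) = a"
  by (simp add: fps_eq_iff)

lemma cjp_cjp [simp]: "cjp (cjp p) = p"
  by (simp add: map_poly_map_poly o_def)

lemma fcnj_X [simp]: "fcnj (fps_X ^ k) = fps_X ^ k"
  by (simp add: fps_eq_iff)

lemma fcnj_psub: "N > 0 \<Longrightarrow> fcnj (psub c N a) = psub (cnj c) N (fcnj a)"
  by (simp add: fps_eq_iff psub_nth)

lemma fcnj_poly_psubs:
  assumes "N > 0"
  shows "fcnj (poly (psubs c N p) x) = poly (psubs (cnj c) N (cjp p)) (fcnj x)"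
proof -
  interpret c: unital_hom "psub c N" by (rule psub_hom[OF assms])
  interpret cc: unital_hom "psub (cnj c) N" by (rule psub_hom[OF assms])
  have "cjp (psubs c N p) = psubs (cnj c) N (cjp p)"
    by (simp add: map_poly_map_poly o_def fcnj_psub[OF assms])
  then show ?thesis by (simp flip: fcnj.poly_map_poly)
qed

text \<open>On real series this is nonnegativity for infinitely small positive values of the
  variable. Quantifying over every \<open>m\<close> with vanishing earlier coefficients spares a
  separate case for the zero series.\<close>

definition lead_nonneg :: "complex fps \<Rightarrow> bool"
  where "lead_nonneg a \<longleftrightarrow> (\<forall>m. (\<forall>j<m. a $ j = 0) \<longrightarrow> 0 \<le> Re (a $ m))"

text \<open>Nonnegativity along all real formal curves \<open>t = \<plusminus>s\<^sup>N\<close>, \<open>r = \<psi>(s)\<close>.\<close>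

definition formally_psd :: "complex fps poly \<Rightarrow> bool"
  where "formally_psd f \<longleftrightarrow> (\<forall>\<psi> \<epsilon> N. fcnj \<psi> = \<psi> \<longrightarrow> \<epsilon> \<in> {1, -1} \<longrightarrow> N > 0 \<longrightarrow>
    lead_nonneg (poly (psubs \<epsilon> N f) \<psi>))"

section \<open>Perturbing formal curves\<close>

lemma fps_low_order_mult:
  fixes a b :: "'a :: comm_ring_1 fps"
  assumes "\<And>j. j < m \<Longrightarrow> a $ j = 0" "\<And>j. j < n \<Longrightarrow> b $ j = 0"
  shows "\<And>j. j < m + n \<Longrightarrow> (a * b) $ j = 0" "(a * b) $ (m + n) = a $ m * b $ n"
proof -
  have "a * b = fps_X ^ (m + n) * (fps_shift m a * fps_shift n b)"
    using fps_X_power_cofactor[of m a, OF assms(1)] fps_X_power_cofactor[of n b, OF assms(2)]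
    by (metis (no_types, opaque_lifting) mult.assoc mult.left_commute power_add)
  then show "\<And>j. j < m + n \<Longrightarrow> (a * b) $ j = 0" "(a * b) $ (m + n) = a $ m * b $ n"
    by (simp_all add: fps_X_power_mult_nth)
qed

lemma diff_dvd_poly_diff:
  fixes p :: "'a :: comm_ring_1 poly"
  shows "x - y dvd poly p x - poly p y"
proof (induction p)
  case (pCons a p)
  have "poly (pCons a p) x - poly (pCons a p) y = x * (poly p x - poly p y) + (x - y) * poly p y"
    by (simp add: algebra_simps)
  with pCons.IH show ?case by simp
qed simp

lemma poly_fps_cong:
  fixes p :: "'a :: comm_ring_1 fps poly"
  assumes "\<And>j. j < M \<Longrightarrow> x $ j = y $ j" "j < M"
  shows "poly p x $ j = poly p y $ j"
proof -
  have "x - y = fps_X ^ M * fps_shift M (x - y)"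
    using assms(1) by (intro fps_X_power_cofactor) simp
  then obtain k where "poly p x - poly p y = fps_X ^ M * (fps_shift M (x - y) * k)"
    using diff_dvd_poly_diff[of x y p] by (metis dvdE mult.assoc)
  then have "(poly p x - poly p y) $ j = 0" using assms(2) by (simp add: fps_X_power_mult_nth)
  then show ?thesis by simp
qed

lemma poly_fps_X_power_perturb:
  fixes p :: "'a :: comm_ring_1 fps poly"
  assumes "j < M"
  shows "poly p (x + fps_const c * fps_X ^ M) $ j = poly p x $ j"
  using assms by (intro poly_fps_cong[of M]) (simp_all add: fps_X_power_mult_right_nth)

text \<open>At a simple root the sign would change: moving \<open>\<psi>\<close> by plus or minus a
  high power of the parameter gives values with opposite leading coefficients.\<close>

lemma formally_psd_double_root:
  assumes psd: "formally_psd f" and real: "cjp f = f" "fcnj \<psi> = \<psi>"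
    and \<epsilon>: "\<epsilon> \<in> {1, -1}" and N: "N > 0" and root: "poly (psubs \<epsilon> N f) \<psi> = 0"
  shows "poly (psubs \<epsilon> N (pderiv f)) \<psi> = 0"
proof (rule ccontr)
  interpret e: unital_hom "psub \<epsilon> N" by (rule psub_hom[OF N])
  have c\<epsilon>: "cnj \<epsilon> = \<epsilon>" using \<epsilon> by auto
  define d where "d = poly (psubs \<epsilon> N (pderiv f)) \<psi>"
  define k where "k = subdegree d"
  assume "poly (psubs \<epsilon> N (pderiv f)) \<psi> \<noteq> 0"
  then have dk: "d $ k \<noteq> 0" by (simp add: d_def k_def)
  obtain F where F: "psubs \<epsilon> N f = [:- \<psi>, 1:] * F" using root by (auto simp: poly_eq_0_iff_dvd)
  have d: "d = poly F \<psi>"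
    unfolding d_def e.pderiv_map_poly[symmetric] F pderiv_mult by (simp add: pderiv_pCons)
  have "fcnj d = d"
    unfolding d_def fcnj_poly_psubs[OF N] fcnj.pderiv_map_poly[symmetric] using real c\<epsilon> by simp
  then have "cnj (d $ k) = d $ k" by (metis fcnj_nth)
  then have Im: "Im (d $ k) = 0" by (simp add: complex_eq_iff)
  have "0 \<le> Re (c * d $ k)" if c: "c \<in> {1, -1}" for c
  proof -
    \<comment> \<open>One order above that of \<open>d\<close>, so the cofactor \<open>F\<close>
      keeps its coefficients up to index \<open>k\<close> and its leading coefficient stays
      \<open>d $ k\<close>.\<close>
    define \<delta> where "\<delta> = fps_const c * fps_X ^ Suc k"
    have "fcnj (fps_const c) = fps_const c" using c by (auto simp: fps_eq_iff)
    then have "fcnj (\<psi> + \<delta>) = \<psi> + \<delta>"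
      by (simp add: \<delta>_def fcnj.add fcnj.mult real del: power_Suc)
    then have nn: "lead_nonneg (poly (psubs \<epsilon> N f) (\<psi> + \<delta>))"
      using psd \<epsilon> N unfolding formally_psd_def by blast
    have eq: "poly (psubs \<epsilon> N f) (\<psi> + \<delta>) = \<delta> * poly F (\<psi> + \<delta>)"
      by (simp add: F algebra_simps)
    have low: "poly F (\<psi> + \<delta>) $ j = d $ j" if "j \<le> k" for j
      unfolding d \<delta>_def using that by (intro poly_fps_X_power_perturb) simp
    have z1: "\<delta> $ j = 0" if "j < Suc k" for j
      using that by (simp add: \<delta>_def fps_X_power_mult_right_nth del: power_Suc)
    have z2: "poly F (\<psi> + \<delta>) $ j = 0" if "j < k" for j
      using low[of j] that nth_less_subdegree_zero[of j d] by (simp add: k_def)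
    have "\<delta> $ Suc k = c" by (simp add: \<delta>_def del: power_Suc)
    then have "(\<delta> * poly F (\<psi> + \<delta>)) $ (Suc k + k) = c * d $ k"
      using fps_low_order_mult(2)[of "Suc k" \<delta> k, OF z1 z2] low by simp
    moreover have "\<forall>j < Suc k + k. (\<delta> * poly F (\<psi> + \<delta>)) $ j = 0"
      using fps_low_order_mult(1)[of "Suc k" \<delta> k, OF z1 z2] by blast
    ultimately show ?thesis using nn unfolding lead_nonneg_def eq by metis
  qed
  from this[of 1] this[of "-1"] Im dk show False by (simp add: complex_eq_iff)
qed

text \<open>Along a real curve \<open>P * cjp P\<close> takes the value \<open>s * fcnj s\<close>,
  whose leading coefficient is positive unless \<open>s = 0\<close>. Curves with
  \<open>s = 0\<close> are avoided by adding a power \<open>fps_X ^ k\<close> with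
  \<open>k > m\<close>: it leaves the coefficients up to \<open>m\<close> unchanged, and a nonzero
  polynomial has only finitely many roots.\<close>

lemma formally_psd_cofactor:
  assumes psd: "formally_psd (P * cjp P * f)" and P: "lead_coeff P = 1"
  shows "formally_psd f"
  unfolding formally_psd_def lead_nonneg_def
proof (intro allI impI)
  fix \<psi> \<epsilon> N m
  assume \<psi>: "fcnj \<psi> = \<psi>" and \<epsilon>: "\<epsilon> \<in> {1, -1 :: complex}" and N: "N > 0"
    and low: "\<forall>j<m. poly (psubs \<epsilon> N f) \<psi> $ j = 0"
  interpret e: unital_hom "psub \<epsilon> N" by (rule psub_hom[OF N])
  interpret me: unital_hom "psubs \<epsilon> N" by (rule e.map_poly_hom)
  have c\<epsilon>: "cnj \<epsilon> = \<epsilon>" using \<epsilon> by auto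
  define S where "S = psubs \<epsilon> N P"
  have "S \<noteq> 0" using e.degree_map_poly_monic(2)[OF P] by (auto simp: S_def)
  then have "finite {x. poly S x = 0}" by (rule poly_roots_finite)
  moreover have "inj_on (\<lambda>k. \<psi> + fps_X ^ k) {m<..}"
    by (auto simp: inj_on_def fps_X_power_iff fps_eq_iff split: if_splits)
  then have "infinite ((\<lambda>k. \<psi> + fps_X ^ k) ` {m<..})"
    by (simp add: finite_image_iff infinite_Ioi)
  ultimately have "\<not> (\<lambda>k. \<psi> + fps_X ^ k) ` {m<..} \<subseteq> {x. poly S x = 0}"
    using finite_subset by blast
  then obtain k where k: "k > m" "poly S (\<psi> + fps_X ^ k) \<noteq> 0" by auto
  define x where "x = \<psi> + fps_X ^ k"
  define s where "s = poly S x"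
  define a where "a = poly (psubs \<epsilon> N f) x"
  define n where "n = subdegree s"
  have x: "fcnj x = x" by (simp add: x_def \<psi> fcnj.add)
  have a: "a $ j = poly (psubs \<epsilon> N f) \<psi> $ j" if "j \<le> m" for j
    using that k poly_fps_X_power_perturb[of j k _ \<psi> 1] by (simp add: a_def x_def)
  have "poly (psubs \<epsilon> N (P * cjp P * f)) x = s * fcnj s * a"
    using fcnj_poly_psubs[OF N, of \<epsilon> P x] by (simp add: me.mult s_def S_def a_def x c\<epsilon>)
  then have nn: "lead_nonneg (s * fcnj s * a)"
    using psd x \<epsilon> N unfolding formally_psd_def by metis
  have s0: "s $ j = 0" "fcnj s $ j = 0" if "j < n" for j
  proof -
    show "s $ j = 0" using that unfolding n_def by (rule nth_less_subdegree_zero)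
    then show "fcnj s $ j = 0" by simp
  qed
  have a0: "\<And>j. j < m \<Longrightarrow> a $ j = 0" using a low by simp
  note ss = fps_low_order_mult[of n s n "fcnj s", OF s0]
  note ssa = fps_low_order_mult[of "n + n" "s * fcnj s" m a, OF ss(1) a0]
  have "0 \<le> Re ((s * fcnj s * a) $ (n + n + m))"
    using nn ssa(1) unfolding lead_nonneg_def by blast
  also have "(s * fcnj s * a) $ (n + n + m) = s $ n * cnj (s $ n) * a $ m"
    using ssa(2) ss(2) by simp
  also have "s $ n * cnj (s $ n) = of_real ((cmod (s $ n))\<^sup>2)"
    by (rule complex_norm_square[symmetric])
  finally have "0 \<le> (cmod (s $ n))\<^sup>2 * Re (a $ m)" by simp
  moreover have "s $ n \<noteq> 0" using k by (simp add: n_def s_def x_def)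
  ultimately have "0 \<le> Re (a $ m)" by (simp add: zero_le_mult_iff)
  then show "0 \<le> Re (poly (psubs \<epsilon> N f) \<psi> $ m)" using a by simp
qed

section \<open>The Galois orbit of a Puiseux root\<close>

lemma psub_compress:
  assumes "N > 0" "\<And>m. a $ m \<noteq> 0 \<Longrightarrow> N dvd m"
  shows "psub 1 N (Abs_fps (\<lambda>n. a $ (N * n))) = a"
proof (rule fps_ext)
  fix m
  show "psub 1 N (Abs_fps (\<lambda>n. a $ (N * n))) $ m = a $ m"
    using assms by (cases "N dvd m") (auto simp: psub_nth)
qed

lemma psub_1_nth: "psub c 1 a $ n = c ^ n * a $ n"
  by (simp add: psub_nth)

lemma primitive_root_power_eq_1:
  assumes "N > 0" "cis (2 * pi / real N) ^ n = 1"
  shows "N dvd n"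
proof -
  have "cis (2 * pi / real N) ^ N = 1" using assms by (simp add: DeMoivre)
  then have "cis (2 * pi / real N) ^ n = cis (2 * pi / real N) ^ (n mod N)"
    using mult_div_mod_eq[of N n] by (metis mult_1 power_add power_mult power_one)
  then have "cis (2 * pi * real (n mod N) / real N) = cis (2 * pi * real 0 / real N)"
    using assms(2) by (simp add: DeMoivre mult_ac)
  then have "n mod N = 0"
    using bij_betw_roots_unity[OF assms(1)] assms(1) unfolding bij_betw_def inj_on_def
    by (metis lessThan_iff mod_less_divisor)
  then show ?thesis by auto
qed

text \<open>\<open>N\<close> is the least ramification index of any root of \<open>f\<close>; this
  is what makes the \<open>N\<close> conjugates of \<open>\<phi>\<close> distinct.\<close>

locale puiseux_orbit =
  fixes f :: "complex fps poly" and N :: nat and \<phi> :: "complex fps"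
  assumes N: "N > 0" and root: "poly (psubs 1 N f) \<phi> = 0"
    and minimal: "\<And>M \<psi>. 0 < M \<Longrightarrow> M < N \<Longrightarrow> poly (psubs 1 M f) \<psi> \<noteq> 0"
begin

definition \<zeta> :: complex where "\<zeta> = cis (2 * pi / real N)"

definition conjugate :: "nat \<Rightarrow> complex fps" where "conjugate k = psub (\<zeta> ^ k) 1 \<phi>"

lemma zeta_pow_N [simp]: "\<zeta> ^ N = 1"
  using N by (simp add: \<zeta>_def DeMoivre)

sublocale sN: unital_hom "psub (1 :: complex) N" by (rule psub_hom[OF N])
sublocale msN: unital_hom "psubs (1 :: complex) N" by (rule sN.map_poly_hom)
sublocale pN: unital_hom "\<lambda>p. poly (psubs (1 :: complex) N p) x" for x by (rule sN.poly_hom)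

text \<open>Stated for arbitrary \<open>c\<close> because two cases matter: \<open>c ^ N = 1\<close>
  permutes the roots, while \<open>c ^ N = -1\<close> passes from \<open>t = s ^ N\<close> to
  \<open>t = - s ^ N\<close>.\<close>

lemma rotate: "poly (psubs (c ^ N) N A) (psub c 1 x) = psub c 1 (poly (psubs 1 N A) x)"
proof -
  interpret c: unital_hom "psub c 1" by (rule psub_hom) simp
  have "psubs c 1 (psubs 1 N A) = psubs (c ^ N) N A" using N by (simp add: psubs_psubs)
  then show ?thesis by (metis c.poly_map_poly)
qed

lemma root_conjugate:
  assumes "poly (psubs 1 N A) \<phi> = 0"
  shows "poly (psubs 1 N A) (conjugate k) = 0"
proof -
  have "(\<zeta> ^ k) ^ N = 1" by (metis power_mult mult.commute power_one zeta_pow_N)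
  then show ?thesis using rotate[of "\<zeta> ^ k" A \<phi>] assms by (simp add: conjugate_def psub_def)
qed

lemma conjugate_0 [simp]: "conjugate 0 = \<phi>"
  by (simp add: conjugate_def psub_def)

text \<open>If two conjugates agreed, only exponents divisible by some divisor \<open>d > 1\<close>
  of \<open>N\<close> could occur in \<open>\<phi>\<close>. Then \<open>\<phi>\<close> would be a
  series in the \<open>d\<close>-th power of the parameter, and \<open>f\<close> would have a root
  of the smaller index \<open>g = N / d\<close>.\<close>

lemma conjugate_neq:
  assumes "j < k" "k < N"
  shows "conjugate j \<noteq> conjugate k"
proof
  assume eq: "conjugate j = conjugate k"
  define l where "l = k - j"
  define g where "g = gcd l N"
  define d where "d = N div g"
  have l: "0 < l" "l < N" using assms by (auto simp: l_def)
  have g: "0 < g" "g < N" "g * d = N" "d > 0"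
  proof -
    have "g dvd l" "g dvd N" by (simp_all add: g_def)
    then show "0 < g" "g < N" "g * d = N" "d > 0"
      using l N dvd_imp_le[of g l] by (auto simp: d_def dvd_div_eq_0_iff intro: Nat.gr0I)
  qed
  have dvd: "d dvd m" if "\<phi> $ m \<noteq> 0" for m
  proof -
    have "(\<zeta> ^ j) ^ m * \<phi> $ m = (\<zeta> ^ k) ^ m * \<phi> $ m"
      using arg_cong[OF eq, of "\<lambda>a. a $ m"] by (simp add: conjugate_def psub_1_nth del: One_nat_def)
    then have "\<zeta> ^ (j * m) = \<zeta> ^ (k * m)" using that by (simp add: power_mult)
    also have "k * m = j * m + l * m" using assms by (simp add: l_def diff_mult_distrib)
    finally have "\<zeta> ^ (j * m) = \<zeta> ^ (j * m) * \<zeta> ^ (l * m)" by (simp add: power_add)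
    then have "\<zeta> ^ (l * m) = 1" by (simp add: \<zeta>_def)
    then have "N dvd l * m" unfolding \<zeta>_def using N by (intro primitive_root_power_eq_1) auto
    then have "N div g dvd (l div g) * m"
    proof -
      have "l = g * (l div g)" "N = g * (N div g)" by (simp_all add: g_def)
      then show ?thesis
        using \<open>N dvd l * m\<close> g(1) by (metis mult.assoc nat_mult_dvd_cancel1)
    qed
    moreover have "coprime (N div g) (l div g)"
      using g l unfolding g_def by (metis div_gcd_coprime gcd.commute less_irrefl)
    ultimately show ?thesis by (simp add: d_def coprime_dvd_mult_right_iff)
  qed
  interpret d: unital_hom "psub (1 :: complex) d" by (rule psub_hom[OF g(4)])
  define \<psi> where "\<psi> = Abs_fps (\<lambda>n. \<phi> $ (d * n))"
  have "\<phi> = psub 1 d \<psi>" unfolding \<psi>_def using dvd g by (intro psub_compress[symmetric]) auto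
  moreover have "psubs 1 N f = psubs 1 d (psubs 1 g f)" using g by (simp add: psubs_psubs)
  ultimately have "psub 1 d (poly (psubs 1 g f) \<psi>) = 0"
    using root by (simp add: d.poly_map_poly)
  then have "poly (psubs 1 g f) \<psi> = 0"
    using psub_inj[OF g(4), of 1 "poly (psubs 1 g f) \<psi>" 0] by simp
  with minimal g show False by blast
qed

lemma inj_conjugate: "inj_on conjugate {..<N}"
  by (rule linorder_inj_onI) (auto simp: conjugate_neq)

definition orbit_poly :: "complex fps poly"
  where "orbit_poly = (\<Prod>k<N. [:- conjugate k, 1:])"

text \<open>Rotation by \<open>\<zeta>\<close> permutes the conjugates cyclically and so fixes
  \<open>orbit_poly\<close>. Its coefficients are therefore series in the \<open>N\<close>-th power
  of the parameter; here they are read as series in the original variable.\<close>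

definition min_poly :: "complex fps poly"
  where "min_poly = map_poly (\<lambda>a. Abs_fps (\<lambda>n. a $ (N * n))) orbit_poly"

lemma orbit_poly_monic: "lead_coeff orbit_poly = 1" "degree orbit_poly = N"
proof -
  have "lead_coeff (\<Prod>k<n. [:- conjugate k, 1:]) = 1 \<and> degree (\<Prod>k<n. [:- conjugate k, 1:]) = n" for n
  proof (induction n)
    case (Suc n)
    let ?p = "\<Prod>k<n. [:- conjugate k, 1:]" and ?q = "[:- conjugate n, 1:]"
    have p: "lead_coeff ?p = 1" "degree ?p = n" and q: "lead_coeff ?q = 1" "degree ?q = 1"
      using Suc by auto
    have "degree (?p * ?q) = Suc n" using monic_mult(2)[OF p(1) q(1)] p(2) q(2) by linarith
    with monic_mult(1)[OF p(1) q(1)] show ?case unfolding prod.lessThan_Suc by blast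
  qed simp
  then show "lead_coeff orbit_poly = 1" "degree orbit_poly = N" unfolding orbit_poly_def by blast+
qed

lemma psubs_min_poly: "psubs 1 N min_poly = orbit_poly"
proof (rule poly_eqI)
  fix i
  interpret z: unital_hom "psub \<zeta> 1" by (rule psub_hom) simp
  interpret mz: unital_hom "psubs \<zeta> 1" by (rule z.map_poly_hom)
  have shift: "psub \<zeta> 1 (conjugate k) = conjugate (Suc k)" for k
    by (simp add: conjugate_def psub_psub mult.commute)
  have "psubs \<zeta> 1 orbit_poly = (\<Prod>k<N. [:- conjugate (Suc k), 1:])"
    unfolding orbit_poly_def mz.prod z.map_poly_linear shift ..
  also have "\<dots> = orbit_poly"
  proof -
    have "(\<Prod>k<Suc M. x k) = (\<Prod>k<Suc M. x (Suc k))" if "x (Suc M) = x 0"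
      for x :: "nat \<Rightarrow> complex fps poly" and M
      unfolding prod.lessThan_Suc_shift[of x] prod.lessThan_Suc[of "\<lambda>k. x (Suc k)"]
      by (simp add: that mult.commute)
    from this[of "\<lambda>k. [:- conjugate k, 1:]" "N - 1"] show ?thesis
      using N by (simp add: orbit_poly_def conjugate_def)
  qed
  finally have inv: "psub \<zeta> 1 (coeff orbit_poly i) = coeff orbit_poly i"
    by (metis coeff_map_poly z.zero)
  have "N dvd m" if "coeff orbit_poly i $ m \<noteq> 0" for m
  proof -
    have "\<zeta> ^ m * coeff orbit_poly i $ m = coeff orbit_poly i $ m"
      using arg_cong[OF inv, of "\<lambda>a. a $ m"] by (simp add: psub_1_nth del: One_nat_def)
    then have "\<zeta> ^ m = 1" using that by simp
    then show ?thesis unfolding \<zeta>_def using N by (intro primitive_root_power_eq_1) auto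
  qed
  then have "psub 1 N (Abs_fps (\<lambda>n. coeff orbit_poly i $ (N * n))) = coeff orbit_poly i"
    using N by (intro psub_compress) auto
  moreover have "Abs_fps (\<lambda>n. (0 :: complex fps) $ (N * n)) = 0" by (simp add: fps_eq_iff)
  ultimately show "coeff (psubs 1 N min_poly) i = coeff orbit_poly i"
    by (simp add: min_poly_def coeff_map_poly)
qed

lemma min_poly_monic: "lead_coeff min_poly = 1" "degree min_poly = N"
proof -
  have "psub 1 N a \<noteq> 0" if "a \<noteq> 0" for a :: "complex fps"
    using psub_inj[OF N, of 1 a 0] that by auto
  then have deg: "degree (psubs (1 :: complex) N min_poly) = degree min_poly"
    by (rule degree_map_poly)
  then show "degree min_poly = N" by (simp add: psubs_min_poly orbit_poly_monic)
  have "psub 1 N (lead_coeff min_poly) = lead_coeff (psubs 1 N min_poly)"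
    unfolding deg by (simp add: coeff_map_poly)
  then have "psub 1 N (lead_coeff min_poly) = psub 1 N 1"
    using orbit_poly_monic by (simp add: psubs_min_poly)
  then show "lead_coeff min_poly = 1" using psub_inj[OF N, of 1] by fastforce
qed

text \<open>The remainder of \<open>A\<close> modulo \<open>min_poly\<close> vanishes at
  \<open>N\<close> distinct conjugates, but its degree is below \<open>N\<close>.\<close>

lemma min_poly_dvd:
  assumes "poly (psubs 1 N A) \<phi> = 0"
  shows "min_poly dvd A"
proof -
  obtain q r where qr: "A = min_poly * q + r" "r = 0 \<or> degree r < degree min_poly"
    using monic_division[OF min_poly_monic(1)] by blast
  have 0: "poly (psubs 1 N min_poly) (conjugate k) = 0" if "k < N" for k
    using that unfolding psubs_min_poly orbit_poly_def poly_prod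
    by (intro prod_zero) auto
  have "poly (psubs 1 N r) (conjugate k) = 0" if "k < N" for k
    using root_conjugate[OF assms, of k] 0[OF that] by (simp add: qr(1) pN.add pN.mult)
  then have sub: "conjugate ` {..<N} \<subseteq> {x. poly (psubs 1 N r) x = 0}" by auto
  have "psubs 1 N r = 0"
  proof (rule ccontr)
    assume nz: "psubs 1 N r \<noteq> 0"
    then have "r \<noteq> 0" by auto
    have "N = card (conjugate ` {..<N})" by (simp add: card_image inj_conjugate)
    also have "\<dots> \<le> card {x. poly (psubs 1 N r) x = 0}"
      by (rule card_mono[OF poly_roots_finite[OF nz] sub])
    also have "\<dots> \<le> degree (psubs 1 N r)" by (rule card_poly_roots_bound[OF nz])
    also have "\<dots> \<le> degree r" by (rule map_poly_degree_leq)
    also have "\<dots> < N" using qr(2) \<open>r \<noteq> 0\<close> by (simp add: min_poly_monic)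
    finally show False by simp
  qed
  then have "r = 0"
    using psub_inj[OF N, of "1 :: complex" _ 0] unfolding poly_eq_iff
    by (metis coeff_0 coeff_map_poly sN.zero zero_neq_one)
  then show ?thesis using qr by simp
qed

lemma pderiv_min_poly_nz: "poly (psubs 1 N (pderiv min_poly)) \<phi> \<noteq> 0"
proof -
  obtain M where M: "N = Suc M" using N by (cases N) auto
  have "orbit_poly = [:- \<phi>, 1:] * (\<Prod>k<M. [:- conjugate (Suc k), 1:])"
    using prod.lessThan_Suc_shift[of "\<lambda>k. [:- conjugate k, 1:]" M]
    by (simp only: orbit_poly_def M[symmetric] conjugate_0)
  then have "poly (pderiv orbit_poly) \<phi> = (\<Prod>k<M. \<phi> - conjugate (Suc k))"
    by (simp add: pderiv_mult pderiv_pCons poly_prod del: mult_pCons_left)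
  moreover have "\<phi> \<noteq> conjugate (Suc k)" if "k < M" for k
    using conjugate_neq[of 0 "Suc k"] that M conjugate_0 by (metis Suc_mono zero_less_Suc)
  ultimately have "poly (pderiv orbit_poly) \<phi> \<noteq> 0" by simp
  then show ?thesis by (simp flip: sN.pderiv_map_poly add: psubs_min_poly)
qed

text \<open>Since \<open>f\<close> is real, \<open>fcnj \<phi>\<close> is a root too. If it were not
  a root of \<open>A\<close>, it would be a conjugate of \<open>\<phi>\<close>, and a rotation would
  make \<open>\<phi>\<close> real. Nonnegativity makes that root of \<open>f\<close> double; as
  \<open>min_poly\<close> has only simple roots, \<open>A\<close> would vanish at
  \<open>\<phi>\<close>, hence at all conjugates, including \<open>fcnj \<phi>\<close>.\<close>

lemma cj_min_poly_dvd_cofactor: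
  assumes psd: "formally_psd f" and real: "cjp f = f" and A: "f = min_poly * A"
  shows "cjp min_poly dvd A"
proof -
  have "poly (psubs 1 N A) (fcnj \<phi>) = 0"
  proof (rule ccontr)
    assume nz: "poly (psubs 1 N A) (fcnj \<phi>) \<noteq> 0"
    have "poly (psubs 1 N f) (fcnj \<phi>) = fcnj (poly (psubs 1 N f) \<phi>)"
      using fcnj_poly_psubs[OF N, of 1 f \<phi>] real by simp
    then have "poly (psubs 1 N min_poly) (fcnj \<phi>) * poly (psubs 1 N A) (fcnj \<phi>) = 0"
      using root unfolding pN.mult[symmetric] A[symmetric] by simp
    then have "poly orbit_poly (fcnj \<phi>) = 0" using nz by (simp add: psubs_min_poly)
    then obtain k where k: "k < N" "fcnj \<phi> = conjugate k"
      by (auto simp: orbit_poly_def poly_prod prod_zero_iff)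
    \<comment> \<open>Since \<open>\<omega>\<^sup>2 = \<zeta>\<^sup>k\<close>, the series \<open>\<phi>(\<omega>s)\<close> is real; it is a root of \<open>f\<close> at \<open>t = \<plusminus>s\<^sup>N\<close>.\<close>
    define \<omega> where "\<omega> = cis (pi * real k / real N)"
    define \<psi> where "\<psi> = psub \<omega> 1 \<phi>"
    have w0: "\<omega> \<noteq> 0" by (simp add: \<omega>_def)
    have "\<omega> ^ 2 = \<zeta> ^ k" by (simp add: \<omega>_def \<zeta>_def DeMoivre mult_ac)
    then have "\<zeta> ^ k * cnj \<omega> = \<omega> * (\<omega> * cnj \<omega>)" by (simp add: power2_eq_square)
    also have "\<omega> * cnj \<omega> = 1" by (simp add: \<omega>_def cis_cnj cis_mult)
    finally have w: "\<zeta> ^ k * cnj \<omega> = \<omega>" by simp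
    have "\<omega> ^ N = cis (real k * pi)" using N by (simp add: \<omega>_def DeMoivre mult_ac)
    also have "\<dots> = (-1) ^ k" by (simp flip: DeMoivre)
    finally have \<epsilon>: "\<omega> ^ N \<in> {1, -1}" by (metis insertCI power_one_over minus_one_power_iff)
    have \<psi>: "fcnj \<psi> = \<psi>"
      unfolding \<psi>_def using k(2) w by (simp add: fcnj_psub conjugate_def psub_psub)
    have "poly (psubs (\<omega> ^ N) N f) \<psi> = 0"
      unfolding \<psi>_def rotate root by (simp add: psub_def)
    from formally_psd_double_root[OF psd real \<psi> \<epsilon> N this]
    have "psub \<omega> 1 (poly (psubs 1 N (pderiv f)) \<phi>) = 0"
      unfolding \<psi>_def rotate .
    then have "poly (psubs 1 N (pderiv f)) \<phi> = 0"
      using psub_inj[of 1 \<omega> "poly (psubs 1 N (pderiv f)) \<phi>" 0] w0 by (simp add: psub_def)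
    moreover have "poly (psubs 1 N min_poly) \<phi> = 0"
      using N unfolding psubs_min_poly orbit_poly_def poly_prod
      by (intro prod_zero bexI[of _ 0]) auto
    ultimately have "poly (psubs 1 N A) \<phi> = 0"
      using pderiv_min_poly_nz by (simp add: A pderiv_mult pN.add pN.mult)
    from root_conjugate[OF this, of k] nz k show False by simp
  qed
  then have "poly (psubs 1 N (cjp A)) \<phi> = 0"
    using fcnj_poly_psubs[OF N, of 1 A "fcnj \<phi>"] by simp
  then obtain B where "cjp A = min_poly * B" using min_poly_dvd by blast
  then have "A = cjp min_poly * cjp B" by (metis cjp_cjp cjp.mult)
  then show ?thesis by simp
qed

end

theorem formally_psd_norm:
  assumes "lead_coeff f = 1" "cjp f = f" "formally_psd f"
  shows "\<exists>G. f = G * cjp G"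
  using assms
proof (induction "degree f" arbitrary: f rule: less_induct)
  case less
  show ?case
  proof (cases "degree f = 0")
    case True
    then have "f = 1" using less.prems(1) by (metis degree_eq_zeroE lead_coeff_pCons(2) one_pCons)
    then have "f = 1 * cjp 1" by simp
    then show ?thesis by blast
  next
    case False
    define N where "N = (LEAST N. N > 0 \<and> (\<exists>\<phi>. poly (psubs 1 N f) \<phi> = 0))"
    have "\<exists>N. N > 0 \<and> (\<exists>\<phi>. poly (psubs 1 N f) \<phi> = 0)"
      using puiseux_root[OF less.prems(1)] False by blast
    then have "N > 0 \<and> (\<exists>\<phi>. poly (psubs 1 N f) \<phi> = 0)" unfolding N_def by (rule LeastI_ex)
    then obtain \<phi> where \<phi>: "N > 0" "poly (psubs 1 N f) \<phi> = 0" by blast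
    interpret puiseux_orbit f N \<phi>
      by unfold_locales (use \<phi> not_less_Least in \<open>auto simp: N_def\<close>)
    obtain A where A: "f = min_poly * A" using min_poly_dvd[OF root] by blast
    from cj_min_poly_dvd_cofactor[OF less.prems(3,2) A] obtain B where B: "A = cjp min_poly * B" by blast
    have f: "f = min_poly * cjp min_poly * B" by (simp add: A B mult.assoc)
    have lcj: "lead_coeff (cjp min_poly) = 1"
      by (rule fcnj.degree_map_poly_monic[OF min_poly_monic(1)])
    have lm: "lead_coeff (min_poly * cjp min_poly) = 1"
      by (rule monic_mult(1)[OF min_poly_monic(1) lcj])
    have lB: "lead_coeff B = 1"
      using monic_cofactor[of "min_poly * cjp min_poly" B] less.prems(1) lm f by simp
    have "degree f = degree (min_poly * cjp min_poly) + degree B"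
      unfolding f by (rule monic_mult(2)[OF lm lB])
    then have "degree B < degree f"
      using monic_mult(2)[OF min_poly_monic(1) lcj] min_poly_monic(2) N by simp
    moreover have "cjp B = B"
    proof -
      have "cjp f = min_poly * cjp min_poly * cjp B" by (simp add: f cjp.mult mult.commute)
      then have "min_poly * cjp min_poly * cjp B = min_poly * cjp min_poly * B"
        using less.prems(2) f by simp
      moreover have "min_poly * cjp min_poly \<noteq> 0" using lm by auto
      ultimately show ?thesis by (metis mult_left_cancel)
    qed
    moreover have "formally_psd B"
      using formally_psd_cofactor[OF _ min_poly_monic(1)] less.prems(3) f by metis
    ultimately obtain G where "B = G * cjp G" using less.hyps lB by blast
    then have "f = (min_poly * G) * cjp (min_poly * G)"
      by (simp add: f cjp.mult mult_ac)
    then show ?thesis by blast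
  qed
qed

subsection \<open>Sums of squares and nonnegative polynomials\<close>

definition sum_squares :: "'a :: comm_ring_1 \<Rightarrow> bool"
  where "sum_squares x \<longleftrightarrow> (\<exists>gs. x = (\<Sum>g\<leftarrow>gs. g\<^sup>2))"

lemma sum_squares_0 [simp]: "sum_squares 0"
  unfolding sum_squares_def by (rule exI[of _ "[]"]) simp

lemma sum_squares_square: "sum_squares (x\<^sup>2)"
  unfolding sum_squares_def by (rule exI[of _ "[x]"]) simp

lemma sum_squares_add: "sum_squares x \<Longrightarrow> sum_squares y \<Longrightarrow> sum_squares (x + y)"
  unfolding sum_squares_def by (metis map_append sum_list_append)

lemma sum_squares_sum_list: "sum_squares (\<Sum>g\<leftarrow>gs. g\<^sup>2)"
  unfolding sum_squares_def by blast

lemma sum_squares_mult_square: "sum_squares y \<Longrightarrow> sum_squares (x\<^sup>2 * y)"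
proof -
  assume "sum_squares y"
  then obtain gs where "y = (\<Sum>g\<leftarrow>gs. g\<^sup>2)" by (auto simp: sum_squares_def)
  then have "x\<^sup>2 * y = (\<Sum>g\<leftarrow>map ((*) x) gs. g\<^sup>2)"
    by (simp add: sum_list_const_mult power_mult_distrib o_def)
  then show ?thesis unfolding sum_squares_def by blast
qed

lemma sum_squares_mult:
  assumes "sum_squares x" "sum_squares y"
  shows "sum_squares (x * y)"
proof -
  obtain gs where x: "x = (\<Sum>g\<leftarrow>gs. g\<^sup>2)" using assms(1) by (auto simp: sum_squares_def)
  show ?thesis unfolding x
    by (induction gs)
      (auto simp: distrib_right intro!: sum_squares_add sum_squares_mult_square assms(2))
qed

lemma sum_squares_power: "sum_squares x \<Longrightarrow> sum_squares (x ^ k)"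
  by (induction k) (auto intro: sum_squares_mult sum_squares_square[of 1, simplified])

lemma sum_squares_sum: "(\<And>i. i \<in> I \<Longrightarrow> sum_squares (f i)) \<Longrightarrow> sum_squares (sum f I)"
  by (induction I rule: infinite_finite_induct) (auto intro: sum_squares_add)

text \<open>A negative value of \<open>p\<close> persists on an interval, where \<open>d\<close>
  would have infinitely many zeros. Points excluded by a nonzero denominator, leading coefficient or
  pole are handled by this throughout.\<close>

lemma poly_nonneg_dense:
  fixes p d :: "real poly"
  assumes "d \<noteq> 0" "\<And>t. poly d t \<noteq> 0 \<Longrightarrow> poly p t \<ge> 0"
  shows "poly p t \<ge> 0"
proof (rule ccontr)
  assume "\<not> poly p t \<ge> 0"
  then have neg: "poly p t < 0" by simp
  have "open {x. poly p x < 0}"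
    by (intro open_Collect_less continuous_intros)
  then obtain e where e: "e > 0" "\<And>x. dist x t < e \<Longrightarrow> poly p x < 0"
    using neg unfolding open_dist by auto
  have "{t<..<t + e} \<subseteq> {x. poly d x = 0}"
  proof
    fix x assume "x \<in> {t<..<t + e}"
    then have "poly p x < 0" using e by (auto simp: dist_real_def)
    then show "x \<in> {x. poly d x = 0}" using assms(2)[of x] by fastforce
  qed
  then have "finite {t<..<t + e}" using poly_roots_finite[OF assms(1)] by (rule finite_subset)
  with e(1) infinite_Ioo[of t "t + e"] show False by simp
qed

lemma poly_nonneg_cofactor:
  fixes d p :: "real poly"
  assumes "d \<noteq> 0" "\<And>t. poly d t \<ge> 0" "\<And>t. poly (d * p) t \<ge> 0"
  shows "poly p t \<ge> 0"
proof (rule poly_nonneg_dense[OF assms(1)])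
  fix t assume "poly d t \<noteq> 0"
  with assms(2)[of t] have "poly d t > 0" by simp
  with assms(3)[of t] show "poly p t \<ge> 0" by (simp add: zero_le_mult_iff)
qed

lemma two_squares_mult:
  fixes a b c d :: "'a :: comm_ring_1"
  shows "(a\<^sup>2 + b\<^sup>2) * (c\<^sup>2 + d\<^sup>2) = (a * c - b * d)\<^sup>2 + (a * d + b * c)\<^sup>2"
  by (simp add: power2_eq_square algebra_simps)

text \<open>A real root is a double root because the cofactor changes sign at it otherwise; a
  nonreal root contributes the factor \<open>m\<close>, the norm of a linear polynomial. Both
  factors are sums of two squares, and such sums are closed under multiplication.\<close>

theorem nonneg_poly_two_squares:
  fixes p :: "real poly"
  assumes "\<And>t. poly p t \<ge> 0"
  shows "\<exists>a b. p = a\<^sup>2 + b\<^sup>2"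
  using assms
proof (induction "degree p" arbitrary: p rule: less_induct)
  case less
  show ?case
  proof (cases "degree p = 0")
    case True
    then obtain c where c: "p = [:c:]" by (rule degree_eq_zeroE)
    then have "c \<ge> 0" using less.prems[of 0] by simp
    then have "p = [:sqrt c:]\<^sup>2 + 0\<^sup>2" by (simp add: c power2_eq_square)
    then show ?thesis by blast
  next
    case False
    have step: "\<exists>a b. p = a\<^sup>2 + b\<^sup>2"
      if p: "p = (u\<^sup>2 + v\<^sup>2) * q" and deg: "degree (u\<^sup>2 + v\<^sup>2) > 0" for u v q
    proof -
      have "u\<^sup>2 + v\<^sup>2 \<noteq> 0" using deg by auto
      have "poly q t \<ge> 0" for t
      proof (rule poly_nonneg_cofactor[OF \<open>u\<^sup>2 + v\<^sup>2 \<noteq> 0\<close>])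
        show "poly (u\<^sup>2 + v\<^sup>2) t \<ge> 0" for t by simp
        show "poly ((u\<^sup>2 + v\<^sup>2) * q) t \<ge> 0" for t using less.prems[of t] unfolding p .
      qed
      moreover have "degree q < degree p"
      proof -
        have "q \<noteq> 0" using p False by auto
        then show ?thesis using deg \<open>u\<^sup>2 + v\<^sup>2 \<noteq> 0\<close> by (simp add: p degree_mult_eq)
      qed
      ultimately obtain a b where "q = a\<^sup>2 + b\<^sup>2" using less.hyps by blast
      then show ?thesis unfolding p using two_squares_mult by blast
    qed
    have "\<not> constant (poly (map_poly complex_of_real p))"
      using False by (simp add: constant_degree degree_map_poly)
    then obtain z where z: "poly (map_poly complex_of_real p) z = 0"
      using fundamental_theorem_of_algebra by blast
    show ?thesis
    proof (cases "Im z = 0")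
      case True
      define a where "a = Re z"
      interpret o: unital_hom complex_of_real by standard auto
      have "z = of_real a" using True by (simp add: a_def complex_eq_iff)
      then have "poly p a = 0" using z o.poly_map_poly[of p a] by simp
      then obtain q where q: "p = [:- a, 1:] * q" by (auto simp: poly_eq_0_iff_dvd)
      have "poly q a = 0"
      proof -
        have "poly q a \<ge> 0"
        proof (rule tendsto_lowerbound[of "poly q" _ "at_right a"])
          show "(poly q \<longlongrightarrow> poly q a) (at_right a)"
            by (rule tendsto_poly[OF tendsto_ident_at])
          show "\<forall>\<^sub>F x in at_right a. 0 \<le> poly q x"
          proof (rule eventually_at_rightI[of a "a + 1"])
            fix x assume "x \<in> {a<..<a + 1}"
            moreover have "(x - a) * poly q x \<ge> 0" using less.prems[of x] by (simp add: q algebra_simps)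
            ultimately show "0 \<le> poly q x" by (simp add: zero_le_mult_iff)
          qed simp
        qed simp
        moreover have "poly q a \<le> 0"
        proof (rule tendsto_upperbound[of "poly q" _ "at_left a"])
          show "(poly q \<longlongrightarrow> poly q a) (at_left a)"
            by (rule tendsto_poly[OF tendsto_ident_at])
          show "\<forall>\<^sub>F x in at_left a. poly q x \<le> 0"
          proof (rule eventually_at_leftI[of "a - 1"])
            fix x assume "x \<in> {a - 1<..<a}"
            moreover have "(x - a) * poly q x \<ge> 0" using less.prems[of x] by (simp add: q algebra_simps)
            ultimately show "poly q x \<le> 0" by (simp add: zero_le_mult_iff)
          qed simp
        qed simp
        ultimately show ?thesis by simp
      qed
      then obtain q' where q': "q = [:- a, 1:] * q'" by (auto simp: poly_eq_0_iff_dvd)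
      show ?thesis
      proof (rule step)
        show "p = ([:- a, 1:]\<^sup>2 + 0\<^sup>2) * q'" unfolding q q'
          by (simp only: power2_eq_square mult.assoc mult_zero_left add_0_right)
        show "degree ([:- a, 1:]\<^sup>2 + 0\<^sup>2) > 0" by (simp add: degree_linear_power)
      qed
    next
      case False
      define m where "m = [:- Re z, 1:]\<^sup>2 + [:Im z:]\<^sup>2"
      have m: "m = [:(Re z)\<^sup>2 + (Im z)\<^sup>2, - 2 * Re z, 1:]"
        by (simp add: m_def power2_eq_square)
      have lm: "lead_coeff m = 1" by (simp add: m)
      obtain q r where qr: "p = m * q + r" "r = 0 \<or> degree r < degree m"
        using monic_division[OF lm] by blast
      have "degree r \<le> 1" using qr(2) by (auto simp: m)
      then obtain c e where r: "r = [:c, e:]"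
        by (metis One_nat_def degree_eq_zeroE le_Suc_eq le_zero_eq degree1_coeffs pCons_0_0)
      interpret o: unital_hom complex_of_real by standard auto
      interpret po: unital_hom "\<lambda>p. poly (map_poly complex_of_real p) z" by (rule o.poly_hom)
      have "poly (map_poly complex_of_real m) z = 0"
        by (simp add: m map_poly_pCons complex_eq_iff power2_eq_square algebra_simps)
      then have "poly (map_poly complex_of_real r) z = 0"
        using z by (simp add: qr po.add po.mult)
      then have "r = 0" using False by (auto simp: r map_poly_pCons complex_eq_iff)
      then show ?thesis using step[of "[:- Re z, 1:]" "[:Im z:]" q] qr(1) unfolding m_def[symmetric]
        by (simp add: m)
    qed
  qed
qed

text \<open>Read off from two squares, whose leading terms cannot cancel.\<close>

lemma nonneg_poly_lead:
  fixes p :: "real poly"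
  assumes "\<And>t. poly p t \<ge> 0" "p \<noteq> 0"
  shows "even (degree p)" "lead_coeff p > 0"
proof -
  obtain a b where p: "p = a\<^sup>2 + b\<^sup>2" using nonneg_poly_two_squares[OF assms(1)] by blast
  define m where "m = max (degree a) (degree b)"
  have sq: "coeff (c\<^sup>2) (m + m) = (coeff c m)\<^sup>2" if "degree c \<le> m" for c :: "real poly"
  proof (cases "degree c = m")
    case True
    then show ?thesis using coeff_mult_degree_sum[of c c] by (simp add: power2_eq_square)
  next
    case False
    then have "degree c < m" using that by simp
    moreover have "degree (c\<^sup>2) \<le> degree c + degree c" by (simp add: power2_eq_square degree_mult_le)
    ultimately show ?thesis by (simp add: coeff_eq_0)
  qed
  have cp: "coeff p (m + m) = (coeff a m)\<^sup>2 + (coeff b m)\<^sup>2"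
    using sq[of a] sq[of b] by (simp add: p m_def)
  have "coeff a m \<noteq> 0 \<or> coeff b m \<noteq> 0"
  proof (rule ccontr)
    assume "\<not> ?thesis"
    then have "lead_coeff a = 0 \<or> lead_coeff b = 0" "coeff a m = 0" "coeff b m = 0"
      by (auto simp: m_def max_def split: if_splits)
    then have "a = 0" "b = 0" by (auto simp: m_def leading_coeff_0_iff simp del: coeff_0)
    with assms(2) show False by (simp add: p)
  qed
  then have pos: "coeff p (m + m) > 0"
    unfolding cp by (auto simp: sum_power2_gt_zero_iff)
  have "degree p = m + m"
  proof (rule antisym)
    show "degree p \<le> m + m" unfolding p power2_eq_square m_def
      by (intro degree_add_le order.trans[OF degree_mult_le]) auto
    show "m + m \<le> degree p" using pos by (intro le_degree) simp
  qed
  with pos show "even (degree p)" "lead_coeff p > 0" by auto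
qed

text \<open>Polynomials in \<open>\<real>[t][r]\<close>: the inner variable is \<open>t\<close>, the outer one is \<open>r\<close>.\<close>

definition ev :: "real poly poly \<Rightarrow> real \<Rightarrow> real \<Rightarrow> real"
  where "ev F t r = poly (poly F [:r:]) t"

lemma poly_poly_hom: "unital_hom (\<lambda>F :: real poly poly. poly (poly F x) t)"
  by standard auto

interpretation ev: unital_hom "\<lambda>F. ev F t r" for t r
  unfolding ev_def by (rule poly_poly_hom)

lemma ev_pCons [simp]: "ev (pCons a F) t r = poly a t + r * ev F t r"
  by (simp add: ev_def)

lemma ev_smult [simp]: "ev (smult a F) t r = poly a t * ev F t r"
  by (simp add: ev_def)

lemma ev_sum_list: "ev (\<Sum>g\<leftarrow>gs. f g) t r = (\<Sum>g\<leftarrow>gs. ev (f g) t r)"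
  by (induction gs) (simp_all add: ev.add)

lemma ev_conv_map_poly: "ev F t r = poly (map_poly (\<lambda>a. poly a t) F) r"
  by (induction F) (simp_all add: map_poly_pCons)

lemma ev_conv_sum: "degree F \<le> n \<Longrightarrow> ev F t r = (\<Sum>i\<le>n. poly (coeff F i) t * r ^ i)"
proof -
  assume n: "degree F \<le> n"
  have "ev F t r = (\<Sum>i\<le>degree F. poly (coeff F i) t * r ^ i)"
    by (simp add: ev_def poly_altdef[of F] poly_sum flip: poly_const_pow)
  also have "\<dots> = (\<Sum>i\<le>n. poly (coeff F i) t * r ^ i)"
    using n by (intro sum.mono_neutral_left) (auto simp: coeff_eq_0)
  finally show ?thesis .
qed

lemma ev_eqI:
  assumes "\<And>t r. ev F t r = ev G t r"
  shows "F = G"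
proof -
  have "poly F [:r:] = poly G [:r:]" for r
    using assms by (intro poly_ext) (simp add: ev_def)
  then have "range (\<lambda>r. [:r:]) \<subseteq> {x. poly (F - G) x = 0}" by auto
  moreover have "infinite (range (\<lambda>r :: real. [:r:]))"
    by (subst finite_image_iff) (auto simp: inj_on_def infinite_UNIV_char_0)
  ultimately have "F - G = 0" using poly_roots_finite finite_subset by blast
  then show ?thesis by simp
qed

definition psd2 :: "real poly poly \<Rightarrow> bool"
  where "psd2 F \<longleftrightarrow> (\<forall>t r. ev F t r \<ge> 0)"

text \<open>The zeros of \<open>D\<close> are removed one variable at a time: by density in
  \<open>r\<close> as long as the leading coefficient of \<open>D\<close> does not vanish at
  \<open>t\<close>, then by density in \<open>t\<close>.\<close>

lemma psd2_cofactor: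
  assumes "D \<noteq> 0" "psd2 D" "psd2 (D * F)"
  shows "psd2 F"
  unfolding psd2_def
proof (intro allI)
  fix t r
  have nz: "ev F t r \<ge> 0" if "ev D t r \<noteq> 0" for t r
  proof -
    have "ev D t r > 0" using that assms(2) by (simp add: psd2_def less_le)
    moreover have "ev D t r * ev F t r \<ge> 0" using assms(3) by (simp add: psd2_def ev.mult)
    ultimately show ?thesis by (simp add: zero_le_mult_iff)
  qed
  have dense_r: "ev F t r \<ge> 0" if "map_poly (\<lambda>a. poly a t) D \<noteq> 0" for t r
    unfolding ev_conv_map_poly
    by (rule poly_nonneg_dense[OF that]) (use nz in \<open>simp add: ev_conv_map_poly\<close>)
  have lead: "map_poly (\<lambda>a. poly a t) D \<noteq> 0" if "poly (lead_coeff D) t \<noteq> 0" for t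
    using that by (metis coeff_0 coeff_map_poly poly_0)
  show "ev F t r \<ge> 0"
    unfolding ev_def
    by (rule poly_nonneg_dense[of "lead_coeff D"])
      (use assms(1) lead dense_r in \<open>auto simp: ev_def\<close>)
qed

lemma psd2_lead:
  assumes "psd2 F" "F \<noteq> 0"
  shows "even (degree F)" "\<And>t. poly (lead_coeff F) t \<ge> 0"
proof -
  define P where "P t = map_poly (\<lambda>a. poly a t) F" for t
  have nn: "poly (P t) r \<ge> 0" for t r
    using assms(1) by (simp add: psd2_def P_def ev_conv_map_poly)
  have P: "degree (P t) = degree F" "lead_coeff (P t) = poly (lead_coeff F) t" "P t \<noteq> 0"
    if "poly (lead_coeff F) t \<noteq> 0" for t
  proof -
    show 1: "degree (P t) = degree F" unfolding P_def using that by (rule map_poly_degree_eq)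
    show 2: "lead_coeff (P t) = poly (lead_coeff F) t" unfolding 1 by (simp add: P_def coeff_map_poly)
    show "P t \<noteq> 0" using 2 that by auto
  qed
  have "lead_coeff F \<noteq> 0" using assms by simp
  then obtain t where t: "poly (lead_coeff F) t \<noteq> 0"
    using poly_all_0_iff_0 by blast
  show "even (degree F)" using nonneg_poly_lead(1)[OF nn[of t] P(3)[OF t]] P(1)[OF t] by simp
  show "poly (lead_coeff F) t \<ge> 0" for t
  proof (cases "poly (lead_coeff F) t = 0")
    case False
    then show ?thesis using nonneg_poly_lead(2)[OF nn[of t] P(3)] P(2) by simp
  qed simp
qed

subsection \<open>Sums of squares modulo powers of a real point\<close>

definition cst :: "real \<Rightarrow> complex fps"
  where "cst c = fps_const (complex_of_real c)"

interpretation cst: unital_hom cst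
  by standard (simp_all add: cst_def)

definition sub_at :: "complex fps \<Rightarrow> real poly \<Rightarrow> complex fps"
  where "sub_at x a = poly (map_poly cst a) x"

interpretation sub_at: unital_hom "sub_at x" for x
  unfolding sub_at_def by (rule cst.poly_hom)

lemma sub_at_pCons [simp]: "sub_at x (pCons c a) = cst c + x * sub_at x a"
  by (simp add: sub_at_def map_poly_pCons)

lemma sub_at_pcompose: "sub_at x (pcompose a q) = sub_at (sub_at x q) a"
  by (simp add: sub_at_def cst.map_poly_pcompose poly_pcompose)

lemma sub_at_monom: "sub_at x (monom c n) = cst c * x ^ n"
  by (simp add: sub_at_def map_poly_monom poly_monom)

lemma sub_at_X_nth: "sub_at fps_X a $ k = of_real (coeff a k)"
proof (induction a arbitrary: k)
  case (pCons c a)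
  show ?case by (cases k) (simp_all add: pCons.IH cst_def)
qed simp

abbreviation taylor :: "real \<Rightarrow> real poly \<Rightarrow> complex fps"
  where "taylor t0 \<equiv> sub_at (cst t0 + fps_X)"

abbreviation taylors :: "real \<Rightarrow> real poly poly \<Rightarrow> complex fps poly"
  where "taylors t0 \<equiv> map_poly (taylor t0)"

interpretation taylors: unital_hom "taylors t0" for t0
  by (rule sub_at.map_poly_hom)

lemma fcnj_cst [simp]: "fcnj (cst c) = cst c"
  by (simp add: fps_eq_iff cst_def)

lemma fcnj_taylor [simp]: "fcnj (taylor t0 a) = taylor t0 a"
  by (induction a) (use fcnj_X[of 1] in \<open>simp_all add: fcnj.add fcnj.mult del: fcnj_X\<close>)

lemma psub_cst [simp]: "psub c N (cst x) = cst x"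
  by (simp add: psub_def cst_def)

lemma psub_taylor:
  assumes "N > 0"
  shows "psub c N (taylor t0 a) = sub_at (cst t0 + fps_const c * fps_X ^ N) a"
proof -
  interpret c: unital_hom "psub c N" by (rule psub_hom[OF assms])
  show ?thesis by (induction a) (simp_all add: c.add c.mult assms)
qed

lemma taylor_linear: "taylor t0 [:- t0, 1:] = fps_X"
  by (simp add: cst.uminus)

text \<open>The unit part has to be real because its inverse multiplies real polynomials later. The
  last conclusion brings divisibility by the uniformizer back from power series to
  polynomials.\<close>

lemma taylor_factor:
  assumes "a \<noteq> 0"
  obtains v u where "taylor t0 a = fps_X ^ v * u" "u $ 0 \<noteq> 0" "fcnj u = u"
    "\<And>k. fps_X ^ k dvd taylor t0 a \<Longrightarrow> [:- t0, 1:] ^ k dvd a"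
proof -
  define v where "v = order t0 a"
  obtain b where b: "a = [:- t0, 1:] ^ v * b" "\<not> [:- t0, 1:] dvd b"
    using order_decomp[OF assms, of t0] unfolding v_def by blast
  have eq: "taylor t0 a = fps_X ^ v * taylor t0 b"
    unfolding b sub_at.mult sub_at.power taylor_linear ..
  have "poly b t0 \<noteq> 0" using b(2) by (simp add: poly_eq_0_iff_dvd)
  moreover have t0: "taylor t0 b $ 0 = of_real (poly b t0)" for b
    by (induction b) (simp_all add: cst_def)
  ultimately have nz: "taylor t0 b $ 0 \<noteq> 0" by simp
  have "[:- t0, 1:] ^ k dvd a" if dvd: "fps_X ^ k dvd taylor t0 a" for k
  proof -
    obtain c where "taylor t0 a = fps_X ^ k * c" using dvd by blast
    then have "k \<le> v" using nz eq fps_X_power_mult_nth[of k c v] fps_X_power_mult_nth[of v "taylor t0 b" v]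
      by (metis diff_self_eq_0 less_irrefl not_less)
    then show ?thesis unfolding b by (intro dvd_mult2 le_imp_power_dvd)
  qed
  with that eq nz show thesis by simp
qed

lemma nonneg_low_coeff:
  fixes h :: "real poly"
  assumes "\<And>s. poly h s \<ge> 0" "\<And>j. j < m \<Longrightarrow> coeff h j = 0"
  shows "coeff h m \<ge> 0"
proof -
  have "monom 1 m dvd h" using assms(2) by (simp add: monom_1_dvd_iff')
  then obtain g where g: "h = monom 1 m * g" by blast
  have "poly g 0 \<ge> 0"
  proof (rule tendsto_lowerbound[of "poly g" _ "at_right 0"])
    show "(poly g \<longlongrightarrow> poly g 0) (at_right 0)" by (rule tendsto_poly[OF tendsto_ident_at])
    show "\<forall>\<^sub>F x in at_right 0. 0 \<le> poly g x"
    proof (rule eventually_at_rightI[of 0 1])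
      fix x :: real assume "x \<in> {0<..<1}"
      then have "x ^ m > 0" by simp
      then show "0 \<le> poly g x" using assms(1)[of x] by (simp add: g poly_monom zero_le_mult_iff)
    qed simp
  qed simp
  then show ?thesis by (simp add: g coeff_monom_mult poly_0_coeff_0)
qed

text \<open>Only coefficients up to \<open>m\<close> matter, so the formal curve may be truncated to
  the polynomial curve \<open>(u, w)\<close>. Along it \<open>F\<close> becomes a genuine polynomial
  \<open>h\<close> that is nonnegative on the real line.\<close>

lemma formally_psd_taylors:
  assumes "psd2 F"
  shows "formally_psd (taylors t0 F)"
  unfolding formally_psd_def lead_nonneg_def
proof (intro allI impI)
  fix \<psi> \<epsilon> N m
  assume \<psi>: "fcnj \<psi> = \<psi>" and \<epsilon>: "\<epsilon> \<in> {1, -1 :: complex}" and N: "N > 0"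
    and low: "\<forall>j<m. poly (psubs \<epsilon> N (taylors t0 F)) \<psi> $ j = 0"
  interpret e: unital_hom "psub \<epsilon> N" by (rule psub_hom[OF N])
  obtain e where e: "\<epsilon> = of_real e" using \<epsilon> by (metis empty_iff insert_iff of_real_1 of_real_minus)
  define u where "u = [:t0:] + monom e N"
  define w where "w = (\<Sum>j\<le>m. monom (Re (\<psi> $ j)) j)"
  define h where "h = poly (map_poly (\<lambda>a. pcompose a u) F) w"
  interpret pc: unital_hom "\<lambda>a. pcompose a u"
    by standard (simp_all add: pcompose_1 pcompose_add pcompose_mult)
  have u: "sub_at fps_X u = cst t0 + fps_const \<epsilon> * fps_X ^ N"
    by (simp add: u_def sub_at.add sub_at_monom e cst_def)
  have "psubs \<epsilon> N (taylors t0 F) = map_poly (sub_at fps_X) (map_poly (\<lambda>a. pcompose a u) F)"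
    by (simp add: map_poly_map_poly o_def psub_taylor[OF N] sub_at_pcompose u)
  then have eq: "poly (psubs \<epsilon> N (taylors t0 F)) (sub_at fps_X w) = sub_at fps_X h"
    by (simp add: h_def sub_at.poly_map_poly)
  have low_w: "sub_at fps_X w $ j = \<psi> $ j" if "j < Suc m" for j
  proof -
    have "cnj (\<psi> $ j) = \<psi> $ j" using \<psi> by (metis fcnj_nth)
    then show ?thesis
      using that by (simp add: sub_at_X_nth w_def coeff_sum if_distrib sum.delta complex_eq_iff cong: if_cong)
  qed
  have cong: "poly (psubs \<epsilon> N (taylors t0 F)) \<psi> $ j = of_real (coeff h j)" if "j \<le> m" for j
  proof -
    have "poly (psubs \<epsilon> N (taylors t0 F)) (sub_at fps_X w) $ j = poly (psubs \<epsilon> N (taylors t0 F)) \<psi> $ j"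
      using that by (intro poly_fps_cong[of "Suc m"] low_w) simp_all
    then show ?thesis unfolding eq sub_at_X_nth by simp
  qed
  have "poly h s \<ge> 0" for s
  proof -
    interpret s: unital_hom "\<lambda>p :: real poly. poly p s" by standard auto
    have "poly h s = ev F (poly u s) (poly w s)"
      by (simp add: h_def ev_conv_map_poly map_poly_map_poly o_def poly_pcompose flip: s.poly_map_poly)
    then show ?thesis using assms by (simp add: psd2_def)
  qed
  moreover have "coeff h j = 0" if "j < m" for j
    using low cong[of j] that by simp
  ultimately have "coeff h m \<ge> 0" by (intro nonneg_low_coeff)
  then show "0 \<le> Re (poly (psubs \<epsilon> N (taylors t0 F)) \<psi> $ m)" by (simp add: cong)
qed

text \<open>The residue field is real, so a square of the uniformizer can be cancelled from a sum of
  squares.\<close>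

lemma sum_squares_cancel_X:
  assumes real: "\<And>g. g \<in> set gs \<Longrightarrow> cjp g = g \<and> degree g \<le> d"
    and eq: "(\<Sum>g\<leftarrow>gs. g\<^sup>2) = smult (fps_X ^ (2 * k)) P"
  shows "\<exists>hs. (\<forall>h\<in>set hs. cjp h = h \<and> degree h \<le> d) \<and> P = (\<Sum>h\<leftarrow>hs. h\<^sup>2)"
  using assms
proof (induction k arbitrary: gs)
  case 0
  then show ?case by (intro exI[of _ gs]) auto
next
  case (Suc k)
  interpret z: unital_hom "\<lambda>a :: complex fps. a $ 0" by standard auto
  interpret r: unital_hom "\<lambda>g :: complex fps poly. poly (red0 g) x" for x
    unfolding red0_def by (rule z.poly_hom)
  have r_sum: "poly (red0 (\<Sum>g\<leftarrow>gs. g\<^sup>2)) x = (\<Sum>g\<leftarrow>gs. (poly (red0 g) x)\<^sup>2)" for x and gs :: "complex fps poly list"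
    by (induction gs) (simp_all add: r.add r.power)
  have red: "red0 g = 0" if g: "g \<in> set gs" for g
  proof -
    have "poly (red0 g) (of_real x) = 0" for x
    proof -
      have re: "poly (red0 g) (of_real x) = of_real (Re (poly (red0 g) (of_real x)))"
        if "g \<in> set gs" for g
      proof -
        have "cnj (coeff g i $ 0) = coeff g i $ 0" for i
          using Suc.prems(1)[OF that] by (metis coeff_map_poly fcnj.zero fcnj_nth)
        then have "map_poly cnj (red0 g) = red0 g"
          by (intro poly_eqI) (simp add: red0_def coeff_map_poly)
        then have "cnj (poly (red0 g) (of_real x)) = poly (red0 g) (of_real x)"
          using poly_cnj[of "red0 g" "of_real x"] by simp
        then show ?thesis by (simp add: complex_eq_iff)
      qed
      have "(\<Sum>g\<leftarrow>gs. (poly (red0 g) (of_real x))\<^sup>2) = 0"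
        unfolding r_sum[symmetric] Suc.prems(2) by (simp add: red0_def map_poly_smult)
      also have "(\<Sum>g\<leftarrow>gs. (poly (red0 g) (of_real x))\<^sup>2) =
          (\<Sum>g\<leftarrow>gs. of_real ((Re (poly (red0 g) (of_real x)))\<^sup>2))"
        using re by (intro arg_cong[of _ _ sum_list] map_cong) (auto simp: of_real_power)
      also have "\<dots> = of_real (\<Sum>g\<leftarrow>gs. (Re (poly (red0 g) (of_real x)))\<^sup>2)"
        by (induction gs) simp_all
      finally have "(\<Sum>g\<leftarrow>gs. (Re (poly (red0 g) (of_real x)))\<^sup>2) = 0" by (simp only: of_real_eq_0_iff)
      then have "(Re (poly (red0 g) (of_real x)))\<^sup>2 = 0"
        using g by (subst (asm) sum_list_nonneg_eq_0_iff) auto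
      then show ?thesis using re[OF g] by simp
    qed
    then have "range complex_of_real \<subseteq> {x. poly (red0 g) x = 0}" by auto
    moreover have "infinite (range complex_of_real)"
      by (subst finite_image_iff) (auto simp: inj_on_def infinite_UNIV_char_0)
    ultimately show ?thesis using poly_roots_finite finite_subset by blast
  qed
  define q where "q = map_poly (fps_shift 1 :: complex fps \<Rightarrow> complex fps)"
  have g: "g = smult fps_X (q g)" if "g \<in> set gs" for g
  proof (rule poly_eqI)
    fix i
    have "coeff g i $ 0 = 0" using red[OF that] by (metis coeff_0 coeff_map_poly fps_zero_nth red0_def)
    then have "coeff g i = fps_X ^ 1 * fps_shift 1 (coeff g i)" by (intro fps_X_power_cofactor) simp
    then show "coeff g i = coeff (smult fps_X (q g)) i" by (simp add: q_def coeff_map_poly)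
  qed
  have X0: "fps_X ^ 2 \<noteq> (0 :: complex fps)" by simp
  have "(\<Sum>g\<leftarrow>gs. g\<^sup>2) = (\<Sum>g\<leftarrow>gs. smult (fps_X\<^sup>2) ((q g)\<^sup>2))"
  proof (intro arg_cong[of _ _ sum_list] map_cong refl)
    fix h assume "h \<in> set gs"
    from arg_cong[OF g[OF this], of "\<lambda>x. x\<^sup>2"] show "h\<^sup>2 = smult (fps_X\<^sup>2) ((q h)\<^sup>2)"
      by (simp add: smult_power)
  qed
  also have "\<dots> = smult (fps_X\<^sup>2) (\<Sum>g\<leftarrow>map q gs. g\<^sup>2)"
    by (induction gs) (simp_all add: smult_add_right)
  finally have "smult (fps_X\<^sup>2) (\<Sum>g\<leftarrow>map q gs. g\<^sup>2) = smult (fps_X\<^sup>2) (smult (fps_X ^ (2 * k)) P)"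
    using Suc.prems(2) by (simp add: mult_ac flip: power_add)
  then have "(\<Sum>g\<leftarrow>map q gs. g\<^sup>2) = smult (fps_X ^ (2 * k)) P"
    using X0 by (metis smult_cancel)
  moreover have "cjp g = g \<and> degree g \<le> d" if g: "g \<in> set (map q gs)" for g
  proof -
    obtain g0 where g0: "g = q g0" "g0 \<in> set gs" using g by auto
    have "degree g \<le> degree g0" unfolding g0 q_def by (rule map_poly_degree_leq)
    moreover have "cjp g = g"
      using Suc.prems(1)[OF g0(2)] unfolding g0 q_def
      by (simp add: poly_eq_iff coeff_map_poly fps_eq_iff)
    ultimately show ?thesis using Suc.prems(1)[OF g0(2)] by simp
  qed
  ultimately show ?case using Suc.IH by blast
qed

text \<open>\<open>A\<close> and \<open>B\<close> are the real and imaginary parts of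
  \<open>G\<close>, which has the same degree as its conjugate, namely \<open>e\<close>.\<close>

lemma real_two_squares:
  assumes "f = G * cjp G" "lead_coeff f = 1" "degree f = 2 * e"
  obtains A B where "f = A\<^sup>2 + B\<^sup>2" "cjp A = A" "cjp B = B" "degree A \<le> e" "degree B \<le> e"
proof -
  have dc: "degree (cjp G) = degree G" by (intro degree_map_poly) (auto simp: fps_eq_iff)
  have "G \<noteq> 0" using assms by auto
  then have "cjp G \<noteq> 0" using cjp_cjp by (metis map_poly_0)
  with \<open>G \<noteq> 0\<close> have dG: "degree G = e" using assms dc by (simp add: degree_mult_eq)
  define A where "A = smult (fps_const (1 / 2)) (G + cjp G)"
  define B where "B = smult (fps_const (- \<i> / 2)) (G - cjp G)"
  have cs: "cjp (smult (fps_const c) p) = smult (fps_const (cnj c)) (cjp p)" for c p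
    by (subst map_poly_smult) (auto simp: fcnj.mult fps_eq_iff intro!: arg_cong2[of _ _ _ _ smult])
  have "cjp A = A" by (simp add: A_def cs cjp.add add.commute)
  moreover have "cjp B = B"
  proof -
    have "cjp B = smult (fps_const (\<i> / 2)) (cjp G - G)" by (simp add: B_def cs cjp.diff)
    also have "\<dots> = smult (fps_const (- \<i> / 2)) (- (cjp G - G))"
      by (simp only: smult_minus_right) (simp flip: smult_minus_left fps_const_neg)
    finally show ?thesis by (simp add: B_def)
  qed
  moreover have "f = A\<^sup>2 + B\<^sup>2"
  proof -
    have "A\<^sup>2 = smult (fps_const (1 / 4)) ((G + cjp G)\<^sup>2)"
      by (simp add: A_def smult_power fps_const_power power_divide)
    moreover have "B\<^sup>2 = smult (fps_const (- 1 / 4)) ((G - cjp G)\<^sup>2)"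
      by (simp add: B_def smult_power fps_const_power power_divide power_mult_distrib)
    moreover have "fps_const (- 1 / 4) = - fps_const (1 / 4 :: complex)" by simp
    ultimately have "A\<^sup>2 + B\<^sup>2 = smult (fps_const (1 / 4)) ((G + cjp G)\<^sup>2 - (G - cjp G)\<^sup>2)"
      by (simp only: smult_minus_left smult_diff_right) simp
    also have "(G + cjp G)\<^sup>2 - (G - cjp G)\<^sup>2 = f + f + (f + f)"
      by (simp add: assms(1) power2_eq_square algebra_simps)
    also have "smult (fps_const (1 / 4)) (f + f + (f + f)) =
        smult (fps_const (1 / 4) + fps_const (1 / 4) + (fps_const (1 / 4) + fps_const (1 / 4))) f"
      by (simp only: smult_add_left smult_add_right)
    finally show ?thesis by simp
  qed
  moreover have "degree A \<le> e" "degree B \<le> e"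
    unfolding A_def B_def
    by (intro order.trans[OF degree_smult_le] degree_add_le degree_diff_le; simp add: dc dG)+
  ultimately show thesis using that by blast
qed

text \<open>This is \<open>a^(n - 1) * F(r / a)\<close> for the leading coefficient \<open>a\<close>
  and the degree \<open>n\<close>, written without division.\<close>

definition monicize :: "'a :: idom poly \<Rightarrow> 'a poly"
  where "monicize F = (\<Sum>i<degree F. monom (coeff F i * lead_coeff F ^ (degree F - 1 - i)) i)
    + monom 1 (degree F)"

lemma monicize:
  assumes "degree F > 0"
  shows "lead_coeff (monicize F) = 1" "degree (monicize F) = degree F"
    "pcompose (monicize F) [:0, lead_coeff F:] = smult (lead_coeff F ^ (degree F - 1)) F"
proof -
  define n where "n = degree F"
  have c: "coeff (monicize F) i = (if i < n then coeff F i * lead_coeff F ^ (n - 1 - i) else if i = n then 1 else 0)" for i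
    unfolding monicize_def coeff_add coeff_sum coeff_monom n_def[symmetric] by simp
  show deg: "degree (monicize F) = degree F"
    by (rule antisym[OF degree_le le_degree]) (auto simp: c n_def)
  then show "lead_coeff (monicize F) = 1" by (simp add: c n_def)
  show "pcompose (monicize F) [:0, lead_coeff F:] = smult (lead_coeff F ^ (degree F - 1)) F"
  proof (rule poly_eqI)
    fix i
    define a where "a = lead_coeff F"
    have cp: "coeff (pcompose (monicize F) [:0, a:]) i = a ^ i * (if i < n then coeff F i * a ^ (n - 1 - i) else if i = n then 1 else 0)"
      by (simp only: Polynomial.coeff_pcompose_linear c a_def)
    consider "i < n" | "i = n" | "i > n" by linarith
    then have "coeff (pcompose (monicize F) [:0, a:]) i = a ^ (n - 1) * coeff F i"
    proof cases
      case 1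
      then have "n - 1 = i + (n - 1 - i)" by simp
      then have "a ^ (n - 1) = a ^ i * a ^ (n - 1 - i)" by (metis power_add)
      with 1 show ?thesis unfolding cp by (simp add: mult_ac)
    next
      case 2
      have "a ^ n = a ^ (n - 1) * a" using assms by (simp add: n_def flip: power_Suc2)
      with 2 show ?thesis unfolding cp by (simp add: n_def a_def)
    next
      case 3
      then show ?thesis unfolding cp by (simp add: n_def coeff_eq_0)
    qed
    then show "coeff (pcompose (monicize F) [:0, lead_coeff F:]) i = coeff (smult (lead_coeff F ^ (degree F - 1)) F) i"
      by (simp add: a_def n_def)
  qed
qed

lemma ev_pcompose_scale: "ev (pcompose F [:0, a:]) t r = ev F t (r * poly a t)"
proof -
  interpret t: unital_hom "\<lambda>p :: real poly. poly p t" by standard auto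
  show ?thesis by (simp add: ev_conv_map_poly t.map_poly_pcompose poly_pcompose map_poly_pCons)
qed

text \<open>The factor \<open>a^(n - 1)\<close> between the values of \<open>F\<close> and of its
  monic version is nonnegative because the leading coefficient \<open>a\<close> is; the zeros of
  \<open>a\<close> are covered by density.\<close>

lemma psd2_monicize:
  assumes "psd2 F" "degree F > 0"
  shows "psd2 (monicize F)"
  unfolding psd2_def
proof (intro allI)
  fix t R
  have F0: "F \<noteq> 0" using assms by auto
  have odd: "odd (degree F - 1)" using psd2_lead(1)[OF assms(1) F0] assms(2) by simp
  have "ev (monicize F) t R \<ge> 0" if nz: "poly (lead_coeff F) t \<noteq> 0" for t
  proof -
    have "ev (monicize F) t R = ev (pcompose (monicize F) [:0, lead_coeff F:]) t (R / poly (lead_coeff F) t)"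
      using nz by (simp add: ev_pcompose_scale)
    also have "\<dots> = poly (lead_coeff F) t ^ (degree F - 1) * ev F t (R / poly (lead_coeff F) t)"
      by (simp add: monicize(3)[OF assms(2)])
    also have "\<dots> \<ge> 0"
      using psd2_lead(2)[OF assms(1) F0, of t] assms(1) by (simp add: psd2_def)
    finally show ?thesis .
  qed
  then show "ev (monicize F) t R \<ge> 0"
    using poly_nonneg_dense[of "lead_coeff F" "poly (monicize F) [:R:]" t] F0
    unfolding ev_def leading_coeff_0_iff by blast
qed

text \<open>The monic version is a norm, hence two squares, and substituting back makes
  \<open>a^(n - 1) * F\<close> two squares. One more factor \<open>a\<close>, itself two squares,
  gives the even power \<open>a^n\<close>. Locally \<open>a\<close> is a power of the uniformizer
  times a unit \<open>u\<close>; dividing by the square \<open>u^n\<close> leaves an even power of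
  the uniformizer, which can be cancelled.\<close>

theorem local_sum_squares:
  assumes "psd2 F" "degree F \<le> 2 * d"
  shows "\<exists>gs. (\<forall>g\<in>set gs. cjp g = g \<and> degree g \<le> d) \<and> taylors t0 F = (\<Sum>g\<leftarrow>gs. g\<^sup>2)"
proof (cases "F = 0")
  case True
  then show ?thesis by (intro exI[of _ "[]"]) simp
next
  case F0: False
  define a where "a = lead_coeff F"
  have "\<exists>b c. a = b\<^sup>2 + c\<^sup>2"
    unfolding a_def using psd2_lead(2)[OF assms(1) F0] by (rule nonneg_poly_two_squares)
  then obtain b c where bc: "a = b\<^sup>2 + c\<^sup>2" by blast
  have cT: "cjp [:taylor t0 x:] = [:taylor t0 x:]" for x by (simp add: map_poly_pCons)
  show ?thesis
  proof (cases "degree F = 0")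
    case True
    then have "F = [:a:]" using degree_0_id[of F] by (simp add: a_def)
    then have "F = [:b:]\<^sup>2 + [:c:]\<^sup>2" using bc by (simp add: power2_eq_square)
    then have "taylors t0 F = [:taylor t0 b:]\<^sup>2 + [:taylor t0 c:]\<^sup>2"
      by (simp add: taylors.add taylors.power map_poly_pCons)
    then show ?thesis by (intro exI[of _ "[[:taylor t0 b:], [:taylor t0 c:]]"]) (simp add: cT)
  next
    case False
    obtain e where e: "degree F = 2 * e" using psd2_lead(1)[OF assms(1) F0] by blast
    then have ed: "e \<le> d" and e0: "e > 0" using assms(2) False by auto
    define n where "n = degree F"
    have n0: "n > 0" using False by (simp add: n_def)
    define T where "T = taylor t0"
    note mon = monicize[OF n0[unfolded n_def]]
    have mT: "lead_coeff (taylors t0 (monicize F)) = 1" "degree (taylors t0 (monicize F)) = n"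
      using sub_at.degree_map_poly_monic[OF mon(1)] mon(2) by (auto simp: n_def)
    have "cjp (taylors t0 (monicize F)) = taylors t0 (monicize F)"
      by (simp add: map_poly_map_poly o_def)
    from formally_psd_norm[OF mT(1) this formally_psd_taylors[OF psd2_monicize[OF assms(1)]]]
    obtain G where "taylors t0 (monicize F) = G * cjp G" using False by auto
    from real_two_squares[OF this mT(1)] obtain A B where
      AB: "taylors t0 (monicize F) = A\<^sup>2 + B\<^sup>2" "cjp A = A" "cjp B = B" "degree A \<le> e" "degree B \<le> e"
      using mT(2) e unfolding n_def by metis
    interpret pc: unital_hom "\<lambda>p. pcompose p [:0, T a:]"
      by standard (simp_all add: pcompose_1 pcompose_add pcompose_mult)
    define A' where "A' = pcompose A [:0, T a:]"
    define B' where "B' = pcompose B [:0, T a:]"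
    have dA': "degree A' \<le> e" "degree B' \<le> e"
      using AB(4,5) degree_pcompose_le[of A "[:0, T a:]"] degree_pcompose_le[of B "[:0, T a:]"]
      by (auto simp: A'_def B'_def degree_pCons_eq_if split: if_splits)
    have cA': "cjp A' = A'" "cjp B' = B'"
      by (simp_all add: A'_def B'_def fcnj.map_poly_pcompose AB map_poly_pCons T_def)
    have "smult (T a ^ (n - 1)) (taylors t0 F) = A'\<^sup>2 + B'\<^sup>2"
    proof -
      have "taylors t0 (pcompose (monicize F) [:0, a:]) = smult (T a ^ (n - 1)) (taylors t0 F)"
        unfolding a_def mon(3) n_def by (subst map_poly_smult) (simp_all add: sub_at.mult sub_at.power T_def a_def)
      moreover have "taylors t0 (pcompose (monicize F) [:0, a:]) = pcompose (taylors t0 (monicize F)) [:0, T a:]"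
        by (simp add: sub_at.map_poly_pcompose map_poly_pCons T_def)
      ultimately show ?thesis by (simp add: AB pc.add pc.power A'_def B'_def)
    qed
    moreover have "T a = (T b)\<^sup>2 + (T c)\<^sup>2" by (simp add: T_def bc sub_at.add sub_at.power)
    then have "[:T a:] = [:T b:]\<^sup>2 + [:T c:]\<^sup>2" by (simp add: power2_eq_square)
    ultimately have "[:T a:] * smult (T a ^ (n - 1)) (taylors t0 F) = ([:T b:]\<^sup>2 + [:T c:]\<^sup>2) * (A'\<^sup>2 + B'\<^sup>2)"
      by (simp only:)
    moreover have "[:T a:] * smult (T a ^ (n - 1)) (taylors t0 F) = smult (T a ^ n) (taylors t0 F)"
      using n0 by (cases n) (simp_all add: mult.commute)
    ultimately have sq: "smult (T a ^ n) (taylors t0 F) =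
        ([:T b:] * A' - [:T c:] * B')\<^sup>2 + ([:T b:] * B' + [:T c:] * A')\<^sup>2"
      by (simp only: two_squares_mult)
    obtain v u where vu: "T a = fps_X ^ v * u" "u $ 0 \<noteq> 0" "fcnj u = u"
    proof -
      have "a \<noteq> 0" using F0 by (simp add: a_def)
      from taylor_factor[OF this, of t0] that show thesis unfolding T_def by blast
    qed
    define w where "w = inverse u"
    have w: "w * u = 1" unfolding w_def using vu(2) by (rule inverse_mult_eq_1)
    have cw: "fcnj w = w"
    proof -
      have "fcnj w * u = 1" using arg_cong[OF w, of fcnj] by (simp add: fcnj.mult vu)
      then show ?thesis using w by (metis mult.assoc mult.commute mult_1)
    qed
    define g where "g = smult (w ^ e) ([:T b:] * A' - [:T c:] * B')"
    define h where "h = smult (w ^ e) ([:T b:] * B' + [:T c:] * A')"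
    have cs: "cjp (smult x p) = smult (fcnj x) (cjp p)" for x p
      by (subst map_poly_smult) (auto simp: fcnj.mult)
    have "cjp g = g" "cjp h = h"
      by (simp_all add: g_def h_def cs cjp.add cjp.diff cA' fcnj.power cw T_def)
    moreover have "degree g \<le> d" "degree h \<le> d"
      unfolding g_def h_def using dA' ed
      by (intro order.trans[OF degree_smult_le] degree_add_le degree_diff_le; simp;
          intro order.trans[OF degree_smult_le]; simp)+
    moreover have "g\<^sup>2 + h\<^sup>2 = smult (fps_X ^ (2 * (v * e))) (taylors t0 F)"
    proof -
      have "g\<^sup>2 + h\<^sup>2 = smult (w ^ n) (smult (T a ^ n) (taylors t0 F))"
      proof -
        have "(smult (w ^ e) p)\<^sup>2 = smult (w ^ n) (p\<^sup>2)" for p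
          by (simp add: smult_power n_def e mult.commute flip: power_mult)
        then show ?thesis unfolding g_def h_def sq smult_add_right[of "w ^ n"] by (simp only:)
      qed
      also have "\<dots> = smult ((w * T a) ^ n) (taylors t0 F)" by (simp add: power_mult_distrib)
      also have "w * T a = fps_X ^ v" using w by (simp add: vu(1) mult.left_commute)
      finally show ?thesis by (simp add: n_def e mult_ac flip: power_mult)
    qed
    ultimately show ?thesis
      using sum_squares_cancel_X[of "[g, h]" d "v * e" "taylors t0 F"] by auto
  qed
qed

section \<open>From power series back to polynomials\<close>

definition truncation :: "real \<Rightarrow> nat \<Rightarrow> complex fps \<Rightarrow> real poly"
  where "truncation t0 M a = (\<Sum>j<M. smult (Re (a $ j)) ([:- t0, 1:] ^ j))"

lemma cst_mult_nth: "(cst c * x) $ k = of_real c * x $ k"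
  by (simp add: cst_def)

lemma taylor_truncation:
  assumes "fcnj a = a" "j < M"
  shows "taylor t0 (truncation t0 M a) $ j = a $ j"
proof -
  have "cnj (a $ j) = a $ j" using assms(1) by (metis fcnj_nth)
  then have re: "of_real (Re (a $ j)) = a $ j" by (simp add: complex_eq_iff)
  have "taylor t0 (smult c p) = cst c * taylor t0 p" for c p
    using sub_at.mult[of _ "[:c:]" p] by simp
  then have "taylor t0 (truncation t0 M a) $ j = (\<Sum>i<M. of_real (Re (a $ i)) * (if j = i then 1 else 0))"
    unfolding truncation_def sub_at.sum by (simp add: sub_at.power taylor_linear fps_sum_nth cst_mult_nth del: sub_at_pCons)
  also have "\<dots> = a $ j" using assms(2) re by (simp add: if_distrib cong: if_cong)
  finally show ?thesis .
qed

theorem local_sum_squares_mod: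
  assumes "psd2 F" "degree F \<le> 2 * d"
  shows "\<exists>gs. (\<forall>g\<in>set gs. degree g \<le> d) \<and> [:[:- t0, 1:] ^ M:] dvd F - (\<Sum>g\<leftarrow>gs. g\<^sup>2)"
proof -
  obtain gs where gs: "\<And>g. g \<in> set gs \<Longrightarrow> cjp g = g \<and> degree g \<le> d" "taylors t0 F = (\<Sum>g\<leftarrow>gs. g\<^sup>2)"
    using local_sum_squares[OF assms, of t0] by blast
  define tr where "tr = map_poly (truncation t0 M)"
  have tr0: "truncation t0 M 0 = 0" by (simp add: truncation_def)
  have tr: "[:fps_X ^ M:] dvd (taylors t0 (tr g))\<^sup>2 - g\<^sup>2" if "g \<in> set gs" for g
  proof -
    have "fps_X ^ M dvd coeff (taylors t0 (tr g) - g) i" for i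
    proof -
      have "fcnj (coeff g i) = coeff g i" using gs(1)[OF that] by (metis coeff_map_poly fcnj.zero)
      then have "(taylor t0 (truncation t0 M (coeff g i)) - coeff g i) $ j = 0" if "j < M" for j
        using that by (simp add: taylor_truncation)
      from fps_X_power_cofactor[OF this] show ?thesis
        by (simp add: tr_def coeff_map_poly tr0) (metis dvd_triv_left)
    qed
    then have "[:fps_X ^ M:] dvd taylors t0 (tr g) - g" by (simp add: const_poly_dvd_iff)
    moreover have "(taylors t0 (tr g))\<^sup>2 - g\<^sup>2 = (taylors t0 (tr g) - g) * (taylors t0 (tr g) + g)"
      by (simp add: power2_eq_square algebra_simps)
    ultimately show ?thesis by simp
  qed
  have "taylors t0 (F - (\<Sum>g\<leftarrow>map tr gs. g\<^sup>2)) = - (\<Sum>g\<leftarrow>gs. (taylors t0 (tr g))\<^sup>2 - g\<^sup>2)"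
  proof -
    have "taylors t0 (\<Sum>g\<leftarrow>map tr gs. g\<^sup>2) = (\<Sum>g\<leftarrow>gs. (taylors t0 (tr g))\<^sup>2)"
      by (induction gs) (simp_all add: taylors.add taylors.power)
    then show ?thesis by (simp add: taylors.diff gs(2) sum_list_subtractf)
  qed
  moreover have "[:fps_X ^ M:] dvd (\<Sum>g\<leftarrow>gs. (taylors t0 (tr g))\<^sup>2 - g\<^sup>2)"
    using tr by (induction gs) auto
  ultimately have "[:fps_X ^ M:] dvd taylors t0 (F - (\<Sum>g\<leftarrow>map tr gs. g\<^sup>2))" by simp
  then have dvd: "fps_X ^ M dvd taylor t0 (coeff (F - (\<Sum>g\<leftarrow>map tr gs. g\<^sup>2)) i)" for i
    unfolding const_poly_dvd_iff by (simp add: coeff_map_poly del: coeff_diff)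
  have "[:- t0, 1:] ^ M dvd coeff (F - (\<Sum>g\<leftarrow>map tr gs. g\<^sup>2)) i" for i
  proof (cases "coeff (F - (\<Sum>g\<leftarrow>map tr gs. g\<^sup>2)) i = 0")
    case False
    from taylor_factor[OF this, of t0] dvd[of i] show ?thesis by blast
  qed simp
  then have "[:[:- t0, 1:] ^ M:] dvd F - (\<Sum>g\<leftarrow>map tr gs. g\<^sup>2)" by (simp add: const_poly_dvd_iff)
  moreover have "degree (tr g) \<le> d" if "g \<in> set gs" for g
    using gs(1)[OF that] map_poly_degree_leq[of "truncation t0 M" g] by (simp add: tr_def)
  ultimately show ?thesis by (intro exI[of _ "map tr gs"]) auto
qed

subsection \<open>Strictly positive polynomials on the cylinder\<close>

abbreviation qt :: "real poly" where "qt \<equiv> [:1, 0, 1:]"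

definition cyl_sos :: "real poly poly \<Rightarrow> bool"
  where "cyl_sos F \<longleftrightarrow> (\<exists>k. sum_squares ([:qt ^ k:] * F))"

lemma poly_qt: "poly qt t = 1 + t\<^sup>2"
  by (simp add: power2_eq_square)

lemma sum_squares_qt: "sum_squares [:qt ^ k:]"
proof -
  have "[:qt:] = [:1:]\<^sup>2 + [:[:0, 1:]:]\<^sup>2" by (simp add: power2_eq_square one_pCons)
  then have "sum_squares [:qt:]" by (simp only: sum_squares_add sum_squares_square)
  then show ?thesis by (simp only: sum_squares_power flip: poly_const_pow)
qed

text \<open>Relative to the central one, the factors by which the sampling kernel acts on a fixed
  frequency are these ratios; the limit 1 expresses that the kernel concentrates.\<close>

lemma binomial_ratio_tendsto:
  "(\<lambda>m. real ((2 * m) choose (m + k)) / real ((2 * m) choose m)) \<longlonglongrightarrow> 1"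
proof (induction k)
  case 0
  have "(2 * m) choose m > 0" for m :: nat by simp
  then have "real ((2 * m) choose (m + 0)) / real ((2 * m) choose m) = 1" for m :: nat
    by (metis add_0_right div_self less_irrefl of_nat_0_less_iff)
  then show ?case by simp
next
  case (Suc k)
  have "(\<lambda>m. (real (2 * k + 1)) / (real (k + 1) + real m)) \<longlonglongrightarrow> 0"
    by (intro tendsto_divide_0[OF tendsto_const] filterlim_at_top_imp_at_infinity
        filterlim_tendsto_add_at_top[OF tendsto_const filterlim_real_sequentially])
  then have "(\<lambda>m. 1 - (real (2 * k + 1)) / (real (k + 1) + real m)) \<longlonglongrightarrow> 1 - 0"
    by (intro tendsto_intros)
  from tendsto_mult[OF this Suc.IH]
  have "(\<lambda>m. (1 - (real (2 * k + 1)) / (real (k + 1) + real m)) *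
      (real ((2 * m) choose (m + k)) / real ((2 * m) choose m))) \<longlonglongrightarrow> 1" by simp
  moreover have "\<forall>\<^sub>F m in sequentially. (1 - (real (2 * k + 1)) / (real (k + 1) + real m)) *
      (real ((2 * m) choose (m + k)) / real ((2 * m) choose m)) =
      real ((2 * m) choose (m + Suc k)) / real ((2 * m) choose m)"
  proof (rule eventually_sequentiallyI[of k])
    fix m assume m: "k \<le> m"
    have "Suc (m + k) * ((2 * m) choose Suc (m + k)) = (2 * m - (m + k)) * ((2 * m) choose (m + k))"
      using binomial_absorb_comp[of "2 * m" "m + k"] binomial_absorption[of "m + k" "2 * m"] by simp
    then have "real (Suc (m + k)) * real ((2 * m) choose Suc (m + k)) =
        real (2 * m - (m + k)) * real ((2 * m) choose (m + k))"
      by (simp only: flip: of_nat_mult)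
    moreover have "real (2 * m - (m + k)) = real m - real k" using m by (simp add: of_nat_diff)
    ultimately have "real ((2 * m) choose Suc (m + k)) =
        (real m - real k) / (real m + real k + 1) * real ((2 * m) choose (m + k))"
      by (simp add: field_simps)
    moreover have "1 - (real (2 * k + 1)) / (real (k + 1) + real m) = (real m - real k) / (real m + real k + 1)"
      by (simp add: field_simps)
    ultimately show "(1 - (real (2 * k + 1)) / (real (k + 1) + real m)) *
      (real ((2 * m) choose (m + k)) / real ((2 * m) choose m)) =
      real ((2 * m) choose (m + Suc k)) / real ((2 * m) choose m)" by simp
  qed
  ultimately show ?case by (rule Lim_transform_eventually)
qed

lemma binomial_ratio_tendsto':
  assumes "p \<le> 2 * n"
  shows "(\<lambda>m. real ((2 * m) choose m) / real ((2 * m) choose (p + m - n))) \<longlonglongrightarrow> 1"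
proof -
  define k where "k = (if p \<ge> n then p - n else n - p)"
  have "(\<lambda>m. inverse (real ((2 * m) choose (m + k)) / real ((2 * m) choose m))) \<longlonglongrightarrow> inverse 1"
    by (intro tendsto_intros binomial_ratio_tendsto) simp
  then have lim: "(\<lambda>m. real ((2 * m) choose m) / real ((2 * m) choose (m + k))) \<longlonglongrightarrow> 1"
    by simp
  have "\<forall>\<^sub>F m in sequentially. real ((2 * m) choose m) / real ((2 * m) choose (m + k)) =
      real ((2 * m) choose m) / real ((2 * m) choose (p + m - n))"
  proof (rule eventually_sequentiallyI[of n])
    fix m assume m: "n \<le> m"
    have "(2 * m) choose (m + k) = (2 * m) choose (p + m - n)"
    proof (cases "p \<ge> n")
      case True
      then show ?thesis by (simp add: k_def add.commute)
    next
      case False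
      then show ?thesis using m binomial_symmetric[of "m + k" "2 * m"] by (simp add: k_def add.commute[of p])
    qed
    then show "real ((2 * m) choose m) / real ((2 * m) choose (m + k)) =
      real ((2 * m) choose m) / real ((2 * m) choose (p + m - n))" by simp
  qed
  with lim show ?thesis by (rule Lim_transform_eventually)
qed

section \<open>Sampling on the circle\<close>

lemma roots_of_unity_orthogonal:
  assumes "p < N" "l < N"
  shows "(\<Sum>j<N. (cis (2 * pi * real p / real N) / cis (2 * pi * real l / real N)) ^ j) =
    (if p = l then of_nat N else 0)"
proof (cases "p = l")
  case False
  define w where "w = cis (2 * pi * real p / real N) / cis (2 * pi * real l / real N)"
  have "w \<noteq> 1"
    using bij_betw_roots_unity[of N] assms False by (auto simp: w_def bij_betw_def inj_on_def)
  moreover have "w ^ N = 1" using assms by (simp add: w_def power_divide DeMoivre)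
  ultimately show ?thesis using False geometric_sum[of w N] by (simp add: w_def)
qed simp

text \<open>The kernel \<open>cos\<^sup>2\<^sup>m(\<alpha> - \<alpha>\<^sub>j)\<close> at \<open>t = tan \<alpha>\<close>, \<open>\<alpha>\<^sub>j = \<pi>j/N\<close>, acts diagonally on trigonometric monomials.\<close>

lemma cosine_kernel:
  fixes t :: real
  assumes "N = Suc (2 * m)" "p \<le> 2 * m"
  defines "x \<equiv> \<lambda>j. cis (pi * real j / real N)"
  shows "(\<Sum>j<N. of_real (Re (x j) + Im (x j) * t) ^ (2 * m) * (x j ^ (2 * p) * cnj (x j) ^ (2 * m))) =
    of_nat N * of_nat ((2 * m) choose p) / 4 ^ m * ((1 + \<i> * t) ^ p * (1 - \<i> * t) ^ (2 * m - p))"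
proof -
  define \<omega> where "\<omega> p = cis (2 * pi * real p / real N)" for p
  have xx: "x j * cnj (x j) = 1" for j by (simp add: x_def cis_cnj cis_mult)
  have x2: "(x j ^ 2) ^ p = \<omega> p ^ j" for j p
    by (simp add: x_def \<omega>_def DeMoivre mult_ac)
  have cx2: "(cnj (x j) ^ 2) ^ p = inverse (\<omega> p ^ j)" for j p
  proof -
    have "(x j ^ 2) ^ p * (cnj (x j) ^ 2) ^ p = 1" by (simp add: xx flip: power_mult_distrib)
    then show ?thesis unfolding x2 by (rule inverse_unique[symmetric])
  qed
  have kernel: "of_real (Re (x j) + Im (x j) * t) ^ (2 * m) * (x j ^ (2 * p) * cnj (x j) ^ (2 * m)) =
      (\<Sum>l\<le>2 * m. of_nat ((2 * m) choose l) / 4 ^ m * ((1 + \<i> * t) ^ l * (1 - \<i> * t) ^ (2 * m - l)) *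
        (\<omega> p / \<omega> l) ^ j)" for j
  proof -
    \<comment> \<open>For \<open>t = tan \<alpha>\<close> the left side is
      \<open>cos (\<alpha> - \<alpha>_j) / cos \<alpha>\<close>; the forms \<open>1 + i t\<close>
      and \<open>1 - i t\<close> play the role of the two exponentials.\<close>
    have half: "of_real (Re (x j) + Im (x j) * t) = ((1 + \<i> * t) * cnj (x j) + (1 - \<i> * t) * x j) / 2"
      by (simp add: complex_eq_iff)
    have four: "(2 :: complex) ^ (2 * m) = 4 ^ m" by (simp add: power_mult)
    have "of_real (Re (x j) + Im (x j) * t) ^ (2 * m) =
        (\<Sum>l\<le>2 * m. of_nat ((2 * m) choose l) * ((1 + \<i> * t) * cnj (x j)) ^ l * ((1 - \<i> * t) * x j) ^ (2 * m - l)) / 4 ^ m"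
      unfolding half power_divide four binomial_ring ..
    then have "of_real (Re (x j) + Im (x j) * t) ^ (2 * m) * (x j ^ (2 * p) * cnj (x j) ^ (2 * m)) =
      (\<Sum>l\<le>2 * m. of_nat ((2 * m) choose l) / 4 ^ m * ((1 + \<i> * t) ^ l * (1 - \<i> * t) ^ (2 * m - l)) *
        (x j ^ (2 * m - l) * cnj (x j) ^ l * (x j ^ (2 * p) * cnj (x j) ^ (2 * m))))"
      by (simp only: sum_divide_distrib sum_distrib_right)
        (intro sum.cong refl, simp add: power_mult_distrib mult_ac)
    also have "\<dots> = (\<Sum>l\<le>2 * m. of_nat ((2 * m) choose l) / 4 ^ m * ((1 + \<i> * t) ^ l * (1 - \<i> * t) ^ (2 * m - l)) *
        (\<omega> p / \<omega> l) ^ j)"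
    proof (intro sum.cong refl arg_cong2[of _ _ _ _ "(*)"])
      fix l assume "l \<in> {..2 * m}"
      then have "2 * m = (2 * m - l) + l" by simp
      then have "cnj (x j) ^ (2 * m) = cnj (x j) ^ (2 * m - l) * cnj (x j) ^ l" by (metis power_add)
      then have "x j ^ (2 * m - l) * cnj (x j) ^ l * (x j ^ (2 * p) * cnj (x j) ^ (2 * m)) =
        (x j * cnj (x j)) ^ (2 * m - l) * ((x j ^ 2) ^ p * (cnj (x j) ^ 2) ^ l)"
      proof -
        have e1: "(x j ^ 2) ^ p = x j ^ (2 * p)" by (rule power_mult[symmetric])
        have e2: "(cnj (x j) ^ 2) ^ l = cnj (x j) ^ l * cnj (x j) ^ l"
          by (simp only: power2_eq_square power_mult_distrib)
        show ?thesis
          unfolding e1 e2 \<open>cnj (x j) ^ (2 * m) = _\<close> by (simp only: power_mult_distrib mult_ac)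
      qed
      then show "x j ^ (2 * m - l) * cnj (x j) ^ l * (x j ^ (2 * p) * cnj (x j) ^ (2 * m)) = (\<omega> p / \<omega> l) ^ j"
        unfolding xx x2 cx2 by (simp add: power_mult_distrib power_inverse divide_inverse)
    qed
    finally show ?thesis .
  qed
  \<comment> \<open>With \<open>N = 2 * m + 1\<close> nodes the frequencies from 0 to
    \<open>2 * m\<close> are distinct modulo \<open>N\<close>, so the sum over \<open>j\<close>
    leaves only \<open>l = p\<close>.\<close>
  have "(\<Sum>j<N. of_real (Re (x j) + Im (x j) * t) ^ (2 * m) * (x j ^ (2 * p) * cnj (x j) ^ (2 * m))) =
     (\<Sum>l\<le>2 * m. of_nat ((2 * m) choose l) / 4 ^ m * ((1 + \<i> * t) ^ l * (1 - \<i> * t) ^ (2 * m - l)) *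
        (\<Sum>j<N. (\<omega> p / \<omega> l) ^ j))"
    unfolding kernel by (subst sum.swap) (simp add: sum_distrib_left)
  also have "\<dots> = (\<Sum>l\<le>2 * m. if p = l then of_nat ((2 * m) choose l) / 4 ^ m *
      ((1 + \<i> * t) ^ l * (1 - \<i> * t) ^ (2 * m - l)) * of_nat N else 0)"
    unfolding \<omega>_def using assms by (intro sum.cong refl) (subst roots_of_unity_orthogonal; simp)
  also have "\<dots> = of_nat N * of_nat ((2 * m) choose p) / 4 ^ m * ((1 + \<i> * t) ^ p * (1 - \<i> * t) ^ (2 * m - p))"
    using assms by (simp add: mult_ac)
  finally show ?thesis .
qed

text \<open>For \<open>t = tan \<alpha>\<close> the products are trigonometric monomials divided by
  \<open>cos^M \<alpha>\<close>. Both 1 and \<open>t\<close> are combinations of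
  \<open>1 + i t\<close> and \<open>1 - i t\<close>, so raising the degree by one amounts to
  multiplying by these two forms.\<close>

lemma trigonometric_expansion:
  fixes a :: "real poly"
  assumes "degree a \<le> M"
  shows "\<exists>b :: nat \<Rightarrow> complex. \<forall>t :: real. of_real (poly a t) =
    (\<Sum>p\<le>M. b p * ((1 + \<i> * t) ^ p * (1 - \<i> * t) ^ (M - p)))"
  using assms
proof (induction M arbitrary: a)
  case 0
  then obtain c where "a = [:c:]" by (auto elim: degree_eq_zeroE)
  then show ?case by (intro exI[of _ "\<lambda>_. of_real c"]) simp
next
  case (Suc M)
  define T where "T = (\<lambda>b M (t :: real). \<Sum>p\<le>M. b p * ((1 + \<i> * t) ^ p * (1 - \<i> * t) ^ (M - p) :: complex))"
  obtain c a' where a: "a = pCons c a'" by (cases a)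
  have "degree a' \<le> M" using Suc.prems by (auto simp: a split: if_splits)
  then obtain b1 where b1: "\<And>t. of_real (poly a' t) = T b1 M t" using Suc.IH T_def by metis
  obtain b2 where b2: "\<And>t. of_real (poly [:c:] t) = T b2 M t" using Suc.IH[of "[:c:]"] T_def by auto
  have up: "(1 + \<i> * t) * T b M t = T (\<lambda>p. if p = 0 then 0 else b (p - 1)) (Suc M) t" for b t
    unfolding T_def sum.atMost_Suc_shift by (simp add: sum_distrib_left mult_ac)
  have down: "(1 - \<i> * t) * T b M t = T (\<lambda>p. if p = Suc M then 0 else b p) (Suc M) t" for b t
  proof -
    have "(1 - \<i> * t) * T b M t = (\<Sum>p\<le>M. b p * ((1 + \<i> * t) ^ p * (1 - \<i> * t) ^ (Suc M - p)))"
      unfolding T_def sum_distrib_left by (intro sum.cong) (auto simp: Suc_diff_le mult_ac)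
    also have "\<dots> = T (\<lambda>p. if p = Suc M then 0 else b p) (Suc M) t"
      unfolding T_def sum.atMost_Suc by simp
    finally show ?thesis .
  qed
  have add: "T b M t + T b' M t = T (\<lambda>p. b p + b' p) M t" for b b' M t
    by (simp add: T_def algebra_simps flip: sum.distrib)
  have scale: "e * T b M t = T (\<lambda>p. e * b p) M t" for e b M t
    by (simp add: T_def sum_distrib_left mult_ac)
  have "complex_of_real (poly a t) = (1 / 2) * ((1 + \<i> * t) * T b2 M t) + (1 / 2) * ((1 - \<i> * t) * T b2 M t)
      + ((- \<i> / 2) * ((1 + \<i> * t) * T b1 M t) + (\<i> / 2) * ((1 - \<i> * t) * T b1 M t))" for t
    using b1[of t, symmetric] b2[of t, symmetric] by (simp add: a algebra_simps)
  note this[unfolded up down, unfolded scale add]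
  then have "\<exists>b. \<forall>t. complex_of_real (poly a t) = T b (Suc M) t" by (intro exI allI)
  then show ?case unfolding T_def .
qed

lemma abs_power_le:
  fixes r :: real
  assumes "i \<le> 2 * d"
  shows "\<bar>r\<bar> ^ i \<le> (1 + r\<^sup>2) ^ d"
proof (cases "\<bar>r\<bar> \<le> 1")
  case True
  then have "\<bar>r\<bar> ^ i \<le> 1" by (simp add: power_le_one)
  also have "1 \<le> (1 + r\<^sup>2) ^ d" by (rule one_le_power) simp
  finally show ?thesis .
next
  case False
  then have "\<bar>r\<bar> ^ i \<le> \<bar>r\<bar> ^ (2 * d)" using assms by (intro power_increasing) auto
  also have "\<dots> = (r\<^sup>2) ^ d" by (simp add: power_mult)
  also have "\<dots> \<le> (1 + r\<^sup>2) ^ d" by (intro power_mono) auto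
  finally show ?thesis .
qed

lemma lift_sum_squares:
  fixes P :: "real poly"
  assumes "\<And>r. poly P r \<ge> 0"
  shows "sum_squares (map_poly (\<lambda>c. [:c:]) P)"
proof -
  interpret l: unital_hom "\<lambda>c :: real. [:c:]" by standard auto
  interpret m: unital_hom "map_poly (\<lambda>c :: real. [:c:])" by (rule l.map_poly_hom)
  obtain a b where "P = a\<^sup>2 + b\<^sup>2" using nonneg_poly_two_squares[OF assms] by blast
  then show ?thesis by (simp add: m.add m.power sum_squares_add sum_squares_square)
qed

lemma ev_lift: "ev (map_poly (\<lambda>c. [:c:]) P) t r = poly P r"
  by (induction P) (simp_all add: map_poly_pCons)

text \<open>The kernel alone would damp each frequency slightly, so the trigonometric coefficients
  are corrected in advance and the reproduction of \<open>F\<close> is exact. The price is that the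
  sampled polynomials \<open>P j\<close> are not quite the values of \<open>F\<close> at the nodes;
  for large \<open>m\<close> the difference is below the strict margin, hence they are
  nonnegative.\<close>

theorem strictly_positive_cyl_sos:
  assumes dt: "\<And>i. degree (coeff F i) \<le> 2 * n" and dr: "degree F \<le> 2 * d" and c: "c > 0"
    and pos: "\<And>t r. ev F t r \<ge> c * (1 + t\<^sup>2) ^ n * (1 + r\<^sup>2) ^ d"
  shows "cyl_sos F"
proof -
  have "\<forall>i. \<exists>b :: nat \<Rightarrow> complex. \<forall>t :: real. of_real (poly (coeff F i) t) =
      (\<Sum>p\<le>2 * n. b p * ((1 + \<i> * t) ^ p * (1 - \<i> * t) ^ (2 * n - p)))"
    using trigonometric_expansion[OF dt] by blast
  then obtain b :: "nat \<Rightarrow> nat \<Rightarrow> complex" where b: "\<And>i t. of_real (poly (coeff F i) t) =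
      (\<Sum>p\<le>2 * n. b i p * ((1 + \<i> * t) ^ p * (1 - \<i> * t) ^ (2 * n - p)))" by metis
  define B where "B = (\<Sum>i\<le>2 * d. \<Sum>p\<le>2 * n. cmod (b i p))"
  have "B \<ge> 0" by (auto simp: B_def intro!: sum_nonneg)
  \<comment> \<open>\<open>B\<close> is the total size of the coefficients, so relative errors of
    size \<open>\<delta>\<close> add up to at most \<open>c\<close>; the summand 1 covers
    \<open>B = 0\<close>.\<close>
  define \<delta> where "\<delta> = c / (B + 1)"
  have \<delta>: "\<delta> > 0" "\<delta> * B \<le> c" using c \<open>B \<ge> 0\<close> by (auto simp: \<delta>_def field_simps)
  define \<Lambda> where "\<Lambda> m p = real ((2 * m) choose m) / real ((2 * m) choose (p + m - n))" for m p
  have "\<forall>\<^sub>F m in sequentially. \<forall>p\<in>{..2 * n}. dist (\<Lambda> m p) 1 < \<delta>"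
    unfolding \<Lambda>_def using \<delta>(1)
    by (intro eventually_ball_finite ballI tendstoD[OF binomial_ratio_tendsto']) auto
  then have "\<forall>\<^sub>F m in sequentially. (\<forall>p\<in>{..2 * n}. dist (\<Lambda> m p) 1 < \<delta>) \<and> n \<le> m"
    using eventually_ge_at_top[of n] by eventually_elim auto
  then obtain m where m: "n \<le> m" "\<And>p. p \<le> 2 * n \<Longrightarrow> \<bar>\<Lambda> m p - 1\<bar> \<le> \<delta>"
    unfolding eventually_sequentially dist_real_def by (metis atMost_iff less_imp_le order_refl)
  define N where "N = Suc (2 * m)"
  define x where "x j = cis (pi * real j / real N)" for j
  \<comment> \<open>\<open>A0 i j\<close> is the coefficient of \<open>F\<close> at the
    \<open>j\<close>-th node, up to a power of the cosine; \<open>A i j\<close> is the same with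
    every frequency corrected for the damping by the kernel.\<close>
  define A where "A i j = (\<Sum>p\<le>2 * n. b i p * of_real (\<Lambda> m p) * (x j ^ (2 * p) * cnj (x j) ^ (2 * n)))" for i j
  define A0 where "A0 i j = (\<Sum>p\<le>2 * n. b i p * (x j ^ (2 * p) * cnj (x j) ^ (2 * n)))" for i j
  define P where "P j = (\<Sum>i\<le>2 * d. monom (Re (A i j)) i)" for j
  \<comment> \<open>Inverts the action of the kernel at the central frequency;
    \<open>\<Lambda> m p\<close> accounts for the others.\<close>
  define \<kappa> where "\<kappa> = 4 ^ m / (real N * real ((2 * m) choose m))"
  have \<kappa>: "\<kappa> > 0" by (simp add: \<kappa>_def N_def)
  have xx: "x j * cnj (x j) = 1" for j by (simp add: x_def cis_cnj cis_mult)
  have nx: "cmod (x j) = 1" for j by (simp add: x_def)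
  have sampling: "(1 + t\<^sup>2) ^ (m - n) * poly (coeff F i) t =
      (\<Sum>j<N. \<kappa> * (Re (x j) + Im (x j) * t) ^ (2 * m) * Re (A i j))" for i t
  proof -
    have q: "of_real (1 + t\<^sup>2) = (1 + \<i> * t) * (1 - \<i> * t)"
      by (simp add: algebra_simps power2_eq_square)
    have step: "(\<Sum>j<N. of_real (Re (x j) + Im (x j) * t) ^ (2 * m) * (x j ^ (2 * p) * cnj (x j) ^ (2 * n))) * of_real (\<kappa> * \<Lambda> m p) =
        ((1 + \<i> * t) * (1 - \<i> * t)) ^ (m - n) * ((1 + \<i> * t) ^ p * (1 - \<i> * t) ^ (2 * n - p))"
      if p: "p \<le> 2 * n" for p
    proof -
      \<comment> \<open>Multiplying by \<open>(1 + t^2)^(m - n)\<close> turns the monomial with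
        index \<open>p\<close> in degree \<open>2 * n\<close> into the one with index
        \<open>p'\<close> in degree \<open>2 * m\<close>.\<close>
      define p' where "p' = p + m - n"
      have p': "p' = p + (m - n)" "p' \<le> 2 * m" "2 * m - p' = (2 * n - p) + (m - n)"
        using p m(1) by (auto simp: p'_def)
      have "x j ^ (2 * p) * cnj (x j) ^ (2 * n) = x j ^ (2 * p') * cnj (x j) ^ (2 * m)" for j
      proof -
        have "2 * p' = 2 * p + 2 * (m - n)" "2 * m = 2 * n + 2 * (m - n)" using p' m(1) by auto
        then have "x j ^ (2 * p') * cnj (x j) ^ (2 * m) =
            x j ^ (2 * p) * cnj (x j) ^ (2 * n) * (x j * cnj (x j)) ^ (2 * (m - n))"
          by (simp only: power_add power_mult_distrib mult_ac)
        then show ?thesis by (simp add: xx)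
      qed
      then have "(\<Sum>j<N. of_real (Re (x j) + Im (x j) * t) ^ (2 * m) * (x j ^ (2 * p) * cnj (x j) ^ (2 * n))) =
          of_nat N * of_nat ((2 * m) choose p') / 4 ^ m * ((1 + \<i> * t) ^ p' * (1 - \<i> * t) ^ (2 * m - p'))"
        using cosine_kernel[OF N_def p'(2), of t] by (simp add: x_def)
      also have "\<dots> * of_real (\<kappa> * \<Lambda> m p) = (1 + \<i> * t) ^ p' * (1 - \<i> * t) ^ (2 * m - p')"
      proof -
        have L: "\<Lambda> m p = real ((2 * m) choose m) / real ((2 * m) choose p')"
          by (simp add: \<Lambda>_def p'_def)
        have "real ((2 * m) choose p') \<noteq> 0" "real ((2 * m) choose m) \<noteq> 0" "real N \<noteq> 0"
          using p'(2) by (simp_all add: N_def del: of_nat_Suc)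
        then have "real N * real ((2 * m) choose p') / 4 ^ m * (\<kappa> * \<Lambda> m p) = 1"
          by (simp add: L \<kappa>_def)
        from arg_cong[OF this, of complex_of_real]
        have one: "of_nat N * of_nat ((2 * m) choose p') / 4 ^ m * complex_of_real (\<kappa> * \<Lambda> m p) = 1"
          by (simp only: of_real_mult of_real_divide of_real_of_nat_eq of_real_power of_real_numeral of_real_1)
        have "a * y * k = y" if "a * k = 1" for a y k :: complex
          using that by (metis mult.assoc mult.commute mult_1_right)
        from this[OF one] show ?thesis .
      qed
      also have "\<dots> = ((1 + \<i> * t) * (1 - \<i> * t)) ^ (m - n) * ((1 + \<i> * t) ^ p * (1 - \<i> * t) ^ (2 * n - p))"
      proof -
        have "u ^ (p + e) * v ^ (q + e) = (u * v) ^ e * (u ^ p * v ^ q)" for u v :: complex and q e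
          by (simp add: power_add power_mult_distrib mult_ac)
        from this[of "1 + \<i> * t" "m - n" "1 - \<i> * t" "2 * n - p"]
        show ?thesis unfolding p'(1)[symmetric] p'(3)[symmetric] .
      qed
      finally show ?thesis .
    qed
    have "of_real ((1 + t\<^sup>2) ^ (m - n) * poly (coeff F i) t) =
        (\<Sum>p\<le>2 * n. b i p * (((1 + \<i> * t) * (1 - \<i> * t)) ^ (m - n) * ((1 + \<i> * t) ^ p * (1 - \<i> * t) ^ (2 * n - p))))"
      unfolding of_real_mult of_real_power q b sum_distrib_left by (simp add: mult_ac)
    also have "\<dots> = (\<Sum>p\<le>2 * n. \<Sum>j<N. of_real (\<kappa> * (Re (x j) + Im (x j) * t) ^ (2 * m)) *
        (b i p * of_real (\<Lambda> m p) * (x j ^ (2 * p) * cnj (x j) ^ (2 * n))))"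
    proof (intro sum.cong refl)
      fix p assume "p \<in> {..2 * n}"
      then have "p \<le> 2 * n" by simp
      show "b i p * (((1 + \<i> * t) * (1 - \<i> * t)) ^ (m - n) * ((1 + \<i> * t) ^ p * (1 - \<i> * t) ^ (2 * n - p))) =
          (\<Sum>j<N. of_real (\<kappa> * (Re (x j) + Im (x j) * t) ^ (2 * m)) *
            (b i p * of_real (\<Lambda> m p) * (x j ^ (2 * p) * cnj (x j) ^ (2 * n))))"
        unfolding step[OF \<open>p \<le> 2 * n\<close>, symmetric] sum_distrib_left sum_distrib_right
        by (intro sum.cong refl) (simp add: mult_ac)
    qed
    also have "\<dots> = (\<Sum>j<N. of_real (\<kappa> * (Re (x j) + Im (x j) * t) ^ (2 * m)) * A i j)"
      unfolding A_def sum_distrib_left by (rule sum.swap)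
    finally have "Re (of_real ((1 + t\<^sup>2) ^ (m - n) * poly (coeff F i) t)) =
        Re (\<Sum>j<N. of_real (\<kappa> * (Re (x j) + Im (x j) * t) ^ (2 * m)) * A i j)" by (rule arg_cong)
    moreover have "Re (of_real u * z) = u * Re z" for u z by simp
    ultimately show ?thesis by (simp only: Re_complex_of_real Re_sum)
  qed
  have Ppos: "poly (P j) r \<ge> 0" if j: "j < N" for j r
  proof -
    define C where "C = Re (x j)"
    define t where "t = Im (x j) / C"
    \<comment> \<open>Since \<open>N\<close> is odd, no node has the angle \<open>\<pi> / 2\<close>,
      where \<open>t\<close> would be infinite.\<close>
    have C: "C \<noteq> 0"
    proof
      assume "C = 0"
      then have "cos (pi * real j / real N) = 0" by (simp add: C_def x_def)
      moreover have "0 \<le> pi * real j / real N" "pi * real j / real N \<le> pi"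
        using j by (auto simp: field_simps)
      ultimately have "pi * real j / real N = pi / 2"
        using cos_inj_pi[of "pi * real j / real N" "pi / 2"] by simp
      then have "real (2 * j) = real N" using j by (simp add: field_simps)
      then have "2 * j = N" by (simp only: of_nat_eq_iff)
      then show False by (simp add: N_def) presburger
    qed
    have lin: "1 + \<i> * t = x j / C" "1 - \<i> * t = cnj (x j) / C"
      using C by (auto simp: complex_eq_iff t_def C_def field_simps)
    have A0: "A0 i j = of_real (C ^ (2 * n) * poly (coeff F i) t)" for i
    proof -
      have "(1 + \<i> * t) ^ p * (1 - \<i> * t) ^ (2 * n - p) = (x j ^ (2 * p) * cnj (x j) ^ (2 * n)) / of_real C ^ (2 * n)"
        if "p \<le> 2 * n" for p
      proof -
        have 2: "2 * n = p + (2 * n - p)" using that by simp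
        have "x j ^ (2 * p) * cnj (x j) ^ (2 * n) = (x j * cnj (x j)) ^ p * (x j ^ p * cnj (x j) ^ (2 * n - p))"
        proof -
          have e1: "x j ^ (2 * p) = x j ^ p * x j ^ p" by (simp add: mult_2 power_add)
          have e2: "cnj (x j) ^ (2 * n) = cnj (x j) ^ p * cnj (x j) ^ (2 * n - p)"
            using 2 by (metis power_add)
          show ?thesis unfolding e1 e2 by (simp only: power_mult_distrib mult_ac)
        qed
        then have "x j ^ (2 * p) * cnj (x j) ^ (2 * n) = x j ^ p * cnj (x j) ^ (2 * n - p)" by (simp add: xx)
        moreover have "of_real C ^ (2 * n) = (of_real C ^ p * of_real C ^ (2 * n - p) :: complex)"
          using 2 by (metis power_add)
        ultimately show ?thesis by (simp add: lin power_divide)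
      qed
      then have "of_real (poly (coeff F i) t) = A0 i j / of_real C ^ (2 * n)"
        unfolding b A0_def by (simp add: sum_divide_distrib)
      then show ?thesis using C by (simp add: field_simps)
    qed
    have "C * t = Im (x j)" using C by (simp add: t_def)
    moreover have "C\<^sup>2 * (1 + t\<^sup>2) = C\<^sup>2 + (C * t)\<^sup>2" by (simp add: power_mult_distrib distrib_left)
    ultimately have "C\<^sup>2 * (1 + t\<^sup>2) = C\<^sup>2 + (Im (x j))\<^sup>2" by simp
    also have "\<dots> = 1" using cmod_power2[of "x j"] by (simp add: C_def nx)
    finally have "C\<^sup>2 * (1 + t\<^sup>2) = 1" .
    then have C1: "C ^ (2 * n) * (1 + t\<^sup>2) ^ n = 1" by (simp add: power_mult flip: power_mult_distrib)
    have "c * (1 + r\<^sup>2) ^ d = C ^ (2 * n) * (c * (1 + t\<^sup>2) ^ n * (1 + r\<^sup>2) ^ d)"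
    proof -
      have "u * v = w * (u * z * v)" if "w * z = 1" for u v w z :: real
        using that by (metis mult.assoc mult.commute mult_1)
      from this[OF C1] show ?thesis .
    qed
    also have "\<dots> \<le> C ^ (2 * n) * ev F t r" by (intro mult_left_mono pos) simp
    also have "\<dots> = (\<Sum>i\<le>2 * d. Re (A0 i j) * r ^ i)"
      by (simp add: ev_conv_sum[OF dr] A0 sum_distrib_left mult_ac)
    finally have low: "c * (1 + r\<^sup>2) ^ d \<le> (\<Sum>i\<le>2 * d. Re (A0 i j) * r ^ i)" .
    have "\<bar>Re (A i j) * r ^ i - Re (A0 i j) * r ^ i\<bar> \<le> (\<Sum>p\<le>2 * n. cmod (b i p)) * \<delta> * (1 + r\<^sup>2) ^ d"
      if "i \<le> 2 * d" for i
    proof -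
      have "A i j - A0 i j = (\<Sum>p\<le>2 * n. b i p * of_real (\<Lambda> m p - 1) * (x j ^ (2 * p) * cnj (x j) ^ (2 * n)))"
        unfolding A_def A0_def sum_subtractf[symmetric] by (intro sum.cong) (simp_all add: algebra_simps)
      also have "cmod \<dots> \<le> (\<Sum>p\<le>2 * n. cmod (b i p) * \<delta>)"
      proof (rule sum_norm_le)
        fix p assume "p \<in> {..2 * n}"
        then have "\<bar>\<Lambda> m p - 1\<bar> \<le> \<delta>" using m(2) by simp
        then show "cmod (b i p * of_real (\<Lambda> m p - 1) * (x j ^ (2 * p) * cnj (x j) ^ (2 * n))) \<le> cmod (b i p) * \<delta>"
          by (simp add: norm_mult norm_power nx mult_left_mono del: of_real_diff)
      qed
      finally have "\<bar>Re (A i j) - Re (A0 i j)\<bar> \<le> (\<Sum>p\<le>2 * n. cmod (b i p)) * \<delta>"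
        using abs_Re_le_cmod[of "A i j - A0 i j"] by (simp add: sum_distrib_right)
      from mult_mono[OF this abs_power_le[OF that, of r]] show ?thesis
        using \<delta>(1) by (simp add: abs_mult power_abs sum_nonneg flip: left_diff_distrib)
    qed
    then have "\<bar>\<Sum>i\<le>2 * d. (Re (A i j) * r ^ i - Re (A0 i j) * r ^ i)\<bar> \<le>
        (\<Sum>i\<le>2 * d. (\<Sum>p\<le>2 * n. cmod (b i p)) * \<delta> * (1 + r\<^sup>2) ^ d)"
      by (intro order.trans[OF sum_abs] sum_mono) auto
    also have "\<dots> = \<delta> * B * (1 + r\<^sup>2) ^ d" by (simp add: B_def sum_distrib_left sum_distrib_right mult_ac)
    also have "\<dots> \<le> c * (1 + r\<^sup>2) ^ d" by (intro mult_right_mono \<delta>) simp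
    finally have "(\<Sum>i\<le>2 * d. Re (A0 i j) * r ^ i) - (\<Sum>i\<le>2 * d. Re (A i j) * r ^ i) \<le> c * (1 + r\<^sup>2) ^ d"
      by (simp add: sum_subtractf abs_le_iff)
    with low show ?thesis by (simp add: P_def poly_sum poly_monom)
  qed
  define L where "L j = map_poly (\<lambda>c. [:c:]) (P j)" for j
  have "[:qt ^ (m - n):] * F = (\<Sum>j<N. [:[:sqrt \<kappa>:] * [:Re (x j), Im (x j):] ^ m:]\<^sup>2 * L j)"
  proof (rule ev_eqI)
    fix t r
    have "ev ([:qt ^ (m - n):] * F) t r = (1 + t\<^sup>2) ^ (m - n) * (\<Sum>i\<le>2 * d. poly (coeff F i) t * r ^ i)"
      by (simp add: ev_conv_sum[OF dr, symmetric] ev.mult poly_power power2_eq_square)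
    also have "\<dots> = (\<Sum>i\<le>2 * d. (\<Sum>j<N. \<kappa> * (Re (x j) + Im (x j) * t) ^ (2 * m) * Re (A i j)) * r ^ i)"
      unfolding sum_distrib_left mult.assoc[symmetric] sampling ..
    also have "\<dots> = (\<Sum>j<N. \<kappa> * (Re (x j) + Im (x j) * t) ^ (2 * m) * (\<Sum>i\<le>2 * d. Re (A i j) * r ^ i))"
      unfolding sum_distrib_left sum_distrib_right by (subst sum.swap) (simp add: mult_ac)
    also have "\<dots> = ev (\<Sum>j<N. [:[:sqrt \<kappa>:] * [:Re (x j), Im (x j):] ^ m:]\<^sup>2 * L j) t r"
    proof -
      have sq: "(sqrt \<kappa> * y ^ m)\<^sup>2 = \<kappa> * y ^ (2 * m)" for y
        using \<kappa> by (simp add: power_mult_distrib mult.commute[of m] flip: power_mult)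
      have L: "ev (L j) t r = (\<Sum>i\<le>2 * d. Re (A i j) * r ^ i)" for j
        by (simp add: L_def ev_lift P_def poly_sum poly_monom)
      have "ev [:[:sqrt \<kappa>:] * [:Re (x j), Im (x j):] ^ m:] t r = sqrt \<kappa> * (Re (x j) + Im (x j) * t) ^ m" for j
        by (simp add: poly_power mult.commute)
      then show ?thesis unfolding ev.sum ev.mult ev.power L by (simp only: sq)
    qed
    finally show "ev ([:qt ^ (m - n):] * F) t r = ev (\<Sum>j<N. [:[:sqrt \<kappa>:] * [:Re (x j), Im (x j):] ^ m:]\<^sup>2 * L j) t r" .
  qed
  moreover have "sum_squares (L j)" if "j < N" for j
    unfolding L_def using Ppos[OF that] by (rule lift_sum_squares)
  ultimately show ?thesis
    unfolding cyl_sos_def by (metis (no_types, lifting) lessThan_iff sum_squares_mult_square sum_squares_sum)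
qed

subsection \<open>Gluing local and global representations\<close>

lemma cyl_sosI: "sum_squares F \<Longrightarrow> cyl_sos F"
  unfolding cyl_sos_def by (rule exI[of _ 0]) (simp add: one_pCons[symmetric])

lemma cyl_sos_mult_sum_squares:
  assumes "sum_squares S" "cyl_sos F"
  shows "cyl_sos (S * F)"
proof -
  obtain k where "sum_squares ([:qt ^ k:] * F)" using assms(2) by (auto simp: cyl_sos_def)
  from sum_squares_mult[OF assms(1) this] have "sum_squares ([:qt ^ k:] * (S * F))"
    by (simp only: mult_ac)
  then show ?thesis unfolding cyl_sos_def by blast
qed

lemma cyl_sos_add:
  assumes "cyl_sos F" "cyl_sos G"
  shows "cyl_sos (F + G)"
proof -
  obtain k l where kl: "sum_squares ([:qt ^ k:] * F)" "sum_squares ([:qt ^ l:] * G)"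
    using assms by (auto simp: cyl_sos_def)
  have "[:qt ^ (k + l):] = [:qt ^ l:] * [:qt ^ k:]" by (simp add: power_add mult.commute)
  then have "[:qt ^ (k + l):] * (F + G) = [:qt ^ l:] * ([:qt ^ k:] * F) + [:qt ^ k:] * ([:qt ^ l:] * G)"
    by (simp only: distrib_left distrib_right mult_ac)
  then have "sum_squares ([:qt ^ (k + l):] * (F + G))"
    using kl by (simp only: sum_squares_add sum_squares_mult sum_squares_qt)
  then show ?thesis unfolding cyl_sos_def by blast
qed

lemma cyl_sos_cancel_qt:
  assumes "cyl_sos ([:qt ^ l:] * F)"
  shows "cyl_sos F"
proof -
  obtain k where "sum_squares ([:qt ^ k:] * ([:qt ^ l:] * F))" using assms by (auto simp: cyl_sos_def)
  moreover have "[:qt ^ k:] * ([:qt ^ l:] * F) = [:qt ^ (k + l):] * F"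
    by (simp add: power_add mult.commute)
  ultimately show ?thesis unfolding cyl_sos_def by metis
qed

lemma sum_squares_const: "c \<ge> 0 \<Longrightarrow> sum_squares [:[:c :: real:]:]"
  using sum_squares_square[of "[:[:sqrt c:]:]"] by (simp add: power2_eq_square)

lemma cyl_sos_cancel_const:
  assumes "c > 0" "cyl_sos ([:[:c:]:] * F)"
  shows "cyl_sos F"
proof -
  have 1: "[:[:1 / c:]:] * ([:[:c:]:] * F) = F"
    using assms(1) by (simp add: one_pCons[symmetric])
  have "cyl_sos ([:[:1 / c:]:] * ([:[:c:]:] * F))"
    by (rule cyl_sos_mult_sum_squares[OF sum_squares_const assms(2)]) (use assms in simp)
  then show ?thesis unfolding 1 .
qed

section \<open>Degree in \<open>t\<close> and growth estimates\<close>

definition tdeg_le :: "real poly poly \<Rightarrow> nat \<Rightarrow> bool"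
  where "tdeg_le F n \<longleftrightarrow> (\<forall>i. degree (coeff F i) \<le> n)"

lemma tdeg_le_mono: "tdeg_le F m \<Longrightarrow> m \<le> n \<Longrightarrow> tdeg_le F n"
  by (meson tdeg_le_def le_trans)

lemma tdeg_le_add: "tdeg_le F n \<Longrightarrow> tdeg_le G n \<Longrightarrow> tdeg_le (F + G) n"
  by (simp add: tdeg_le_def degree_add_le)

lemma tdeg_le_diff: "tdeg_le F n \<Longrightarrow> tdeg_le G n \<Longrightarrow> tdeg_le (F - G) n"
  by (simp add: tdeg_le_def degree_diff_le)

lemma tdeg_le_mult: "tdeg_le F m \<Longrightarrow> tdeg_le G n \<Longrightarrow> tdeg_le (F * G) (m + n)"
  unfolding tdeg_le_def coeff_mult
  by (intro allI degree_sum_le finite_atMost order.trans[OF degree_mult_le] add_mono) auto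

lemma tdeg_le_const: "degree a \<le> n \<Longrightarrow> tdeg_le [:a:] n"
  by (simp add: tdeg_le_def coeff_pCons split: nat.splits)

lemma tdeg_le_const_mult: "degree a \<le> m \<Longrightarrow> tdeg_le G n \<Longrightarrow> tdeg_le ([:a:] * G) (m + n)"
  by (intro tdeg_le_mult tdeg_le_const)

lemma tdeg_le_sum_list:
  "(\<And>g. g \<in> set gs \<Longrightarrow> tdeg_le (f g) n) \<Longrightarrow> tdeg_le (\<Sum>g\<leftarrow>gs. f g) n"
  by (induction gs) (simp_all add: tdeg_le_add, simp add: tdeg_le_def)

lemma degree_sum_list_le:
  "(\<And>g. g \<in> set gs \<Longrightarrow> degree (f g) \<le> n) \<Longrightarrow> degree (\<Sum>g\<leftarrow>gs. f g) \<le> n"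
  by (induction gs) (auto simp: degree_add_le)

lemma tdeg_le_exists: "\<exists>n. tdeg_le F n"
proof (intro exI)
  show "tdeg_le F (\<Sum>i\<le>degree F. degree (coeff F i))"
    unfolding tdeg_le_def
  proof
    fix i
    show "degree (coeff F i) \<le> (\<Sum>i\<le>degree F. degree (coeff F i))"
      by (cases "i \<le> degree F") (auto intro: member_le_sum simp: coeff_eq_0)
  qed
qed

lemma poly_abs_bound:
  fixes p :: "real poly"
  assumes "degree p \<le> 2 * N"
  shows "\<exists>C\<ge>0. \<forall>t. \<bar>poly p t\<bar> \<le> C * (1 + t\<^sup>2) ^ N"
proof (intro exI conjI allI)
  fix t
  have "\<bar>poly p t\<bar> \<le> (\<Sum>i\<le>degree p. \<bar>coeff p i * t ^ i\<bar>)" unfolding poly_altdef by (rule sum_abs)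
  also have "\<dots> \<le> (\<Sum>i\<le>degree p. \<bar>coeff p i\<bar> * (1 + t\<^sup>2) ^ N)"
    using assms by (intro sum_mono) (auto simp: abs_mult power_abs intro!: mult_left_mono abs_power_le)
  finally show "\<bar>poly p t\<bar> \<le> (\<Sum>i\<le>degree p. \<bar>coeff p i\<bar>) * (1 + t\<^sup>2) ^ N"
    by (simp add: sum_distrib_right)
qed (simp add: sum_nonneg)

lemma ev_abs_bound:
  assumes "tdeg_le F (2 * N)" "degree F \<le> 2 * d"
  shows "\<exists>C\<ge>0. \<forall>t r. \<bar>ev F t r\<bar> \<le> C * (1 + t\<^sup>2) ^ N * (1 + r\<^sup>2) ^ d"
proof -
  have "\<forall>i. \<exists>C\<ge>0. \<forall>t. \<bar>poly (coeff F i) t\<bar> \<le> C * (1 + t\<^sup>2) ^ N"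
    using assms(1) poly_abs_bound by (auto simp: tdeg_le_def)
  then obtain C where C: "\<And>i. C i \<ge> 0" "\<And>i t. \<bar>poly (coeff F i) t\<bar> \<le> C i * (1 + t\<^sup>2) ^ N" by metis
  show ?thesis
  proof (intro exI conjI allI)
    fix t r
    have "\<bar>ev F t r\<bar> \<le> (\<Sum>i\<le>2 * d. \<bar>poly (coeff F i) t * r ^ i\<bar>)"
      unfolding ev_conv_sum[OF assms(2)] by (rule sum_abs)
    also have "\<dots> \<le> (\<Sum>i\<le>2 * d. (C i * (1 + t\<^sup>2) ^ N) * (1 + r\<^sup>2) ^ d)"
      unfolding abs_mult power_abs
    proof (intro sum_mono mult_mono)
      fix i assume "i \<in> {..2 * d}"
      then show "\<bar>r\<bar> ^ i \<le> (1 + r\<^sup>2) ^ d" by (intro abs_power_le) simp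
      show "0 \<le> C i * (1 + t\<^sup>2) ^ N" using C(1)[of i] by simp
    qed (use C in auto)
    finally show "\<bar>ev F t r\<bar> \<le> (\<Sum>i\<le>2 * d. C i) * (1 + t\<^sup>2) ^ N * (1 + r\<^sup>2) ^ d"
      by (simp add: sum_distrib_right)
  qed (simp add: sum_nonneg C)
qed

text \<open>The Chinese remainder multipliers go inside the squares:
  \<open>(1 - A)^2 * S1 + A^2 * S2\<close> is \<open>S1\<close> modulo \<open>m1\<close> and
  \<open>S2\<close> modulo \<open>m2\<close>, since \<open>A\<close> is 0 modulo \<open>m1\<close>
  and 1 modulo \<open>m2\<close>. They do not involve \<open>r\<close>, so the degree bound
  persists.\<close>

lemma sum_squares_mod_crt:
  fixes m1 m2 :: "real poly" and F :: "real poly poly"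
  assumes "coprime m1 m2"
    and "\<And>g. g \<in> set gs \<Longrightarrow> degree g \<le> d" "\<And>g. g \<in> set hs \<Longrightarrow> degree g \<le> d"
    and "[:m1:] dvd F - (\<Sum>g\<leftarrow>gs. g\<^sup>2)" "[:m2:] dvd F - (\<Sum>g\<leftarrow>hs. g\<^sup>2)"
  shows "\<exists>ks. (\<forall>g\<in>set ks. degree g \<le> d) \<and> [:m1 * m2:] dvd F - (\<Sum>g\<leftarrow>ks. g\<^sup>2)"
proof -
  obtain a b where ab: "a * m1 + b * m2 = 1"
    using assms(1) bezout_coefficients_fst_snd[of m1 m2] by (auto simp: coprime_iff_gcd_eq_1)
  define A where "A = [:a * m1:]"
  have B: "[:b * m2:] = 1 - A" using ab by (simp add: A_def one_pCons algebra_simps)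
  define ks where "ks = map (\<lambda>g. [:b * m2:] * g) gs @ map (\<lambda>g. A * g) hs"
  define S1 where "S1 = (\<Sum>g\<leftarrow>gs. g\<^sup>2)"
  define S2 where "S2 = (\<Sum>g\<leftarrow>hs. g\<^sup>2)"
  have K: "(\<Sum>g\<leftarrow>ks. g\<^sup>2) = (1 - A)\<^sup>2 * S1 + A\<^sup>2 * S2"
    unfolding ks_def S1_def S2_def B
    by (simp add: o_def power_mult_distrib sum_list_const_mult del: mult_pCons_left)
  have "F - (\<Sum>g\<leftarrow>ks. g\<^sup>2) = (F - S1) + A * ((2 - A) * S1 - A * S2)"
    unfolding K by (simp add: power2_eq_square algebra_simps)
  moreover have "[:m1:] dvd A" unfolding A_def by (simp add: const_poly_dvd_const_poly_iff)
  ultimately have 1: "[:m1:] dvd F - (\<Sum>g\<leftarrow>ks. g\<^sup>2)"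
    using assms(4) unfolding S1_def by (metis dvd_add dvd_mult2)
  have "F - (\<Sum>g\<leftarrow>ks. g\<^sup>2) = (F - S2) + (1 - A) * ((1 + A) * S2 - (1 - A) * S1)"
    unfolding K by (simp add: power2_eq_square algebra_simps)
  moreover have "[:m2:] dvd 1 - A" unfolding B[symmetric] by (simp add: const_poly_dvd_const_poly_iff)
  ultimately have 2: "[:m2:] dvd F - (\<Sum>g\<leftarrow>ks. g\<^sup>2)"
    using assms(5) unfolding S2_def by (metis dvd_add dvd_mult2)
  have "[:m1 * m2:] dvd F - (\<Sum>g\<leftarrow>ks. g\<^sup>2)"
    using 1 2 assms(1) unfolding const_poly_dvd_iff by (blast intro: divides_mult)
  moreover have "degree g \<le> d" if "g \<in> set ks" for g
    using that assms(2,3) unfolding ks_def A_def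
    by (auto intro: order.trans[OF degree_smult_le])
  ultimately show ?thesis by blast
qed

lemma coprime_linear_powers:
  assumes "t \<notin> T" "finite T"
  shows "coprime ([:- t, 1 :: real:] ^ i) (\<Prod>s\<in>T. [:- s, 1:] ^ k s)"
proof (intro prod_coprime_right)
  fix s assume s: "s \<in> T"
  have "coprime [:- t, 1:] [:- s, 1 :: real:]"
  proof (rule prime_elem_imp_coprime)
    show "prime_elem [:- t, 1 :: real:]" by (rule prime_elem_linear_field_poly) simp
    show "\<not> [:- t, 1:] dvd [:- s, 1 :: real:]"
      using s assms(1) by (auto simp flip: poly_eq_0_iff_dvd)
  qed
  then show "coprime ([:- t, 1 :: real:] ^ i) ([:- s, 1:] ^ k s)" by simp
qed

lemma sum_squares_mod_real_points:
  assumes "psd2 F" "degree F \<le> 2 * d" "finite T"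
  shows "\<exists>gs. (\<forall>g\<in>set gs. degree g \<le> d) \<and>
    [:\<Prod>t\<in>T. [:- t, 1:] ^ k t:] dvd F - (\<Sum>g\<leftarrow>gs. g\<^sup>2)"
  using assms(3)
proof (induction T)
  case empty
  show ?case by (rule exI[of _ "[]"]) (simp flip: one_pCons)
next
  case (insert t T)
  then obtain hs where hs: "\<forall>g\<in>set hs. degree g \<le> d" "[:\<Prod>t\<in>T. [:- t, 1:] ^ k t:] dvd F - (\<Sum>g\<leftarrow>hs. g\<^sup>2)"
    by blast
  obtain gs where gs: "\<forall>g\<in>set gs. degree g \<le> d" "[:[:- t, 1:] ^ k t:] dvd F - (\<Sum>g\<leftarrow>gs. g\<^sup>2)"
    using local_sum_squares_mod[OF assms(1,2), of t "k t"] by blast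
  show ?case
    unfolding prod.insert[OF insert.hyps]
    using sum_squares_mod_crt[OF coprime_linear_powers[OF insert.hyps(2,1), of "k t" k], of gs d hs F]
      gs hs by blast
qed

text \<open>The Chinese remainder multipliers make the degree in \<open>t\<close> uncontrolled;
  reducing all coefficients modulo \<open>M\<close> restores a bound.\<close>

lemma sum_squares_mod_reduced:
  fixes F :: "real poly poly"
  assumes "\<forall>g\<in>set gs. degree g \<le> d" "[:M:] dvd F - (\<Sum>g\<leftarrow>gs. g\<^sup>2)" "M \<noteq> 0"
  shows "\<exists>hs. (\<forall>g\<in>set hs. degree g \<le> d \<and> tdeg_le g (degree M)) \<and> [:M:] dvd F - (\<Sum>g\<leftarrow>hs. g\<^sup>2)"
proof -
  define \<rho> where "\<rho> = map_poly (\<lambda>a. a mod M)"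
  have c\<rho>: "coeff (\<rho> g) i = coeff g i mod M" for g i by (simp add: \<rho>_def coeff_map_poly)
  have "[:M:] dvd g\<^sup>2 - (\<rho> g)\<^sup>2" for g
  proof -
    have "[:M:] dvd g - \<rho> g" by (simp add: const_poly_dvd_iff c\<rho> minus_mod_eq_mult_div)
    moreover have "g\<^sup>2 - (\<rho> g)\<^sup>2 = (g - \<rho> g) * (g + \<rho> g)" by (simp add: power2_eq_square algebra_simps)
    ultimately show ?thesis by simp
  qed
  then have "[:M:] dvd (\<Sum>g\<leftarrow>gs. g\<^sup>2 - (\<rho> g)\<^sup>2)" by (induction gs) (auto intro: dvd_add)
  then have "[:M:] dvd (\<Sum>g\<leftarrow>gs. g\<^sup>2) - (\<Sum>g\<leftarrow>map \<rho> gs. g\<^sup>2)"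
    by (simp add: sum_list_subtractf o_def)
  from dvd_add[OF assms(2) this] have "[:M:] dvd F - (\<Sum>g\<leftarrow>map \<rho> gs. g\<^sup>2)" by simp
  moreover have "degree (\<rho> g) \<le> d \<and> tdeg_le (\<rho> g) (degree M)" if "g \<in> set gs" for g
  proof
    show "degree (\<rho> g) \<le> d"
      using assms(1) that map_poly_degree_leq[of "\<lambda>a. a mod M" g] unfolding \<rho>_def by (meson le_trans)
    show "tdeg_le (\<rho> g) (degree M)"
      unfolding tdeg_le_def c\<rho>
    proof
      fix i
      show "degree (coeff g i mod M) \<le> degree M"
        using degree_mod_less[OF assms(3), of "coeff g i"] by auto
    qed
  qed
  ultimately show ?thesis by (intro exI[of _ "map \<rho> gs"]) auto
qed

text \<open>By Bernoulli \<open>N * x\<close> is at most \<open>(1 + x)^N\<close>, and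
  \<open>(1 - x^2)^N \<le> 1\<close>. The resulting decay of \<open>(1 - x)^N * x\<close> like
  \<open>1 / N\<close> is what the cutoff relies on.\<close>

lemma power_times_le:
  fixes x :: real
  assumes "0 \<le> x" "x \<le> 1"
  shows "(1 - x) ^ N * (real N * x) \<le> 1"
proof -
  have "(1 - x) ^ N * (real N * x) \<le> (1 - x) ^ N * (1 + x) ^ N"
    using assms Bernoulli_inequality[of x N] by (intro mult_left_mono) auto
  also have "\<dots> = (1 - x\<^sup>2) ^ N" by (simp add: power2_eq_square algebra_simps flip: power_mult_distrib)
  also have "\<dots> \<le> 1" using assms by (intro power_le_one) (auto simp: abs_square_le_1 power_le_one)
  finally show ?thesis .
qed

abbreviation qr :: "real poly poly" where "qr \<equiv> [:1, 0, 1:]"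

lemma ev_qr: "ev qr t r = 1 + r\<^sup>2"
  by (simp add: power2_eq_square)

lemma degree_qr_power: "degree (qr ^ d) \<le> 2 * d"
  using degree_power_le[of qr d] by simp

lemma tdeg_le_qr_power: "tdeg_le (qr ^ d) 0"
proof (induction d)
  case 0
  then show ?case by (simp add: tdeg_le_def)
next
  case (Suc d)
  have "tdeg_le qr 0" by (auto simp: tdeg_le_def coeff_pCons split: nat.splits)
  from tdeg_le_mult[OF this Suc] show ?case by simp
qed

lemma degree_qt_power: "degree (qt ^ k) = 2 * k"
  by (simp add: degree_power_eq)

lemma degree_const_mult_le: "degree ([:a:] * F) \<le> degree (F :: 'a :: idom poly)"
  by (simp add: degree_smult_le)

text \<open>Half of the lower bound is set aside as \<open>W * H\<close>, where \<open>W\<close> is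
  the square of \<open>w\<close>. The rest \<open>F0\<close> is still nonnegative, so locally it is
  a sum of squares \<open>S\<close>, and \<open>F = S + W * (H + W * E)\<close>. The error
  \<open>E\<close> has no sign; the cutoff \<open>X\<close> suppresses it away from the zeros of
  \<open>w\<close>, and the factor \<open>W\<close> makes it small near them, so that
  \<open>H\<close> absorbs it everywhere.\<close>

theorem glue_cyl_sos:
  assumes tF: "tdeg_le F (2 * n)" and dF: "degree F \<le> 2 * d"
    and T: "finite T" and w: "w = (\<Prod>t\<in>T. [:- t, 1:] ^ k t)" and e: "e = degree w" "4 * e \<le> n"
    and c: "c > 0"
    and low: "\<And>t r. ev F t r \<ge> 2 * c * (poly w t)\<^sup>2 * (1 + t\<^sup>2) ^ (n - e) * (1 + r\<^sup>2) ^ d"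
  shows "cyl_sos F"
proof -
  have w0: "w \<noteq> 0" using T by (simp add: w)
  define H where "H = [:[:c:] * qt ^ (n - e):] * qr ^ d"
  have evH: "ev H t r = c * (1 + t\<^sup>2) ^ (n - e) * (1 + r\<^sup>2) ^ d" for t r
    unfolding H_def by (simp add: ev.mult ev.power ev_qr poly_power poly_qt del: mult_pCons_left ev_pCons)
      (simp add: poly_power power2_eq_square)
  have dH: "degree H \<le> 2 * d" unfolding H_def
    by (rule order.trans[OF degree_const_mult_le degree_qr_power])
  have tH: "tdeg_le H (2 * (n - e))"
  proof -
    have "degree ([:c:] * qt ^ (n - e)) \<le> 2 * (n - e)"
      using degree_qt_power[of "n - e"] c by simp
    from tdeg_le_const_mult[OF this tdeg_le_qr_power] show ?thesis by (simp add: H_def)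
  qed
  define W where "W = w\<^sup>2"
  have dW: "degree W = 2 * e" using w0 by (simp add: W_def e degree_power_eq)
  have W0: "poly W t \<ge> 0" for t by (simp add: W_def)
  define F0 where "F0 = F - [:W:] * H"
  have evF0: "ev F0 t r = ev F t r - poly W t * ev H t r" for t r
    by (simp add: F0_def ev.diff)
  have evW: "poly W t * ev H t r \<ge> 0" for t r
    unfolding evH using W0[of t] c by simp
  have evF: "ev F t r \<ge> 2 * (poly W t * ev H t r)" for t r
    using low[of t r] by (simp add: evH W_def mult_ac)
  have psd: "psd2 F0"
    unfolding psd2_def evF0 using evF evW by (metis add_increasing2 diff_ge_0_iff_ge mult_2 order.trans order_refl)
  have dF0: "degree F0 \<le> 2 * d" unfolding F0_def
    by (intro degree_diff_le dF order.trans[OF degree_const_mult_le dH])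
  have tF0: "tdeg_le F0 (2 * n)"
  proof -
    have "tdeg_le ([:W:] * H) (2 * e + 2 * (n - e))"
      by (rule tdeg_le_const_mult[OF _ tH]) (simp add: dW)
    then show ?thesis unfolding F0_def using e(2) by (intro tdeg_le_diff tF) (simp add: algebra_simps)
  qed
  \<comment> \<open>Twice the exponent of \<open>W\<close>: one factor \<open>W\<close> is divided
    off in the end, the other stays with the error \<open>E\<close>.\<close>
  define M where "M = w ^ 4"
  have M: "M = (\<Prod>t\<in>T. [:- t, 1:] ^ (k t * 4))" by (simp add: M_def w power_mult prod_power_distrib)
  have M0: "M \<noteq> 0" and dM: "degree M = 4 * e" using w0 by (simp_all add: M_def degree_power_eq e)
  have MW: "M = W * W" by (simp add: M_def W_def flip: power_add)
  obtain gs where gs: "\<forall>g\<in>set gs. degree g \<le> d \<and> tdeg_le g (degree M)" "[:M:] dvd F0 - (\<Sum>g\<leftarrow>gs. g\<^sup>2)"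
    using sum_squares_mod_real_points[OF psd dF0 T, of "\<lambda>t. k t * 4"] sum_squares_mod_reduced[OF _ _ M0, of _ d F0]
    unfolding M[symmetric] by blast
  define S where "S = (\<Sum>g\<leftarrow>gs. g\<^sup>2)"
  obtain E where E: "F0 - S = [:M:] * E" using gs(2) by (auto simp: S_def)
  have "tdeg_le S (2 * n)"
    unfolding S_def
  proof (rule tdeg_le_sum_list)
    fix g assume "g \<in> set gs"
    then have "tdeg_le g (4 * e)" using gs(1) dM by auto
    from tdeg_le_mult[OF this this] show "tdeg_le (g\<^sup>2) (2 * n)"
      unfolding power2_eq_square using e(2) by (rule_tac tdeg_le_mono) auto
  qed
  then have tME: "tdeg_le ([:M:] * E) (2 * n)" unfolding E[symmetric] by (intro tdeg_le_diff tF0)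
  have tE: "tdeg_le E (2 * (n - 2 * e))"
    unfolding tdeg_le_def
  proof
    fix i
    show "degree (coeff E i) \<le> 2 * (n - 2 * e)"
    proof (cases "coeff E i = 0")
      case False
      then have "4 * e + degree (coeff E i) = degree (coeff ([:M:] * E) i)"
        using M0 dM by (simp add: degree_mult_eq)
      then show ?thesis using tME unfolding tdeg_le_def by (metis add_le_imp_le_diff diff_mult_distrib2 mult.assoc
            add.commute mult_2 numeral_Bit0 mult_2_right)
    qed simp
  qed
  have dE: "degree E \<le> 2 * d"
  proof -
    have "degree S \<le> 2 * d"
      unfolding S_def
    proof (rule degree_sum_list_le)
      fix g assume "g \<in> set gs"
      then have "degree g \<le> d" using gs(1) by auto
      then show "degree (g\<^sup>2) \<le> 2 * d" using degree_power_le[of g 2] by simp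
    qed
    then have "degree ([:M:] * E) \<le> 2 * d" unfolding E[symmetric] using dF0 by (intro degree_diff_le)
    then show ?thesis using M0 by simp
  qed
  obtain C where C: "C \<ge> 0" "\<And>t r. \<bar>ev E t r\<bar> \<le> C * (1 + t\<^sup>2) ^ (n - 2 * e) * (1 + r\<^sup>2) ^ d"
    using ev_abs_bound[OF tE dE] by blast
  obtain K where K: "K > 0" "\<And>t. poly W t \<le> K * (1 + t\<^sup>2) ^ e"
  proof -
    obtain K0 where K0: "K0 \<ge> 0" "\<And>t. \<bar>poly W t\<bar> \<le> K0 * (1 + t\<^sup>2) ^ e"
      using poly_abs_bound[of W e] dW by auto
    have "poly W t \<le> (K0 + 1) * (1 + t\<^sup>2) ^ e" for t
    proof -
      have "(1 + t\<^sup>2) ^ e \<ge> 0" by simp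
      then show ?thesis using K0(2)[of t] unfolding distrib_right by linarith
    qed
    then show thesis using K0(1) by (intro that[of "K0 + 1"]) auto
  qed
  \<comment> \<open>The error will be bounded by \<open>K * C / (2 * l)\<close> in units where the
    reserve \<open>H\<close> counts as \<open>c\<close>; this \<open>l\<close> brings it below one
    half of the reserve.\<close>
  obtain l :: nat where "K * C / c < real l" using reals_Archimedean2 by blast
  then have less: "K * C < c * real l" using c by (simp add: field_simps)
  moreover have "K * C \<ge> 0" using K(1) C(1) by simp
  ultimately have "l \<noteq> 0" by (intro notI) simp
  then have l: "K * C \<le> c * real l" "l > 0" using less by auto
  \<comment> \<open>With \<open>\<omega> = W/A \<in> [0,1]\<close>, the cutoff \<open>X/A\<^sup>l = (1 - \<omega>)\<^sup>l\<close> is 1 modulo \<open>W\<close>, and the error term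
    \<open>(1 - \<omega>)\<^sup>2\<^sup>l \<omega>\<close> is at most \<open>1/(2l)\<close> everywhere.\<close>
  define A where "A = [:K:] * qt ^ e"
  define B where "B = A - W"
  define X where "X = B ^ l"
  define V where "V = (\<Sum>i<2 * l. B ^ (2 * l - Suc i) * A ^ i)"
  have SV: "A ^ (2 * l) - X\<^sup>2 = W * V"
  proof -
    have "A ^ (2 * l) - B ^ (2 * l) = (A - B) * V"
      unfolding V_def by (rule power_diff_sumr2)
    then show ?thesis by (simp add: X_def B_def mult.commute[of l] flip: power_mult)
  qed
  have pA: "poly A t = K * (1 + t\<^sup>2) ^ e" for t by (simp add: A_def poly_power power2_eq_square)
  have Apos: "poly A t > 0" for t unfolding pA using K(1) by (intro mult_pos_pos zero_less_power add_pos_nonneg) auto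
  have B: "0 \<le> poly B t" "poly B t \<le> poly A t" for t
    using K(2)[of t] W0[of t] by (simp_all add: B_def pA)
  have V0: "poly V t \<ge> 0" for t
    unfolding V_def poly_sum using Apos[of t] B(1)[of t] by (intro sum_nonneg) (simp add: poly_power)
  \<comment> \<open>As \<open>A ^ (2 * l)\<close> equals the square of \<open>X\<close> plus
    \<open>W * V\<close>, this is what is left of \<open>A ^ (2 * l) * F\<close> after removing the
    square of \<open>X\<close> times \<open>S\<close>, divided by \<open>W\<close>.\<close>
  define F1 where "F1 = [:V:] * F + [:X\<^sup>2:] * (H + [:W:] * E)"
  have dA: "degree A \<le> 2 * e" using degree_qt_power[of e] K(1) by (simp add: A_def)
  have dB: "degree B \<le> 2 * e" unfolding B_def by (intro degree_diff_le dA) (simp add: dW)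
  have dX: "degree (X\<^sup>2) \<le> 4 * e * l"
  proof -
    have "degree (X\<^sup>2) \<le> degree B * (l * 2)" unfolding X_def power_mult[symmetric] by (rule degree_power_le)
    also have "\<dots> \<le> 2 * e * (l * 2)" using dB by (intro mult_right_mono) auto
    finally show ?thesis by simp
  qed
  have dV: "degree V \<le> 2 * e * (2 * l - 1)"
    unfolding V_def
  proof (intro degree_sum_le finite_lessThan)
    fix i assume i: "i \<in> {..<2 * l}"
    have "degree (B ^ (2 * l - Suc i) * A ^ i) \<le> degree B * (2 * l - Suc i) + degree A * i"
      by (intro order.trans[OF degree_mult_le] add_mono degree_power_le)
    also have "\<dots> \<le> 2 * e * (2 * l - Suc i) + 2 * e * i"
      using dA dB by (intro add_mono mult_right_mono) auto
    also have "\<dots> = 2 * e * (2 * l - 1)"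
      using i by (simp flip: distrib_left)
    finally show "degree (B ^ (2 * l - Suc i) * A ^ i) \<le> 2 * e * (2 * l - 1)" .
  qed
  define n' where "n' = (n - e) + 2 * e * l"
  have "cyl_sos F1"
  proof (rule strictly_positive_cyl_sos[of F1 n' d "c / 2 * K ^ (2 * l)"])
    have le1: "2 * e * (2 * l - 1) + 2 * n \<le> 2 * n'"
    proof -
      have "2 * e * (2 * l - 1) + 2 * e = 4 * e * l" using l(2) by (cases l) (auto simp: algebra_simps)
      then show ?thesis using e(2) unfolding n'_def by (simp add: algebra_simps)
    qed
    have le2: "2 * e + 2 * (n - 2 * e) \<le> 2 * (n - e)" using e(2) by simp
    have "tdeg_le F1 (2 * n')"
      unfolding F1_def
    proof (intro tdeg_le_add)
      show "tdeg_le ([:V:] * F) (2 * n')"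
        by (rule tdeg_le_mono[OF tdeg_le_const_mult[OF dV tF] le1])
      have "tdeg_le ([:W:] * E) (2 * (n - e))"
        by (rule tdeg_le_mono[OF tdeg_le_const_mult[OF _ tE] le2]) (simp add: dW)
      then have "tdeg_le (H + [:W:] * E) (2 * (n - e))" by (intro tdeg_le_add tH)
      from tdeg_le_const_mult[OF dX this] show "tdeg_le ([:X\<^sup>2:] * (H + [:W:] * E)) (2 * n')"
        by (simp add: n'_def algebra_simps)
    qed
    then show "degree (coeff F1 i) \<le> 2 * n'" for i by (simp add: tdeg_le_def)
    show "degree F1 \<le> 2 * d"
      unfolding F1_def by (intro degree_add_le order.trans[OF degree_const_mult_le] dF dH dE)
    show "c / 2 * K ^ (2 * l) > 0" using c K by simp
    fix t r
    define h where "h = ev H t r"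
    define a where "a = poly A t ^ (2 * l)"
    define x where "x = (poly X t)\<^sup>2"
    define y where "y = poly W t"
    have h0: "h \<ge> 0" unfolding h_def evH using c by simp
    have x0: "x \<ge> 0" by (simp add: x_def)
    have xB: "x = poly B t ^ (2 * l)" by (simp add: x_def X_def poly_power mult.commute[of l] flip: power_mult)
    have xa: "x \<le> a" unfolding xB a_def using B by (intro power_mono)
    have av: "y * poly V t = a - x"
      using arg_cong[OF SV, of "\<lambda>p. poly p t"] by (simp add: poly_power a_def x_def y_def)
    have key: "x * y * \<bar>ev E t r\<bar> \<le> a * h / 2"
    proof -
      define \<omega> where "\<omega> = y / poly A t"
      have w01: "0 \<le> \<omega>" "\<omega> \<le> 1"
        using W0[of t] K(2)[of t] Apos[of t] by (auto simp: \<omega>_def y_def pA[symmetric])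
      have yA: "y = \<omega> * poly A t" using Apos[of t] by (simp add: \<omega>_def)
      have Bw: "poly B t = (1 - \<omega>) * poly A t" using yA by (simp add: B_def y_def algebra_simps)
      have x: "x = (1 - \<omega>) ^ (2 * l) * a" unfolding xB Bw a_def power_mult_distrib ..
      define p where "p = (1 + t\<^sup>2) ^ (n - 2 * e)"
      define rr where "rr = (1 + r\<^sup>2) ^ d"
      have pr: "p \<ge> 0" "rr \<ge> 0" by (simp_all add: p_def rr_def)
      have hp: "h = c * ((1 + t\<^sup>2) ^ e * p) * rr"
      proof -
        have "n - e = e + (n - 2 * e)" using e(2) by simp
        then show ?thesis unfolding h_def evH p_def rr_def by (simp only: power_add)
      qed
      have "x * y * \<bar>ev E t r\<bar> \<le> x * y * (C * p * rr)"
        using C(2)[of t r] x0 W0[of t] unfolding p_def rr_def y_def by (intro mult_left_mono) auto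
      also have "\<dots> = ((1 - \<omega>) ^ (2 * l) * \<omega>) * (K * C) * (a * ((1 + t\<^sup>2) ^ e * p) * rr)"
        unfolding x yA pA by (simp only: mult_ac)
      also have "\<dots> \<le> ((1 - \<omega>) ^ (2 * l) * \<omega>) * (c * real l) * (a * ((1 + t\<^sup>2) ^ e * p) * rr)"
        using w01 pr Apos[of t] l(1) unfolding a_def
        by (intro mult_right_mono mult_left_mono mult_nonneg_nonneg zero_le_power) auto
      also have "\<dots> = ((1 - \<omega>) ^ (2 * l) * (real (2 * l) * \<omega>)) * (a * h / 2)"
        unfolding hp by (simp add: field_simps)
      also have "\<dots> \<le> 1 * (a * h / 2)"
        using h0 Apos[of t] by (intro mult_right_mono power_times_le w01) (simp add: a_def)
      finally show ?thesis by simp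
    qed
    have "ev F1 t r = poly V t * ev F t r + x * h + x * (y * ev E t r)"
      by (simp add: F1_def ev.add ev.mult x_def h_def y_def poly_power algebra_simps)
    moreover have "poly V t * ev F t r \<ge> 2 * h * (a - x)"
    proof -
      have "poly V t * (2 * (y * h)) \<le> poly V t * ev F t r"
        using evF[of t r] V0[of t] unfolding y_def h_def by (intro mult_left_mono)
      moreover have "poly V t * (2 * (y * h)) = 2 * h * (y * poly V t)" by simp
      ultimately show ?thesis unfolding av by simp
    qed
    moreover have "x * (y * ev E t r) \<ge> - (a * h / 2)"
    proof -
      have "\<bar>x * (y * ev E t r)\<bar> = x * y * \<bar>ev E t r\<bar>"
        using x0 W0[of t] by (simp add: abs_mult y_def)
      with key show ?thesis by linarith
    qed
    moreover have "x * h \<le> a * h" using xa h0 by (intro mult_right_mono)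
    ultimately have "ev F1 t r \<ge> a * h / 2" by (simp add: algebra_simps)
    also have "a * h / 2 = c / 2 * K ^ (2 * l) * (1 + t\<^sup>2) ^ n' * (1 + r\<^sup>2) ^ d"
      by (simp add: a_def h_def evH pA n'_def power_mult_distrib power_add mult_ac flip: power_mult)
    finally show "c / 2 * K ^ (2 * l) * (1 + t\<^sup>2) ^ n' * (1 + r\<^sup>2) ^ d \<le> ev F1 t r" by simp
  qed
  moreover have "[:A ^ (2 * l):] * F = [:X:]\<^sup>2 * S + [:w:]\<^sup>2 * F1"
  proof -
    have F: "F = S + [:W:] * [:W:] * E + [:W:] * H"
      using E by (simp add: F0_def MW algebra_simps)
    have Xc: "[:X\<^sup>2:] = [:X:]\<^sup>2" and wc: "[:w:]\<^sup>2 = [:W:]" by (simp_all add: power2_eq_square W_def)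
    have "A ^ (2 * l) = X\<^sup>2 + W * V" using SV by (simp add: algebra_simps)
    then have "[:A ^ (2 * l):] = [:X:]\<^sup>2 + [:W:] * [:V:]" by (simp add: Xc[symmetric])
    then have "[:A ^ (2 * l):] * F = [:X:]\<^sup>2 * F + [:W:] * ([:V:] * F)" by (simp only: distrib_right mult.assoc)
    also have "[:X:]\<^sup>2 * F = [:X:]\<^sup>2 * (S + [:W:] * [:W:] * E + [:W:] * H)" using F by (rule arg_cong)
    finally show ?thesis unfolding F1_def Xc wc by (simp only: distrib_left distrib_right mult_ac add_ac)
  qed
  ultimately have "cyl_sos ([:A ^ (2 * l):] * F)"
    by (simp only: cyl_sos_add cyl_sos_mult_sum_squares sum_squares_square cyl_sosI sum_squares_mult
        S_def sum_squares_sum_list)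
  moreover have "[:A ^ (2 * l):] * F = [:[:K ^ (2 * l):]:] * ([:qt ^ (e * (2 * l)):] * F)"
    by (simp add: A_def smult_power flip: power_mult)
  ultimately show ?thesis
    using cyl_sos_cancel_qt cyl_sos_cancel_const[of "K ^ (2 * l)"] K(1) by (metis zero_less_power)
qed

subsection \<open>Square factors and the Bezout relation with the derivative\<close>

text \<open>Prime factors are taken from the primitive part, which no nonunit constant
  divides.\<close>

lemma prime_factor_positive_degree:
  fixes g :: "real poly poly"
  assumes "degree g > 0"
  obtains \<pi> where "prime_elem \<pi>" "degree \<pi> > 0" "\<pi> dvd g"
proof -
  have g0: "g \<noteq> 0" using assms by auto
  define p where "p = primitive_part g"
  have "degree p > 0" using assms by (simp add: p_def)
  then have "\<not> is_unit p" by (auto simp: is_unit_poly_iff)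
  moreover have "p \<noteq> 0" using g0 by (simp add: p_def)
  ultimately obtain \<pi> where \<pi>: "\<pi> dvd p" "prime \<pi>" using prime_divisor_exists by blast
  have "degree \<pi> > 0"
  proof (rule ccontr)
    assume "\<not> degree \<pi> > 0"
    then obtain c where c: "\<pi> = [:c:]" by (auto elim: degree_eq_zeroE)
    then have "c dvd content p" using \<pi>(1) by (simp add: const_poly_dvd_iff_dvd_content)
    also have "content p = 1" using g0 by (simp add: p_def)
    finally have "is_unit \<pi>" by (simp add: c is_unit_const_poly_iff)
    then show False using \<pi>(2) by auto
  qed
  moreover have "\<pi> dvd g" using \<pi>(1) unfolding p_def
    by (metis content_times_primitive_part dvd_smult)
  ultimately show thesis using that \<pi>(2) by blast
qed

text \<open>An element \<open>g\<close> of least degree in the ideal of \<open>F\<close> and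
  \<open>pderiv F\<close> divides both up to factors in \<open>t\<close>, by pseudo-division. If
  \<open>g\<close> is constant in \<open>r\<close>, it is the Bezout constant; otherwise a prime
  factor of \<open>g\<close> divides \<open>F\<close> and its derivative, hence divides
  \<open>F\<close> twice.\<close>

lemma square_factor_or_bezout:
  fixes F :: "real poly poly"
  assumes "degree F > 0"
  shows "(\<exists>\<pi>. degree \<pi> > 0 \<and> \<pi>\<^sup>2 dvd F) \<or> (\<exists>u v \<delta>. \<delta> \<noteq> 0 \<and> u * F + v * pderiv F = [:\<delta>:])"
proof -
  have F0: "F \<noteq> 0" using assms by auto
  define I where "I = {g. g \<noteq> 0 \<and> (\<exists>u v. g = u * F + v * pderiv F)}"
  have "F = 1 * F + 0 * pderiv F" by simp
  then have "F \<in> I" using F0 unfolding I_def by blast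
  then obtain g where g: "g \<in> I" "\<And>h. h \<in> I \<Longrightarrow> degree g \<le> degree h"
    using ex_has_least_nat[of "\<lambda>x. x \<in> I" _ degree] by blast
  obtain u v where uv: "g = u * F + v * pderiv F" and g0: "g \<noteq> 0" using g(1) by (auto simp: I_def)
  have div: "\<exists>c. c \<noteq> 0 \<and> g dvd [:c:] * P" if P: "\<exists>a b. P = a * F + b * pderiv F" for P
  proof -
    obtain q r where qr: "pseudo_divmod P g = (q, r)" by fastforce
    define c where "c = coeff g (degree g) ^ (Suc (degree P) - degree g)"
    have c: "c \<noteq> 0" using g0 by (simp add: c_def)
    have eq: "[:c:] * P = g * q + r" and r: "r = 0 \<or> degree r < degree g"
      using pseudo_divmod[OF g0 qr] by (simp_all add: c_def)
    obtain a b where ab: "P = a * F + b * pderiv F" using P by blast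
    have "r = ([:c:] * a - q * u) * F + ([:c:] * b - q * v) * pderiv F"
      using eq unfolding ab uv by (simp add: algebra_simps)
    then have "r = 0 \<or> r \<in> I" by (auto simp: I_def)
    then have "r = 0" using r g(2) by fastforce
    then show ?thesis using eq c by (metis add_0_right dvd_triv_left)
  qed
  show ?thesis
  proof (cases "degree g = 0")
    case True
    then obtain \<delta> where "g = [:\<delta>:]" by (rule degree_eq_zeroE)
    then show ?thesis using uv g0 by (metis pCons_0_0)
  next
    case False
    obtain \<pi> where \<pi>: "prime_elem \<pi>" "degree \<pi> > 0" "\<pi> dvd g"
      using prime_factor_positive_degree[of g] False by auto
    have no_const: "\<not> \<pi> dvd [:c:]" if "c \<noteq> 0" for c
    proof
      assume "\<pi> dvd [:c:]"
      then have "degree \<pi> \<le> degree [:c:]" using that by (intro dvd_imp_degree_le) auto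
      then show False using \<pi>(2) by simp
    qed
    have dvd: "\<pi> dvd P" if P: "\<exists>a b. P = a * F + b * pderiv F" for P
    proof -
      obtain c where c: "c \<noteq> 0" "g dvd [:c:] * P" using div[OF P] by blast
      then have "\<pi> dvd [:c:] * P" using \<pi>(3) dvd_trans by blast
      then show ?thesis using prime_elem_dvd_multD[OF \<pi>(1)] no_const[OF c(1)] by blast
    qed
    have "F = 1 * F + 0 * pderiv F" "pderiv F = 0 * F + 1 * pderiv F" by simp_all
    then have dF: "\<pi> dvd F" and dF': "\<pi> dvd pderiv F" using dvd by blast+
    obtain h where h: "F = \<pi> * h" using dF by blast
    have "\<pi> dvd pderiv F - \<pi> * pderiv h" using dF' by simp
    then have "\<pi> dvd h * pderiv \<pi>" by (simp add: h pderiv_mult)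
    moreover have "\<not> \<pi> dvd pderiv \<pi>"
    proof
      assume a: "\<pi> dvd pderiv \<pi>"
      have "pderiv \<pi> \<noteq> 0" using \<pi>(2) by (simp add: pderiv_eq_0_iff)
      from dvd_imp_degree_le[OF a this] show False using \<pi>(2) by (simp add: degree_pderiv)
    qed
    ultimately have "\<pi> dvd h" using prime_elem_dvd_multD[OF \<pi>(1)] by blast
    then have "\<pi>\<^sup>2 dvd F" unfolding h power2_eq_square by (rule mult_dvd_mono[OF dvd_refl])
    then show ?thesis using \<pi>(2) by blast
  qed
qed

subsection \<open>Lower bounds\<close>

text \<open>The value at \<open>r + h\<close> is nonnegative and lies below the quadratic Taylor
  bound; \<open>h\<close> is the minimizer of that bound, and the bound on the derivative keeps
  \<open>h\<close> within distance 1.\<close>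

lemma deriv_square_le:
  fixes p :: "real poly"
  assumes nn: "\<And>x. poly p x \<ge> 0" and M: "M > 0" "\<bar>poly (pderiv p) r\<bar> \<le> M"
    and M2: "\<And>x. \<bar>x - r\<bar> \<le> 1 \<Longrightarrow> poly (pderiv (pderiv p)) x \<le> M"
  shows "(poly (pderiv p) r)\<^sup>2 \<le> 2 * M * poly p r"
proof (cases "poly (pderiv p) r = 0")
  case True
  then show ?thesis using nn[of r] M by simp
next
  case False
  define h where "h = - poly (pderiv p) r / M"
  have h: "\<bar>h\<bar> \<le> 1" "h \<noteq> 0" using M False by (auto simp: h_def abs_le_iff field_simps)
  define diff where "diff m = (if m = 0 then poly p else if m = 1 then poly (pderiv p) else poly (pderiv (pderiv p)))" for m :: nat
  have "\<forall>m t. m < 2 \<and> r - 1 \<le> t \<and> t \<le> r + 1 \<longrightarrow> DERIV (diff m) t :> diff (Suc m) t"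
    by (auto simp: diff_def less_2_cases_iff)
  from Taylor[of 2 diff "poly p" "r - 1" "r + 1" r "r + h", OF _ _ this]
  obtain t where t: "if r + h < r then r + h < t \<and> t < r else r < t \<and> t < r + h"
    and eq: "poly p (r + h) = (\<Sum>m<2. diff m r / fact m * (r + h - r) ^ m) + diff 2 t / fact 2 * (r + h - r) ^ 2"
    using h by (auto simp: diff_def abs_le_iff)
  have "\<bar>t - r\<bar> \<le> 1" using t h by (auto split: if_splits)
  then have "poly (pderiv (pderiv p)) t * h\<^sup>2 \<le> M * h\<^sup>2" by (intro mult_right_mono M2) auto
  moreover have "poly p (r + h) = poly p r + poly (pderiv p) r * h + poly (pderiv (pderiv p)) t * h\<^sup>2 / 2"
    using eq by (simp add: diff_def numeral_2_eq_2)
  ultimately have "0 \<le> poly p r + poly (pderiv p) r * h + M * h\<^sup>2 / 2" using nn[of "r + h"] by linarith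
  also have "M * h\<^sup>2 = (poly (pderiv p) r)\<^sup>2 / M" using M by (simp add: h_def power2_eq_square)
  also have "poly (pderiv p) r * h = - ((poly (pderiv p) r)\<^sup>2 / M)" by (simp add: h_def power2_eq_square)
  finally have "(poly (pderiv p) r)\<^sup>2 / M \<le> 2 * poly p r" by simp
  then show ?thesis using M by (simp add: field_simps)
qed

lemma ev_pderiv: "ev (pderiv F) t r = poly (pderiv (map_poly (\<lambda>a. poly a t) F)) r"
proof -
  interpret t: unital_hom "\<lambda>p :: real poly. poly p t" by standard auto
  show ?thesis by (simp add: ev_conv_map_poly t.pderiv_map_poly)
qed

section \<open>Polynomial growth in both variables\<close>

definition grow :: "real \<Rightarrow> real \<Rightarrow> real" where "grow t r = (1 + t\<^sup>2) * (1 + r\<^sup>2)"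

lemma grow_ge_1: "grow t r \<ge> 1"
  by (simp add: grow_def distrib_left)

lemma ev_grow_bound: "\<exists>C\<ge>1. \<exists>N. \<forall>t r. \<bar>ev F t r\<bar> \<le> C * grow t r ^ N"
proof -
  obtain n where n: "tdeg_le F n" using tdeg_le_exists by blast
  define N where "N = max n (degree F)"
  have "tdeg_le F (2 * N)" using n by (rule tdeg_le_mono) (simp add: N_def)
  moreover have "degree F \<le> 2 * N" by (simp add: N_def)
  ultimately obtain C where C: "C \<ge> 0" "\<And>t r. \<bar>ev F t r\<bar> \<le> C * (1 + t\<^sup>2) ^ N * (1 + r\<^sup>2) ^ N"
    using ev_abs_bound by blast
  have "\<bar>ev F t r\<bar> \<le> (C + 1) * grow t r ^ N" for t r
  proof -
    have "grow t r ^ N \<ge> 0" using grow_ge_1[of t r] by simp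
    moreover have "C * (1 + t\<^sup>2) ^ N * (1 + r\<^sup>2) ^ N = C * grow t r ^ N"
      by (simp add: grow_def power_mult_distrib)
    moreover have "(C + 1) * grow t r ^ N = C * grow t r ^ N + grow t r ^ N"
      by (simp add: distrib_right)
    ultimately show ?thesis using C(2)[of t r] by linarith
  qed
  then show ?thesis using C(1) by (intro exI[of _ "C + 1"]) auto
qed

lemma common_grow_bound:
  assumes "finite \<F>"
  shows "\<exists>C\<ge>1. \<exists>N. \<forall>F\<in>\<F>. \<forall>t r. \<bar>ev F t r\<bar> \<le> C * grow t r ^ N"
  using assms
proof (induction \<F>)
  case empty
  show ?case by (intro exI[of _ 1]) auto
next
  case (insert G \<F>)
  obtain C N where C: "C \<ge> 1" "\<forall>F\<in>\<F>. \<forall>t r. \<bar>ev F t r\<bar> \<le> C * grow t r ^ N" using insert.IH by blast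
  obtain D M where D: "D \<ge> 1" "\<forall>t r. \<bar>ev G t r\<bar> \<le> D * grow t r ^ M" using ev_grow_bound by blast
  have up: "A * grow t r ^ i \<le> max C D * grow t r ^ max N M"
    if "A \<le> max C D" "0 \<le> A" "i \<le> max N M" for A i t r
    using that grow_ge_1[of t r] by (intro mult_mono power_increasing) auto
  have "\<bar>ev F t r\<bar> \<le> max C D * grow t r ^ max N M" if "F \<in> insert G \<F>" for F t r
  proof -
    have "\<bar>ev F t r\<bar> \<le> D * grow t r ^ M \<or> \<bar>ev F t r\<bar> \<le> C * grow t r ^ N" using that C D by auto
    then show ?thesis using up[of C N t r] up[of D M t r] C(1) D(1) by auto
  qed
  then show ?case using C(1) by (intro exI[of _ "max C D"]) auto
qed

text \<open>Where \<open>F\<close> is small its derivative is small as well, because the square of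
  the derivative is bounded by \<open>F\<close> times a power of \<open>grow\<close>. The Bezout
  relation passes this smallness on to \<open>\<delta>\<close>.\<close>

lemma bezout_lower_bound:
  assumes psd: "psd2 F" and bez: "u * F + v * pderiv F = [:\<delta>:]"
  shows "\<exists>K>0. \<exists>J. \<forall>t r. (poly \<delta> t)\<^sup>2 \<le> K * grow t r ^ J * ev F t r"
proof -
  have "finite {u, v, F, pderiv F, pderiv (pderiv F)}" by simp
  from common_grow_bound[OF this] obtain C N where C: "C \<ge> 1" and bd0: "\<And>G t r.
     G \<in> {u, v, F, pderiv F, pderiv (pderiv F)} \<Longrightarrow> \<bar>ev G t r\<bar> \<le> C * grow t r ^ N"
    by blast
  have "(poly \<delta> t)\<^sup>2 \<le> (2 * C ^ 3 + 4 * 3 ^ N * C ^ 3) * grow t r ^ (3 * N) * ev F t r" for t r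
  proof -
    define g where "g = grow t r ^ N"
    define f where "f = ev F t r"
    have g1: "g \<ge> 1" unfolding g_def using grow_ge_1 by (rule one_le_power)
    have f0: "f \<ge> 0" using psd by (simp add: f_def psd2_def)
    have bd: "\<bar>ev u t r\<bar> \<le> C * g" "\<bar>ev v t r\<bar> \<le> C * g" "\<bar>f\<bar> \<le> C * g" "\<bar>ev (pderiv F) t r\<bar> \<le> C * g"
      unfolding g_def f_def by (intro bd0; simp)+
    \<comment> \<open>The factor \<open>3 ^ N\<close> makes room for moving \<open>r\<close> by at
      most 1, which changes \<open>grow\<close> by a factor of at most 3.\<close>
    define M where "M = 3 ^ N * (C * g)"
    have Cg: "C * g \<ge> 1" using mult_mono[of 1 C 1 g] C g1 by simp
    have MC: "C * g \<le> M"
    proof -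
      have "1 * (C * g) \<le> 3 ^ N * (C * g)" using Cg by (intro mult_right_mono) auto
      then show ?thesis by (simp add: M_def)
    qed
    have "(ev (pderiv F) t r)\<^sup>2 \<le> 2 * M * f"
      unfolding f_def ev_pderiv unfolding ev_conv_map_poly[of F]
    proof (rule deriv_square_le)
      show "poly (map_poly (\<lambda>a. poly a t) F) x \<ge> 0" for x
        using psd by (simp add: psd2_def ev_conv_map_poly)
      show "M > 0" using MC Cg by linarith
      show "\<bar>poly (pderiv (map_poly (\<lambda>a. poly a t) F)) r\<bar> \<le> M"
        using bd(4) MC by (simp add: ev_pderiv)
      fix x assume x: "\<bar>x - r\<bar> \<le> 1"
      have "x\<^sup>2 \<le> (\<bar>r\<bar> + 1)\<^sup>2" using x by (intro abs_le_square_iff[THEN iffD1]) auto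
      also have "\<dots> \<le> 2 * r\<^sup>2 + 2"
        using sum_squares_bound[of "\<bar>r\<bar>" 1] by (simp add: power2_eq_square algebra_simps)
      also have "\<dots> \<le> 3 * r\<^sup>2 + 2" by simp
      finally have "1 + x\<^sup>2 \<le> 3 * (1 + r\<^sup>2)" by simp
      then have "grow t x \<le> 3 * grow t r" unfolding grow_def
        using mult_left_mono[of "1 + x\<^sup>2" "3 * (1 + r\<^sup>2)" "1 + t\<^sup>2"] by (simp add: algebra_simps)
      then have "grow t x ^ N \<le> 3 ^ N * g" unfolding g_def power_mult_distrib[symmetric]
        using grow_ge_1[of t x] by (intro power_mono) auto
      then have "C * grow t x ^ N \<le> M" using C mult_left_mono[of "grow t x ^ N" "3 ^ N * g" C] by (simp add: M_def mult_ac)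
      moreover have "poly (pderiv (pderiv (map_poly (\<lambda>a. poly a t) F))) x = ev (pderiv (pderiv F)) t x"
      proof -
        interpret t: unital_hom "\<lambda>p :: real poly. poly p t" by standard auto
        show ?thesis by (simp add: ev_conv_map_poly t.pderiv_map_poly)
      qed
      ultimately show "poly (pderiv (pderiv (map_poly (\<lambda>a. poly a t) F))) x \<le> M"
        using bd0[of "pderiv (pderiv F)" t x] by simp
    qed
    moreover have "poly \<delta> t = ev u t r * f + ev v t r * ev (pderiv F) t r"
      using arg_cong[OF bez, of "\<lambda>G. ev G t r"] by (simp add: ev.add ev.mult f_def)
    then have "(poly \<delta> t)\<^sup>2 \<le> 2 * (ev u t r * f)\<^sup>2 + 2 * (ev v t r * ev (pderiv F) t r)\<^sup>2"
      using sum_squares_bound[of "ev u t r * f" "ev v t r * ev (pderiv F) t r"] by (simp add: power2_sum)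
    moreover have "(ev u t r * f)\<^sup>2 \<le> (C * g)\<^sup>2 * (C * g * f)"
    proof -
      have "(ev u t r)\<^sup>2 \<le> (C * g)\<^sup>2" using bd(1) Cg by (intro abs_le_square_iff[THEN iffD1]) simp
      moreover have "f\<^sup>2 \<le> C * g * f" using bd(3) f0 by (simp add: power2_eq_square mult_right_mono)
      ultimately show ?thesis unfolding power_mult_distrib[of "ev u t r"] by (intro mult_mono) auto
    qed
    moreover have "(ev v t r * ev (pderiv F) t r)\<^sup>2 \<le> (C * g)\<^sup>2 * (2 * M * f)"
    proof -
      have "(ev v t r)\<^sup>2 \<le> (C * g)\<^sup>2" using bd(2) Cg by (intro abs_le_square_iff[THEN iffD1]) simp
      then show ?thesis unfolding power_mult_distrib[of "ev v t r"]
        using calculation(1) by (intro mult_mono) auto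
    qed
    ultimately have "(poly \<delta> t)\<^sup>2 \<le> 2 * ((C * g)\<^sup>2 * (C * g * f)) + 2 * ((C * g)\<^sup>2 * (2 * M * f))" by linarith
    also have "\<dots> = (2 * C ^ 3 + 4 * 3 ^ N * C ^ 3) * g ^ 3 * f"
      by (simp add: M_def power2_eq_square power3_eq_cube algebra_simps)
    also have "g ^ 3 = grow t r ^ (3 * N)" by (simp add: g_def mult.commute flip: power_mult)
    finally show ?thesis by (simp add: f_def)
  qed
  moreover have "2 * C ^ 3 + 4 * 3 ^ N * C ^ 3 > 0" using C by (intro add_pos_pos) auto
  ultimately show ?thesis by blast
qed

text \<open>Losses are tolerated in \<open>t\<close> only, through \<open>\<eta>\<close> and a power
  of \<open>1 + t^2\<close>; in \<open>r\<close> the full growth is demanded, as no denominators in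
  \<open>r\<close> are available.\<close>

definition lower_bounded :: "real poly poly \<Rightarrow> nat \<Rightarrow> bool"
  where "lower_bounded F d \<longleftrightarrow> (\<exists>\<eta> L. \<eta> \<noteq> 0 \<and>
    (\<forall>t r. (poly \<eta> t)\<^sup>2 * (1 + r\<^sup>2) ^ d \<le> (1 + t\<^sup>2) ^ L * ev F t r))"

lemma lower_boundedI:
  assumes "\<eta> \<noteq> 0" "K > 0" "\<And>t r. (poly \<eta> t)\<^sup>2 * (1 + r\<^sup>2) ^ d \<le> K * (1 + t\<^sup>2) ^ L * ev F t r"
  shows "lower_bounded F d"
  unfolding lower_bounded_def
proof (intro exI conjI allI)
  show "smult (1 / sqrt K) \<eta> \<noteq> 0" using assms by simp
  show "(poly (smult (1 / sqrt K) \<eta>) t)\<^sup>2 * (1 + r\<^sup>2) ^ d \<le> (1 + t\<^sup>2) ^ L * ev F t r" for t r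
    using assms(2) assms(3)[of t r] by (simp add: power_divide field_simps)
qed

text \<open>For large \<open>r\<close> the leading coefficient of \<open>F\<close> dominates, elsewhere the Bezout relation bounds \<open>F\<close>.\<close>

lemma lower_bounded_bezout:
  assumes psd: "psd2 F" and deg: "degree F = 2 * d" "d > 0"
    and bez: "u * F + v * pderiv F = [:\<delta>:]" "\<delta> \<noteq> 0"
  shows "lower_bounded F d"
proof -
  have F0: "F \<noteq> 0" using deg by auto
  obtain K J where KJ: "K > 0" "\<And>t r. (poly \<delta> t)\<^sup>2 \<le> K * grow t r ^ J * ev F t r"
    using bezout_lower_bound[OF psd bez(1)] by blast
  obtain n where "tdeg_le F n" using tdeg_le_exists by blast
  then have tF: "tdeg_le F (2 * n)" by (rule tdeg_le_mono) simp
  have "\<forall>i. \<exists>C\<ge>0. \<forall>t. \<bar>poly (coeff F i) t\<bar> \<le> C * (1 + t\<^sup>2) ^ n"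
    using tF poly_abs_bound by (auto simp: tdeg_le_def)
  then obtain C0 where C0: "\<And>i. C0 i \<ge> 0" "\<And>i t. \<bar>poly (coeff F i) t\<bar> \<le> C0 i * (1 + t\<^sup>2) ^ n" by metis
  define C where "C = 1 + (\<Sum>i\<le>2 * d. C0 i)"
  have C1: "C \<ge> 1" using C0(1) by (simp add: C_def sum_nonneg)
  have cF: "\<bar>poly (coeff F i) t\<bar> \<le> C * (1 + t\<^sup>2) ^ n" if "i \<le> 2 * d" for i t
  proof -
    have "C0 i \<le> (\<Sum>i\<le>2 * d. C0 i)" using that C0(1) by (intro member_le_sum) auto
    then have "C0 i \<le> C" by (simp add: C_def)
    then show ?thesis using C0(2)[of i t] by (meson mult_right_mono order.trans zero_le_power add_nonneg_nonneg zero_le_one zero_le_power2)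
  qed
  obtain D where D: "D \<ge> 0" "\<And>t. \<bar>poly (\<delta>\<^sup>2) t\<bar> \<le> D * (1 + t\<^sup>2) ^ degree \<delta>"
    using poly_abs_bound[of "\<delta>\<^sup>2" "degree \<delta>"] degree_power_le[of \<delta> 2] by (auto simp: mult.commute)
  define a where "a = lead_coeff F"
  have a0: "a \<noteq> 0" using F0 by (simp add: a_def)
  have apos: "poly a t \<ge> 0" for t unfolding a_def by (rule psd2_lead(2)[OF psd F0])
  \<comment> \<open>In the region where \<open>a * \<bar>r\<bar>\<close> is bounded, the Bezout
    estimate loses \<open>(1 + r^2)^J\<close> and still has to supply \<open>(1 + r^2)^d\<close>; a
    factor \<open>a^(2 * e)\<close> pays for both.\<close>
  define e where "e = J + d"
  have e0: "e > 0" using deg by (simp add: e_def)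
  \<comment> \<open>Chosen so that, once \<open>a * \<bar>r\<bar>\<close> exceeds
    \<open>q * (1 + t^2)^n\<close>, the \<open>2 * d\<close> lower terms together are at most half
    of the leading one.\<close>
  define q where "q = 4 * real d * C"
  have q1: "q \<ge> 1"
    using mult_mono[of 1 "4 * real d" 1 C] deg(2) C1 by (simp add: q_def)
  define L where "L = degree \<delta> + J + 2 * n * e"
  have aq: "poly a t \<le> C * (1 + t\<^sup>2) ^ n" "C * (1 + t\<^sup>2) ^ n \<le> q * (1 + t\<^sup>2) ^ n" for t
  proof -
    show "poly a t \<le> C * (1 + t\<^sup>2) ^ n" using cF[of "2 * d" t] deg by (simp add: a_def)
    have "1 * C \<le> 4 * real d * C" using C1 deg(2) by (intro mult_right_mono) auto
    then show "C * (1 + t\<^sup>2) ^ n \<le> q * (1 + t\<^sup>2) ^ n" by (intro mult_right_mono) (simp_all add: q_def)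
  qed
  have large: "poly a t * (1 + r\<^sup>2) ^ d \<le> 2 ^ (d + 1) * ev F t r"
    if r: "\<bar>r\<bar> \<ge> 1" "poly a t * \<bar>r\<bar> \<ge> q * (1 + t\<^sup>2) ^ n" for t r
  proof -
    have "\<bar>\<Sum>i<2 * d. poly (coeff F i) t * r ^ i\<bar> \<le> (\<Sum>i<2 * d. C * (1 + t\<^sup>2) ^ n * \<bar>r\<bar> ^ (2 * d - 1))"
    proof (intro order.trans[OF sum_abs] sum_mono)
      fix i assume i: "i \<in> {..<2 * d}"
      show "\<bar>poly (coeff F i) t * r ^ i\<bar> \<le> C * (1 + t\<^sup>2) ^ n * \<bar>r\<bar> ^ (2 * d - 1)"
        unfolding abs_mult power_abs using i r C1
        by (intro mult_mono cF power_increasing mult_nonneg_nonneg) auto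
    qed
    also have "\<dots> = (q * (1 + t\<^sup>2) ^ n) * \<bar>r\<bar> ^ (2 * d - 1) / 2" by (simp add: q_def)
    also have "\<dots> \<le> (poly a t * \<bar>r\<bar>) * \<bar>r\<bar> ^ (2 * d - 1) / 2"
      using r(2) by (intro divide_right_mono mult_right_mono) auto
    also have "(poly a t * \<bar>r\<bar>) * \<bar>r\<bar> ^ (2 * d - 1) = poly a t * \<bar>r\<bar> ^ (2 * d)"
      using deg(2) by (cases "2 * d") auto
    also have "\<bar>r\<bar> ^ (2 * d) = r ^ (2 * d)" by (simp add: power_even_abs)
    finally have "\<bar>\<Sum>i<2 * d. poly (coeff F i) t * r ^ i\<bar> \<le> poly a t * r ^ (2 * d) / 2" .
    moreover have "ev F t r = (\<Sum>i<2 * d. poly (coeff F i) t * r ^ i) + poly a t * r ^ (2 * d)"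
      using ev_conv_sum[of F "2 * d" t r] deg(1) by (simp add: a_def flip: lessThan_Suc_atMost)
    ultimately have "ev F t r \<ge> poly a t * r ^ (2 * d) / 2" by linarith
    moreover have "(1 + r\<^sup>2) ^ d \<le> 2 ^ d * r ^ (2 * d)"
    proof -
      have "1 + r\<^sup>2 \<le> 2 * r\<^sup>2" using r(1) by (simp add: abs_le_square_iff[of 1 r, simplified])
      then have "(1 + r\<^sup>2) ^ d \<le> (2 * r\<^sup>2) ^ d" by (intro power_mono) auto
      then show ?thesis by (simp add: power_mult_distrib power_mult)
    qed
    then have "poly a t * (1 + r\<^sup>2) ^ d \<le> poly a t * (2 ^ d * r ^ (2 * d))"
      using apos by (intro mult_left_mono)
    moreover have "poly a t * (2 ^ d * r ^ (2 * d)) = 2 ^ (d + 1) * (poly a t * r ^ (2 * d) / 2)" by simp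
    moreover have "2 ^ (d + 1) * (poly a t * r ^ (2 * d) / 2) \<le> 2 ^ (d + 1) * ev F t r"
      using calculation(1) by (intro mult_left_mono) auto
    ultimately show ?thesis by linarith
  qed
  define K1 where "K1 = D * C ^ (2 * e - 1) * 2 ^ (d + 1)"
  define K2 where "K2 = K * (2 * q\<^sup>2) ^ e"
  have bound: "(poly (\<delta> * a ^ e) t)\<^sup>2 * (1 + r\<^sup>2) ^ d \<le> (K1 + K2) * (1 + t\<^sup>2) ^ L * ev F t r" for t r
  proof -
    define T where "T = 1 + t\<^sup>2"
    define R where "R = 1 + r\<^sup>2"
    define f where "f = ev F t r"
    define A where "A = poly a t"
    have T1: "T \<ge> 1" and R1: "R \<ge> 1" by (simp_all add: T_def R_def)
    have f0: "f \<ge> 0" using psd by (simp add: f_def psd2_def)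
    have A0: "A \<ge> 0" using apos by (simp add: A_def)
    have Tpow: "T ^ i \<ge> 0" "i \<le> j \<Longrightarrow> T ^ i \<le> T ^ j" for i j
      using T1 by (auto intro: power_increasing)
    have sq: "(poly (\<delta> * a ^ e) t)\<^sup>2 = (poly \<delta> t)\<^sup>2 * (A\<^sup>2) ^ e"
      by (simp add: power_mult_distrib A_def poly_power mult.commute flip: power_mult)
    have K12: "K1 \<ge> 0" "K2 \<ge> 0" using D C1 KJ by (simp_all add: K1_def K2_def)
    have "(poly \<delta> t)\<^sup>2 * (A\<^sup>2) ^ e * R ^ d \<le> K1 * T ^ L * f \<or> (poly \<delta> t)\<^sup>2 * (A\<^sup>2) ^ e * R ^ d \<le> K2 * T ^ L * f"
    proof (cases "\<bar>r\<bar> \<ge> 1 \<and> A * \<bar>r\<bar> \<ge> q * T ^ n")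
      case True
      then have lr: "A * R ^ d \<le> 2 ^ (d + 1) * f"
        using large[of r t] by (simp add: A_def R_def T_def f_def)
      have "(A\<^sup>2) ^ e = A ^ (2 * e - 1) * A"
        using e0 by (simp flip: power_mult power_Suc2)
      then have "(poly \<delta> t)\<^sup>2 * (A\<^sup>2) ^ e * R ^ d = (poly \<delta> t)\<^sup>2 * A ^ (2 * e - 1) * (A * R ^ d)" by simp
      also have "\<dots> \<le> (D * T ^ degree \<delta>) * (C * T ^ n) ^ (2 * e - 1) * (2 ^ (d + 1) * f)"
      proof -
        have "(poly \<delta> t)\<^sup>2 * A ^ (2 * e - 1) \<le> (D * T ^ degree \<delta>) * (C * T ^ n) ^ (2 * e - 1)"
          using D(2)[of t] aq(1)[of t] A0 D(1) T1 unfolding A_def[symmetric] T_def[symmetric]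
          by (intro mult_mono power_mono) (auto simp: poly_power)
        from mult_mono[OF this lr] show ?thesis using A0 R1 D(1) T1 C1 by simp
      qed
      also have "\<dots> = K1 * T ^ (degree \<delta> + n * (2 * e - 1)) * f"
        by (simp add: K1_def power_mult_distrib power_add power_mult mult_ac)
      also have "\<dots> \<le> K1 * T ^ L * f"
        using f0 K12 by (intro mult_right_mono mult_left_mono Tpow) (auto simp: L_def diff_mult_distrib2)
      finally show ?thesis by blast
    next
      case False
      have Ar: "A * \<bar>r\<bar> \<le> q * T ^ n"
      proof (cases "\<bar>r\<bar> \<ge> 1")
        case True
        with False show ?thesis by simp
      next
        case r: False
        then have "A * \<bar>r\<bar> \<le> A * 1" using A0 by (intro mult_left_mono) auto
        then show ?thesis using aq[of t] unfolding A_def T_def by linarith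
      qed
      have "A\<^sup>2 * R \<le> 2 * q\<^sup>2 * T ^ (2 * n)"
      proof -
        have "A \<le> q * T ^ n" using aq[of t] unfolding A_def T_def by linarith
        then have "A\<^sup>2 \<le> (q * T ^ n)\<^sup>2" using A0 by (intro power_mono)
        moreover have "(A * \<bar>r\<bar>)\<^sup>2 \<le> (q * T ^ n)\<^sup>2" using Ar A0 by (intro power_mono) auto
        moreover have "A\<^sup>2 * R = A\<^sup>2 + (A * \<bar>r\<bar>)\<^sup>2" by (simp add: R_def power_mult_distrib distrib_left)
        moreover have "(q * T ^ n)\<^sup>2 = q\<^sup>2 * T ^ (2 * n)" by (simp add: power_mult_distrib mult.commute flip: power_mult)
        ultimately show ?thesis by simp
      qed
      then have AR: "(A\<^sup>2 * R) ^ e \<le> (2 * q\<^sup>2) ^ e * T ^ (2 * n * e)"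
        using R1 power_mono[of "A\<^sup>2 * R" "2 * q\<^sup>2 * T ^ (2 * n)" e] by (simp add: power_mult_distrib power_mult)
      have "(poly \<delta> t)\<^sup>2 * (A\<^sup>2) ^ e * R ^ d \<le> (K * (T * R) ^ J * f) * (A\<^sup>2) ^ e * R ^ d"
        using KJ(2)[of t r] R1 unfolding grow_def T_def[symmetric] R_def[symmetric] f_def[symmetric]
        by (intro mult_right_mono) auto
      also have "\<dots> = K * T ^ J * f * (A\<^sup>2 * R) ^ e"
        by (simp add: e_def power_mult_distrib power_add mult_ac)
      also have "\<dots> \<le> K * T ^ J * f * ((2 * q\<^sup>2) ^ e * T ^ (2 * n * e))"
        using AR KJ(1) f0 Tpow by (intro mult_left_mono) auto
      also have "\<dots> = K2 * T ^ (J + 2 * n * e) * f" by (simp add: K2_def power_add mult_ac)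
      also have "\<dots> \<le> K2 * T ^ L * f"
        using f0 K12 by (intro mult_right_mono mult_left_mono Tpow) (auto simp: L_def)
      finally show ?thesis by blast
    qed
    moreover have "K1 * T ^ L * f \<le> (K1 + K2) * T ^ L * f" "K2 * T ^ L * f \<le> (K1 + K2) * T ^ L * f"
      using f0 K12 Tpow by (auto intro!: mult_right_mono)
    ultimately show ?thesis unfolding sq T_def[symmetric] R_def[symmetric] f_def[symmetric] by linarith
  qed
  show ?thesis
  proof (rule lower_boundedI)
    show "\<delta> * a ^ e \<noteq> 0" using a0 bez(2) by simp
    show "K1 + K2 > 0"
    proof -
      have "K2 > 0" using KJ(1) q1 by (simp add: K2_def)
      moreover have "K1 \<ge> 0" using D C1 by (simp add: K1_def)
      ultimately show ?thesis by simp
    qed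
  qed (rule bound)
qed

subsection \<open>Nonnegative polynomials on the cylinder\<close>

lemma real_root_factorization:
  fixes p :: "real poly"
  assumes "p \<noteq> 0"
  shows "\<exists>T k E. finite T \<and> T \<subseteq> {x. poly p x = 0} \<and> p = (\<Prod>t\<in>T. [:- t, 1:] ^ k t) * E \<and> (\<forall>t. poly E t \<noteq> 0)"
  using assms
proof (induction "degree p" arbitrary: p rule: less_induct)
  case less
  show ?case
  proof (cases "\<exists>a. poly p a = 0")
    case False
    then show ?thesis by (intro exI[of _ "{}"] exI[of _ p]) auto
  next
    case True
    then obtain a where a: "poly p a = 0" by blast
    obtain p' where p': "p = [:- a, 1:] ^ order a p * p'" "\<not> [:- a, 1:] dvd p'"
      using order_decomp[OF less.prems] by blast
    have "p' \<noteq> 0" using p'(2) by auto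
    have "order a p > 0" using a less.prems by (simp add: order_root)
    moreover have "degree p = order a p + degree p'"
      using arg_cong[OF p'(1), of degree] \<open>p' \<noteq> 0\<close> by (simp add: degree_mult_eq degree_linear_power)
    ultimately have "degree p' < degree p" by simp
    from less.hyps[OF this \<open>p' \<noteq> 0\<close>] obtain T k E where T: "finite T" "T \<subseteq> {x. poly p' x = 0}"
      "p' = (\<Prod>t\<in>T. [:- t, 1:] ^ k t) * E" "\<forall>t. poly E t \<noteq> 0" by blast
    have aT: "a \<notin> T" using T(2) p'(2) by (auto simp: poly_eq_0_iff_dvd)
    define k' where "k' = k(a := order a p)"
    have "(\<Prod>t\<in>insert a T. [:- t, 1:] ^ k' t) = [:- a, 1:] ^ order a p * (\<Prod>t\<in>T. [:- t, 1:] ^ k t)"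
    proof -
      have "(\<Prod>t\<in>T. [:- t, 1:] ^ k' t) = (\<Prod>t\<in>T. [:- t, 1:] ^ k t)"
        using aT by (intro prod.cong) (auto simp: k'_def)
      then show ?thesis using T(1) aT by (simp add: k'_def)
    qed
    then have "p = (\<Prod>t\<in>insert a T. [:- t, 1:] ^ k' t) * E"
    proof -
      have "(\<Prod>t\<in>insert a T. [:- t, 1:] ^ k' t) * E = [:- a, 1:] ^ order a p * p'"
        by (simp only: \<open>(\<Prod>t\<in>insert a T. [:- t, 1:] ^ k' t) = _\<close> mult.assoc T(3)[symmetric])
      then show ?thesis using p'(1) by simp
    qed
    moreover have "insert a T \<subseteq> {x. poly p x = 0}"
    proof
      fix x assume "x \<in> insert a T"
      then have "x = a \<or> poly p' x = 0" using T(2) by auto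
      moreover have "poly p x = poly ([:- a, 1:] ^ order a p) x * poly p' x"
        using arg_cong[OF p'(1), of "\<lambda>p. poly p x"] unfolding poly_mult .
      ultimately show "x \<in> {x. poly p x = 0}" using a by fastforce
    qed
    ultimately show ?thesis using T(1,4) by blast
  qed
qed

section \<open>Behaviour at \<open>t = \<infinity>\<close>\<close>

lemma coeff_mult_top:
  fixes p q :: "'a :: comm_semiring_0 poly"
  assumes "degree p \<le> a" "degree q \<le> b"
  shows "coeff (p * q) (a + b) = coeff p a * coeff q b"
proof -
  have "coeff (p * q) (a + b) = (\<Sum>i\<le>a + b. if i = a then coeff p a * coeff q b else 0)"
    unfolding coeff_mult
  proof (intro sum.cong refl)
    fix i assume "i \<in> {..a + b}"
    then show "coeff p i * coeff q (a + b - i) = (if i = a then coeff p a * coeff q b else 0)"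
      using assms by (cases "i < a"; cases "i = a") (auto simp: coeff_eq_0)
  qed
  then show ?thesis by simp
qed

lemma coeff_power_top:
  fixes p :: "'a :: comm_semiring_1 poly"
  assumes "degree p \<le> a"
  shows "coeff (p ^ n) (a * n) = coeff p a ^ n"
proof (induction n)
  case (Suc n)
  have "degree (p ^ n) \<le> a * n"
    using degree_power_le[of p n] assms by (meson mult_le_mono1 order.trans)
  from coeff_mult_top[OF assms this] Suc show ?case by simp
qed simp

text \<open>Subtracting the top part as a multiple of \<open>qt ^ n\<close> lowers the degree in
  \<open>t\<close> below \<open>2 * n\<close>. The remainder times \<open>t\<close> is then still
  bounded by a multiple of \<open>(1 + t^2)^n\<close>, so the remainder itself is smaller by a
  factor \<open>1 / \<bar>t\<bar>\<close>.\<close>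

lemma lead_form_dominates:
  assumes tF: "tdeg_le F (2 * n)" and dF: "degree F \<le> 2 * d" and c0: "c0 > 0"
    and lead: "\<And>r. c0 * (1 + r\<^sup>2) ^ d \<le> (\<Sum>i\<le>2 * d. coeff (coeff F i) (2 * n) * r ^ i)"
  shows "\<exists>T0>0. \<forall>t r. \<bar>t\<bar> \<ge> T0 \<longrightarrow> ev F t r \<ge> c0 / 2 * (1 + t\<^sup>2) ^ n * (1 + r\<^sup>2) ^ d"
proof -
  define l where "l i = coeff (coeff F i) (2 * n)" for i
  define p where "p i = coeff F i - smult (l i) (qt ^ n)" for i
  have "\<exists>C\<ge>0. \<forall>t. \<bar>poly (pCons 0 (p i)) t\<bar> \<le> C * (1 + t\<^sup>2) ^ n" for i
  proof (rule poly_abs_bound)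
    have "coeff (p i) j = 0" if "j \<ge> 2 * n" for j
    proof (cases "j = 2 * n")
      case True
      then show ?thesis using coeff_power_top[of qt 2 n] by (simp add: p_def l_def numeral_2_eq_2)
    next
      case False
      then have j: "j > 2 * n" using that by simp
      moreover have "degree (coeff F i) \<le> 2 * n" using tF by (simp add: tdeg_le_def)
      ultimately show ?thesis by (simp add: p_def coeff_eq_0 degree_qt_power)
    qed
    then show "degree (pCons 0 (p i)) \<le> 2 * n"
      by (intro degree_le) (auto simp: coeff_pCons split: nat.splits)
  qed
  then obtain C where C: "\<And>i. C i \<ge> 0" "\<And>i t. \<bar>poly (pCons 0 (p i)) t\<bar> \<le> C i * (1 + t\<^sup>2) ^ n" by metis
  define B where "B = (\<Sum>i\<le>2 * d. C i)"
  have B0: "B \<ge> 0" by (simp add: B_def sum_nonneg C)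
  show ?thesis
  proof (intro exI conjI allI impI)
    show "2 * B / c0 + 1 > 0" using B0 c0 by (intro add_nonneg_pos) auto
    fix t r :: real assume t: "\<bar>t\<bar> \<ge> 2 * B / c0 + 1"
    define Q where "Q = (1 + t\<^sup>2) ^ n"
    define R where "R = (1 + r\<^sup>2) ^ d"
    have Q: "Q \<ge> 0" and R: "R \<ge> 0" by (simp_all add: Q_def R_def)
    have t0: "\<bar>t\<bar> > 0" and tB: "2 * B \<le> c0 * \<bar>t\<bar>"
    proof -
      have "2 * B / c0 \<ge> 0" using B0 c0 by simp
      then show "\<bar>t\<bar> > 0" using t by linarith
      have "2 * B / c0 \<le> \<bar>t\<bar>" using t by linarith
      then show "2 * B \<le> c0 * \<bar>t\<bar>" using c0 by (simp add: field_simps)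
    qed
    have "ev F t r = (\<Sum>i\<le>2 * d. (poly (p i) t + l i * Q) * r ^ i)"
      unfolding ev_conv_sum[OF dF] by (intro sum.cong refl) (simp add: p_def Q_def poly_power power2_eq_square)
    also have "\<dots> = (\<Sum>i\<le>2 * d. poly (p i) t * r ^ i) + Q * (\<Sum>i\<le>2 * d. l i * r ^ i)"
      by (simp add: algebra_simps sum.distrib sum_distrib_left)
    finally have ev: "ev F t r = (\<Sum>i\<le>2 * d. poly (p i) t * r ^ i) + Q * (\<Sum>i\<le>2 * d. l i * r ^ i)" .
    have "\<bar>t\<bar> * \<bar>\<Sum>i\<le>2 * d. poly (p i) t * r ^ i\<bar> \<le> \<bar>t\<bar> * (\<Sum>i\<le>2 * d. \<bar>poly (p i) t * r ^ i\<bar>)"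
      by (intro mult_left_mono sum_abs) simp
    also have "\<dots> = (\<Sum>i\<le>2 * d. \<bar>poly (pCons 0 (p i)) t\<bar> * \<bar>r\<bar> ^ i)"
      by (simp add: sum_distrib_left abs_mult power_abs mult.assoc)
    also have "\<dots> \<le> (\<Sum>i\<le>2 * d. C i * Q * R)"
      unfolding Q_def R_def using C by (intro sum_mono mult_mono abs_power_le) auto
    also have "\<dots> = B * (Q * R)" by (simp add: B_def sum_distrib_right mult.assoc)
    also have "\<dots> \<le> c0 * \<bar>t\<bar> / 2 * (Q * R)" using tB Q R by (intro mult_right_mono) auto
    also have "\<dots> = \<bar>t\<bar> * (c0 / 2 * Q * R)" by simp
    finally have "\<bar>\<Sum>i\<le>2 * d. poly (p i) t * r ^ i\<bar> \<le> c0 / 2 * Q * R" using t0 by (simp only: mult_le_cancel_left_pos)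
    moreover have "Q * (c0 * R) \<le> Q * (\<Sum>i\<le>2 * d. l i * r ^ i)"
      using lead[of r] Q unfolding l_def R_def by (intro mult_left_mono)
    moreover have "Q * (c0 * R) = c0 / 2 * Q * R + c0 / 2 * Q * R" by simp
    ultimately have "c0 / 2 * Q * R \<le> ev F t r" unfolding ev by linarith
    then show "c0 / 2 * (1 + t\<^sup>2) ^ n * (1 + r\<^sup>2) ^ d \<le> ev F t r" by (simp add: Q_def R_def)
  qed
qed

text \<open>The lower bound needed for gluing comes from two regions. For large \<open>t\<close> the
  leading form supplies it; on the remaining compact interval \<open>\<eta>\<close> does, since its
  factor \<open>E\<close> without real zeros is bounded away from 0 there and only \<open>w\<close>
  is left.\<close>

lemma good_at_infinity_cyl_sos:
  assumes psd: "psd2 F" and tF: "tdeg_le F (2 * n)" and dF: "degree F \<le> 2 * d"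
    and lb: "lower_bounded F d" and c0: "c0 > 0"
    and lead: "\<And>r. c0 * (1 + r\<^sup>2) ^ d \<le> (\<Sum>i\<le>2 * d. coeff (coeff F i) (2 * n) * r ^ i)"
  shows "cyl_sos F"
proof -
  obtain \<eta> L where \<eta>: "\<eta> \<noteq> 0" "\<And>t r. (poly \<eta> t)\<^sup>2 * (1 + r\<^sup>2) ^ d \<le> (1 + t\<^sup>2) ^ L * ev F t r"
    using lb by (auto simp: lower_bounded_def)
  obtain T k E where T: "finite T" "\<eta> = (\<Prod>t\<in>T. [:- t, 1:] ^ k t) * E" "\<forall>t. poly E t \<noteq> 0"
    using real_root_factorization[OF \<eta>(1)] by blast
  define w where "w = (\<Prod>t\<in>T. [:- t, 1:] ^ k t)"
  define e where "e = degree w"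
  obtain T0 where T0: "T0 > 0" "\<And>t r. \<bar>t\<bar> \<ge> T0 \<Longrightarrow> ev F t r \<ge> c0 / 2 * (1 + t\<^sup>2) ^ n * (1 + r\<^sup>2) ^ d"
    using lead_form_dominates[OF tF dF c0 lead] by blast
  obtain \<epsilon> where \<epsilon>: "\<epsilon> > 0" "\<And>t. \<bar>t\<bar> \<le> T0 \<Longrightarrow> \<epsilon> \<le> (poly E t)\<^sup>2"
  proof -
    have "\<exists>x\<in>{- T0..T0}. \<forall>y\<in>{- T0..T0}. (poly E x)\<^sup>2 \<le> (poly E y)\<^sup>2"
      using T0(1) by (intro continuous_attains_inf continuous_intros) auto
    then obtain x where "\<forall>y\<in>{- T0..T0}. (poly E x)\<^sup>2 \<le> (poly E y)\<^sup>2" by blast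
    then show thesis using T(3) by (intro that[of "(poly E x)\<^sup>2"]) (auto simp: abs_le_iff)
  qed
  obtain K where K: "K \<ge> 0" "\<And>t. (poly w t)\<^sup>2 \<le> K * (1 + t\<^sup>2) ^ e"
    using poly_abs_bound[of "w\<^sup>2" e] degree_power_le[of w 2] by (auto simp: e_def poly_power)
  \<comment> \<open>The factor \<open>qt ^ (4 * e)\<close> makes room in the degree in
    \<open>t\<close> for the local squares, whose roots are only known to have degree at most
    \<open>4 * e\<close>.\<close>
  define n' where "n' = n + 4 * e"
  define Q0 where "Q0 = (1 + T0\<^sup>2)"
  have Q0: "Q0 \<ge> 1" by (simp add: Q0_def)
  define c1 where "c1 = c0 / 2 / (K + 1)"
  define c2 where "c2 = \<epsilon> / Q0 ^ L / Q0 ^ n'"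
  define c where "c = min c1 c2 / 2"
  have c1: "c1 > 0" using c0 K(1) by (simp add: c1_def)
  have c2: "c2 > 0" using \<epsilon> Q0 by (simp add: c2_def)
  have "cyl_sos ([:qt ^ (4 * e):] * F)"
  proof (rule glue_cyl_sos[OF _ _ T(1) w_def e_def, of _ n' d c])
    show "tdeg_le ([:qt ^ (4 * e):] * F) (2 * n')"
      using tdeg_le_const_mult[OF _ tF, of "qt ^ (4 * e)" "8 * e"] degree_qt_power[of "4 * e"]
      by (simp add: n'_def add.commute)
    show "degree ([:qt ^ (4 * e):] * F) \<le> 2 * d" by (rule order.trans[OF degree_const_mult_le dF])
    show "4 * e \<le> n'" by (simp add: n'_def)
    show "c > 0" using c1 c2 by (simp add: c_def)
    fix t r :: real
    define q where "q = 1 + t\<^sup>2"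
    define R where "R = (1 + r\<^sup>2) ^ d"
    define W where "W = (poly w t)\<^sup>2"
    have q1: "q \<ge> 1" by (simp add: q_def)
    have R0: "R \<ge> 0" and W0: "W \<ge> 0" by (simp_all add: R_def W_def)
    have evq: "ev ([:qt ^ (4 * e):] * F) t r = q ^ (4 * e) * ev F t r"
      by (simp add: ev.mult poly_power q_def power2_eq_square)
    have F0: "ev F t r \<ge> 0" using psd by (simp add: psd2_def)
    have "min c1 c2 * (W * q ^ (n' - e) * R) \<le> q ^ (4 * e) * ev F t r"
    proof (cases "\<bar>t\<bar> \<ge> T0")
      case True
      have "c1 * (W * q ^ (n' - e) * R) \<le> c1 * (((K + 1) * q ^ e) * q ^ (n' - e) * R)"
      proof (intro mult_left_mono mult_right_mono)
        have "K * q ^ e \<le> (K + 1) * q ^ e" using q1 by (intro mult_right_mono) auto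
        then show "W \<le> (K + 1) * q ^ e" using K(2)[of t] unfolding W_def q_def by linarith
      qed (use q1 R0 c1 in auto)
      also have "\<dots> = (c1 * (K + 1)) * (q ^ e * q ^ (n' - e)) * R" by (simp only: mult_ac)
      also have "c1 * (K + 1) = c0 / 2" 
      proof -
        have "K + 1 \<noteq> 0" using K(1) by linarith
        then show ?thesis unfolding c1_def by (rule nonzero_eq_divide_eq[THEN iffD1]) (rule refl)
      qed
      also have "q ^ e * q ^ (n' - e) = q ^ (4 * e) * q ^ n" by (simp add: n'_def flip: power_add)
      also have "c0 / 2 * (q ^ (4 * e) * q ^ n) * R = q ^ (4 * e) * (c0 / 2 * q ^ n * R)" by simp
      also have "\<dots> \<le> q ^ (4 * e) * ev F t r"
        using T0(2)[OF True, of r] q1 unfolding q_def R_def by (intro mult_left_mono) auto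
      finally have "c1 * (W * q ^ (n' - e) * R) \<le> q ^ (4 * e) * ev F t r" .
      moreover have "min c1 c2 * (W * q ^ (n' - e) * R) \<le> c1 * (W * q ^ (n' - e) * R)"
        using W0 q1 R0 by (intro mult_right_mono) auto
      ultimately show ?thesis by linarith
    next
      case False
      have qQ: "q \<le> Q0" unfolding q_def Q0_def using False by (simp add: abs_le_square_iff[symmetric])
      have qL: "q ^ L > 0" using q1 by simp
      have "\<epsilon> * W * R \<le> (poly E t)\<^sup>2 * W * R"
        using \<epsilon>(2)[of t] False W0 R0 by (intro mult_right_mono) auto
      also have "\<dots> = (poly \<eta> t)\<^sup>2 * R" by (simp add: T(2) w_def[symmetric] W_def power_mult_distrib)
      also have "\<dots> \<le> q ^ L * ev F t r" using \<eta>(2)[of t r] by (simp add: R_def q_def)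
      also have "\<dots> \<le> Q0 ^ L * ev F t r"
        using qQ q1 F0 by (intro mult_right_mono power_mono) auto
      finally have 1: "\<epsilon> * W * R / Q0 ^ L \<le> ev F t r" using Q0 by (simp add: field_simps)
      have "q ^ (n' - e) \<le> Q0 ^ n'"
        using power_mono[OF qQ, of "n' - e"] q1 power_increasing[of "n' - e" n' Q0] Q0 by linarith
      then have "c2 * (W * q ^ (n' - e) * R) \<le> c2 * (W * Q0 ^ n' * R)"
        using W0 R0 c2 by (intro mult_left_mono mult_right_mono) auto
      also have "\<dots> = \<epsilon> * W * R / Q0 ^ L" using Q0 by (simp add: c2_def)
      also have "\<dots> \<le> 1 * ev F t r" using 1 by simp
      also have "\<dots> \<le> q ^ (4 * e) * ev F t r" using q1 F0 by (intro mult_right_mono) auto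
      finally have "c2 * (W * q ^ (n' - e) * R) \<le> q ^ (4 * e) * ev F t r" .
      moreover have "min c1 c2 * (W * q ^ (n' - e) * R) \<le> c2 * (W * q ^ (n' - e) * R)"
        using W0 q1 R0 by (intro mult_right_mono) auto
      ultimately show ?thesis by linarith
    qed
    then show "2 * c * (poly w t)\<^sup>2 * (1 + t\<^sup>2) ^ (n' - e) * (1 + r\<^sup>2) ^ d \<le> ev ([:qt ^ (4 * e):] * F) t r"
      unfolding evq by (simp add: c_def q_def R_def W_def mult.assoc)
  qed
  then show ?thesis by (rule cyl_sos_cancel_qt)
qed

text \<open>For fixed \<open>r\<close>, a summand \<open>p\<close> of too large degree would make
  \<open>q - p^2\<close> a nonnegative polynomial with negative leading coefficient. Letting
  \<open>r\<close> vary turns the bound for values into one for coefficients.\<close>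

lemma tdeg_le_sum_squares:
  assumes "tdeg_le (\<Sum>g\<leftarrow>gs. g\<^sup>2) (2 * N)" "g \<in> set gs"
  shows "tdeg_le g N"
proof -
  interpret h: unital_hom "\<lambda>F :: real poly poly. poly F [:r:]" for r by standard auto
  have "degree (poly g [:r:]) \<le> N" for r
  proof (rule ccontr)
    assume big: "\<not> degree (poly g [:r:]) \<le> N"
    define p where "p = poly g [:r:]"
    define q where "q = poly (\<Sum>g\<leftarrow>gs. g\<^sup>2) [:r:]"
    have "degree q \<le> 2 * N"
      unfolding q_def poly_altdef
    proof (intro degree_sum_le finite_atMost)
      fix i
      have "degree ([:r:] ^ i) = 0" by (simp add: poly_const_pow)
      then have "degree (coeff (\<Sum>g\<leftarrow>gs. g\<^sup>2) i * [:r:] ^ i) \<le> degree (coeff (\<Sum>g\<leftarrow>gs. g\<^sup>2) i) + 0"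
        using degree_mult_le[of "coeff (\<Sum>g\<leftarrow>gs. g\<^sup>2) i" "[:r:] ^ i"] by simp
      then show "degree (coeff (\<Sum>g\<leftarrow>gs. g\<^sup>2) i * [:r:] ^ i) \<le> 2 * N"
        using assms(1)[unfolded tdeg_le_def, rule_format, of i] by linarith
    qed
    moreover have p0: "p \<noteq> 0" using big by (auto simp: p_def)
    moreover have dp: "degree (p\<^sup>2) = 2 * degree p" using p0 by (simp add: degree_power_eq)
    ultimately have lt: "degree q < degree (p\<^sup>2)" using big by (simp add: p_def)
    have q: "q = (\<Sum>g\<leftarrow>gs. (poly g [:r:])\<^sup>2)"
      unfolding q_def by (induction gs) (simp_all add: h.power)
    have nn: "poly (q - p\<^sup>2) t \<ge> 0" for t
    proof -
      have "(ev g t r)\<^sup>2 \<le> (\<Sum>g\<leftarrow>gs. (ev g t r)\<^sup>2)"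
        by (rule member_le_sum_list) (use assms(2) in auto)
      moreover have "poly q t = (\<Sum>g\<leftarrow>gs. (ev g t r)\<^sup>2)"
        unfolding q by (induction gs) (simp_all add: ev_def poly_power)
      ultimately show ?thesis by (simp add: p_def ev_def poly_power)
    qed
    have "degree (q - p\<^sup>2) = degree (p\<^sup>2)" "lead_coeff (q - p\<^sup>2) = - lead_coeff (p\<^sup>2)"
    proof -
      have "q - p\<^sup>2 = - (p\<^sup>2) + q" by simp
      then show 1: "degree (q - p\<^sup>2) = degree (p\<^sup>2)"
        using lt degree_add_eq_left[of q "- (p\<^sup>2)"] by simp
      show "lead_coeff (q - p\<^sup>2) = - lead_coeff (p\<^sup>2)" unfolding 1 using lt by (simp add: coeff_eq_0)
    qed
    moreover have "lead_coeff (p\<^sup>2) > 0" using p0 by (simp add: lead_coeff_power)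
    moreover have "q - p\<^sup>2 \<noteq> 0" using calculation by (metis leading_coeff_0_iff neg_equal_0_iff_equal less_irrefl)
    ultimately show False using nonneg_poly_lead(2)[OF nn] by simp
  qed
  then have zero: "coeff (poly g [:r:]) j = 0" if "j > N" for r j
    using that by (meson coeff_eq_0 le_less_trans)
  show ?thesis
    unfolding tdeg_le_def
  proof (intro allI degree_le impI)
    fix i j assume j: "N < j"
    define P where "P = map_poly (\<lambda>a. coeff a j) g"
    have "poly P r = coeff (poly g [:r:]) j" for r
    proof -
      have "degree P \<le> degree g" unfolding P_def by (rule map_poly_degree_leq)
      then have "poly P r = (\<Sum>i\<le>degree g. coeff P i * r ^ i)"
        unfolding poly_altdef by (intro sum.mono_neutral_left) (auto simp: coeff_eq_0)
      also have "\<dots> = coeff (poly g [:r:]) j"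
        by (simp add: poly_altdef[of g] coeff_sum poly_const_pow P_def coeff_map_poly mult.commute)
      finally show ?thesis .
    qed
    then have "P = 0" using zero[OF j] poly_all_0_iff_0 by metis
    then show "coeff (coeff g i) j = 0" unfolding P_def by (metis coeff_0 coeff_map_poly)
  qed
qed

subsection \<open>Rotating the circle\<close>

text \<open>The homogenized substitution \<open>v^m * a(u / v)\<close>; \<open>m\<close> may exceed
  the degree of \<open>a\<close>.\<close>

definition moebius :: "real poly \<Rightarrow> real poly \<Rightarrow> nat \<Rightarrow> real poly \<Rightarrow> real poly"
  where "moebius u v m a = (\<Sum>j\<le>m. smult (coeff a j) (u ^ j * v ^ (m - j)))"

lemma moebius_0 [simp]: "moebius u v m 0 = 0"
  by (simp add: moebius_def)

lemma poly_moebius: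
  assumes "degree a \<le> m" "poly v t \<noteq> 0"
  shows "poly (moebius u v m a) t = poly v t ^ m * poly a (poly u t / poly v t)"
proof -
  have "poly a (poly u t / poly v t) = (\<Sum>j\<le>m. coeff a j * (poly u t / poly v t) ^ j)"
    unfolding poly_altdef using assms(1) by (intro sum.mono_neutral_left) (auto simp: coeff_eq_0)
  then have "poly v t ^ m * poly a (poly u t / poly v t) =
      (\<Sum>j\<le>m. coeff a j * (poly v t ^ m * (poly u t / poly v t) ^ j))"
    by (simp add: sum_distrib_left mult_ac)
  also have "\<dots> = poly (moebius u v m a) t"
    unfolding moebius_def poly_sum
  proof (intro sum.cong refl)
    fix j assume "j \<in> {..m}"
    then have "poly v t ^ m = poly v t ^ j * poly v t ^ (m - j)" by (simp flip: power_add)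
    then show "coeff a j * (poly v t ^ m * (poly u t / poly v t) ^ j) =
        poly (smult (coeff a j) (u ^ j * v ^ (m - j))) t"
      using assms(2) by (simp add: poly_power power_divide)
  qed
  finally show ?thesis ..
qed

lemma moebius_degree:
  assumes "degree u \<le> 1" "degree v \<le> 1"
  shows "degree (moebius u v m a) \<le> m"
    and "coeff (moebius u v m a) m = (\<Sum>j\<le>m. coeff a j * (coeff u 1 ^ j * coeff v 1 ^ (m - j)))"
proof -
  have d: "degree (u ^ j) \<le> j" "degree (v ^ j) \<le> j" for j
    using order.trans[OF degree_power_le[of u j] mult_le_mono1[OF assms(1), of j]]
      order.trans[OF degree_power_le[of v j] mult_le_mono1[OF assms(2), of j]] by simp_all
  show "degree (moebius u v m a) \<le> m"
    unfolding moebius_def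
  proof (intro degree_sum_le finite_atMost order.trans[OF degree_smult_le])
    fix j assume "j \<in> {..m}"
    then show "degree (u ^ j * v ^ (m - j)) \<le> m"
      using degree_mult_le[of "u ^ j" "v ^ (m - j)"] d(1)[of j] d(2)[of "m - j"] by simp
  qed
  have "coeff (u ^ j * v ^ (m - j)) m = coeff u 1 ^ j * coeff v 1 ^ (m - j)" if "j \<le> m" for j
    using coeff_mult_top[OF d(1)[of j] d(2)[of "m - j"]] that
      coeff_power_top[OF assms(1), of j] coeff_power_top[OF assms(2), of "m - j"] by simp
  then show "coeff (moebius u v m a) m = (\<Sum>j\<le>m. coeff a j * (coeff u 1 ^ j * coeff v 1 ^ (m - j)))"
    unfolding moebius_def coeff_sum by (intro sum.cong) auto
qed

abbreviation moebius2 :: "real poly \<Rightarrow> real poly \<Rightarrow> nat \<Rightarrow> real poly poly \<Rightarrow> real poly poly"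
  where "moebius2 u v m \<equiv> map_poly (moebius u v m)"

lemma ev_moebius2:
  assumes "tdeg_le F m" "poly v t \<noteq> 0"
  shows "ev (moebius2 u v m F) t r = poly v t ^ m * ev F (poly u t / poly v t) r"
proof -
  have "ev (moebius2 u v m F) t r = (\<Sum>i\<le>degree F. poly (moebius u v m (coeff F i)) t * r ^ i)"
    using ev_conv_sum[OF map_poly_degree_leq[of "moebius u v m" F], of t r] by (simp add: coeff_map_poly)
  also have "\<dots> = poly v t ^ m * ev F (poly u t / poly v t) r"
    using assms unfolding tdeg_le_def by (simp add: ev_conv_sum[OF order_refl] poly_moebius sum_distrib_left mult_ac)
  finally show ?thesis .
qed

lemma tdeg_le_moebius2: "degree u \<le> 1 \<Longrightarrow> degree v \<le> 1 \<Longrightarrow> tdeg_le (moebius2 u v m F) m"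
  by (simp add: tdeg_le_def coeff_map_poly moebius_degree)

lemma ev_eqI_except:
  assumes "\<And>t r. t \<noteq> t0 \<Longrightarrow> ev F t r = ev G t r"
  shows "F = G"
proof -
  have "[:[:- t0, 1:]:] * F = [:[:- t0, 1:]:] * G"
  proof (rule ev_eqI)
    show "ev ([:[:- t0, 1:]:] * F) t r = ev ([:[:- t0, 1:]:] * G) t r" for t r
      using assms[of t r] by (cases "t = t0") (simp_all add: ev.mult)
  qed
  then show ?thesis by (simp only: mult_left_cancel pCons_eq_0_iff one_neq_zero simp_thms)
qed

text \<open>The map \<open>t \<mapsto> (t0 * t - 1) / (t + t0)\<close> is a rotation of the circle
  that sends infinity to \<open>t0\<close>. Its inverse multiplies \<open>1 + t^2\<close> by a
  constant over the square of \<open>t0 - t\<close>, so admissible denominators stay admissible. The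
  summands can be homogenized because their degree in \<open>t\<close> is at most half of that of
  the sum.\<close>

lemma cyl_sos_rotate_back:
  fixes t0 :: real
  assumes tF: "tdeg_le F (2 * n)" and cs: "cyl_sos (moebius2 [:-1, t0:] [:t0, 1:] (2 * n) F)"
  shows "cyl_sos F"
proof -
  define F' where "F' = moebius2 [:-1, t0:] [:t0, 1:] (2 * n) F"
  define \<rho> where "\<rho> = 1 + t0\<^sup>2"
  have \<rho>: "\<rho> > 0" by (simp add: \<rho>_def add_pos_nonneg)
  obtain k gs where gs: "[:qt ^ k:] * F' = (\<Sum>g\<leftarrow>gs. g\<^sup>2)"
    using cs unfolding cyl_sos_def sum_squares_def F'_def by blast
  have "tdeg_le F' (2 * n)" unfolding F'_def by (rule tdeg_le_moebius2) simp_all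
  then have "tdeg_le ([:qt ^ k:] * F') (2 * k + 2 * n)"
    using tdeg_le_const_mult[OF eq_refl[OF degree_qt_power]] by blast
  then have "tdeg_le (\<Sum>g\<leftarrow>gs. g\<^sup>2) (2 * (k + n))" unfolding gs distrib_left .
  from tdeg_le_sum_squares[OF this] have tg: "tdeg_le g (k + n)" if "g \<in> set gs" for g
    using that .
  define G where "G g = moebius2 [:1, t0:] [:t0, -1:] (k + n) g" for g
  have "[:[:\<rho> ^ (k + 2 * n):]:] * ([:qt ^ k:] * F) = (\<Sum>g\<leftarrow>map G gs. g\<^sup>2)"
  proof (rule ev_eqI_except)
    fix t r assume t: "t \<noteq> t0"
    define b where "b = t0 - t"
    define \<tau> where "\<tau> = (1 + t0 * t) / b"
    have b: "b \<noteq> 0" using t by (simp add: b_def)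
    have b\<tau>: "b * \<tau> = 1 + t0 * t" using b by (simp add: \<tau>_def)
    have "b * (\<tau> + t0) = \<rho>"
      unfolding distrib_left b\<tau> by (simp add: \<rho>_def b_def power2_eq_square algebra_simps)
    then have \<tau>b: "\<tau> + t0 = \<rho> / b" using b by (metis nonzero_mult_div_cancel_left)
    have "b * (t0 * \<tau> - 1) = t0 * (b * \<tau>) - b" by (simp add: algebra_simps)
    also have "\<dots> = t * \<rho>" unfolding b\<tau> by (simp add: \<rho>_def b_def power2_eq_square algebra_simps)
    finally have \<tau>a: "t0 * \<tau> - 1 = t * \<rho> / b" using b by (metis nonzero_mult_div_cancel_left)
    have "b\<^sup>2 * (1 + \<tau>\<^sup>2) = b\<^sup>2 + (b * \<tau>)\<^sup>2" by (simp add: power_mult_distrib distrib_left)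
    also have "\<dots> = \<rho> * (1 + t\<^sup>2)" unfolding b\<tau> by (simp add: \<rho>_def b_def power2_eq_square algebra_simps)
    finally have \<tau>q: "1 + \<tau>\<^sup>2 = \<rho> * (1 + t\<^sup>2) / b\<^sup>2"
      using b by (metis nonzero_mult_div_cancel_left power_not_zero)
    have "ev (\<Sum>g\<leftarrow>map G gs. g\<^sup>2) t r = (\<Sum>g\<leftarrow>gs. (ev (G g) t r)\<^sup>2)"
      by (simp add: ev_sum_list ev.power o_def)
    also have "\<dots> = (\<Sum>g\<leftarrow>gs. (b ^ (k + n))\<^sup>2 * (ev g \<tau> r)\<^sup>2)"
    proof (intro arg_cong[of _ _ sum_list] map_cong refl)
      fix g assume g: "g \<in> set gs"
      have "ev (G g) t r = b ^ (k + n) * ev g \<tau> r"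
        unfolding G_def using ev_moebius2[OF tg[OF g], of "[:t0, -1:]" t "[:1, t0:]" r] b
        by (simp add: b_def \<tau>_def mult.commute)
      then show "(ev (G g) t r)\<^sup>2 = (b ^ (k + n))\<^sup>2 * (ev g \<tau> r)\<^sup>2" by (simp add: power_mult_distrib)
    qed
    also have "\<dots> = (b ^ (k + n))\<^sup>2 * ev ([:qt ^ k:] * F') \<tau> r"
      unfolding gs by (simp add: ev_sum_list ev.power sum_list_const_mult)
    also have "ev ([:qt ^ k:] * F') \<tau> r = (1 + \<tau>\<^sup>2) ^ k * ev F' \<tau> r"
      by (simp add: ev.mult poly_power power2_eq_square)
    also have "ev F' \<tau> r = (\<tau> + t0) ^ (2 * n) * ev F ((t0 * \<tau> - 1) / (\<tau> + t0)) r"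
      unfolding F'_def using ev_moebius2[OF tF, of "[:t0, 1:]" \<tau> "[:-1, t0:]" r] \<tau>b \<rho> b
      by (simp add: add.commute mult.commute)
    also have "(t0 * \<tau> - 1) / (\<tau> + t0) = t" unfolding \<tau>a \<tau>b using \<rho> b by simp
    also have "(b ^ (k + n))\<^sup>2 * ((1 + \<tau>\<^sup>2) ^ k * ((\<tau> + t0) ^ (2 * n) * ev F t r)) =
        \<rho> ^ (k + 2 * n) * ((1 + t\<^sup>2) ^ k * ev F t r)"
    proof -
      have "(b ^ (k + n))\<^sup>2 = (b\<^sup>2) ^ k * b ^ (2 * n)"
        by (simp add: power_add power_mult_distrib mult.commute flip: power_mult)
      moreover have "(b\<^sup>2) ^ k * (\<rho> * (1 + t\<^sup>2) / b\<^sup>2) ^ k = (\<rho> * (1 + t\<^sup>2)) ^ k"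
        using b by (simp add: power_divide)
      moreover have "b ^ (2 * n) * (\<rho> / b) ^ (2 * n) = \<rho> ^ (2 * n)"
        using b by (simp add: power_divide)
      moreover have "((b\<^sup>2) ^ k * b ^ (2 * n)) * (x * (y * f)) = ((b\<^sup>2) ^ k * x) * (b ^ (2 * n) * y) * f" for x y f
        by simp
      ultimately show ?thesis unfolding \<tau>q \<tau>b
        by (simp only:) (simp add: power_mult_distrib power_add)
    qed
    also have "\<dots> = ev ([:[:\<rho> ^ (k + 2 * n):]:] * ([:qt ^ k:] * F)) t r"
      by (simp add: ev.mult poly_power power2_eq_square)
    finally show "ev ([:[:\<rho> ^ (k + 2 * n):]:] * ([:qt ^ k:] * F)) t r = ev (\<Sum>g\<leftarrow>map G gs. g\<^sup>2) t r" ..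
  qed
  then have "cyl_sos ([:[:\<rho> ^ (k + 2 * n):]:] * ([:qt ^ k:] * F))"
    using cyl_sosI[OF sum_squares_sum_list] by metis
  then show ?thesis
    using cyl_sos_cancel_const[of "\<rho> ^ (k + 2 * n)"] cyl_sos_cancel_qt \<rho> by (metis zero_less_power)
qed

text \<open>A point \<open>t0\<close> with \<open>poly \<eta> t0 \<noteq> 0\<close> is rotated to
  infinity. The leading form in \<open>t\<close> of the rotated polynomial is then \<open>F\<close>
  at \<open>t0\<close>, for which the lower bound holds without loss.\<close>

lemma lower_bounded_cyl_sos:
  assumes psd: "psd2 F" and dF: "degree F \<le> 2 * d" and lb: "lower_bounded F d"
  shows "cyl_sos F"
proof -
  obtain n where "tdeg_le F n" using tdeg_le_exists by blast
  then have tF: "tdeg_le F (2 * n)" by (rule tdeg_le_mono) simp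
  obtain \<eta> L where \<eta>: "\<eta> \<noteq> 0" "\<And>t r. (poly \<eta> t)\<^sup>2 * (1 + r\<^sup>2) ^ d \<le> (1 + t\<^sup>2) ^ L * ev F t r"
    using lb by (auto simp: lower_bounded_def)
  obtain t0 where t0: "poly \<eta> t0 \<noteq> 0" using \<eta>(1) poly_all_0_iff_0 by blast
  define u where "u = [:-1, t0:]"
  define v where "v = [:t0, 1:]"
  define F' where "F' = moebius2 u v (2 * n) F"
  define e where "e = degree \<eta>"
  define \<rho> where "\<rho> = 1 + t0\<^sup>2"
  have \<rho>: "\<rho> > 0" by (simp add: \<rho>_def add_pos_nonneg)
  have v0: "v \<noteq> 0" by (simp add: v_def)
  have duv: "degree u \<le> 1" "degree v \<le> 1" by (simp_all add: u_def v_def)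
  have uv: "(poly u t)\<^sup>2 + (poly v t)\<^sup>2 = \<rho> * (1 + t\<^sup>2)" for t
    by (simp add: u_def v_def \<rho>_def power2_eq_square algebra_simps)
  have v2: "(poly v t)\<^sup>2 \<le> \<rho> * (1 + t\<^sup>2)" for t
    using uv[of t] zero_le_power2[of "poly u t"] by linarith
  have evF': "ev F' t r = poly v t ^ (2 * n) * ev F (poly u t / poly v t) r" if "poly v t \<noteq> 0" for t r
    unfolding F'_def by (rule ev_moebius2[OF tF that])
  have psd': "psd2 F'"
    unfolding psd2_def
  proof (intro allI)
    fix t r
    have "ev F' t r \<ge> 0" if "poly v t \<noteq> 0" for t
      using psd by (simp add: evF'[OF that] psd2_def)
    then show "ev F' t r \<ge> 0"
      unfolding ev_def by (rule poly_nonneg_dense[OF v0])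
  qed
  have top: "coeff (moebius u v m a) m = poly a t0" if "degree a \<le> m" for m a
  proof -
    have "coeff (moebius u v m a) m = (\<Sum>j\<le>m. coeff a j * t0 ^ j)"
      using moebius_degree(2)[OF duv, of m a] by (simp add: u_def v_def)
    also have "\<dots> = poly a t0"
      unfolding poly_altdef using that by (intro sum.mono_neutral_right) (auto simp: coeff_eq_0)
    finally show ?thesis .
  qed
  have "cyl_sos F'"
  proof (rule good_at_infinity_cyl_sos[OF psd'])
    show "tdeg_le F' (2 * n)" unfolding F'_def by (rule tdeg_le_moebius2[OF duv])
    show "degree F' \<le> 2 * d" unfolding F'_def using dF map_poly_degree_leq le_trans by blast
    show "(poly \<eta> t0)\<^sup>2 / (1 + t0\<^sup>2) ^ L > 0" using t0 \<rho> by (simp add: \<rho>_def)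
    fix r
    have "(poly \<eta> t0)\<^sup>2 / (1 + t0\<^sup>2) ^ L * (1 + r\<^sup>2) ^ d \<le> ev F t0 r"
      using \<eta>(2)[of t0 r] \<rho> by (simp add: \<rho>_def field_simps)
    also have "ev F t0 r = (\<Sum>i\<le>2 * d. coeff (coeff F' i) (2 * n) * r ^ i)"
      using tF unfolding ev_conv_sum[OF dF] tdeg_le_def by (simp add: F'_def coeff_map_poly top)
    finally show "(poly \<eta> t0)\<^sup>2 / (1 + t0\<^sup>2) ^ L * (1 + r\<^sup>2) ^ d \<le> (\<Sum>i\<le>2 * d. coeff (coeff F' i) (2 * n) * r ^ i)" .
  next
    show "lower_bounded F' d"
    proof (rule lower_boundedI)
      have "moebius u v e \<eta> \<noteq> 0" using top[of \<eta> e] t0 by (auto simp: e_def)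
      \<comment> \<open>Of the powers of \<open>v\<close>, \<open>L\<close> clear the denominators
        of \<open>1 + \<tau>^2\<close> and \<open>n\<close> those of \<open>F\<close>; the extra one
        makes the bound trivial at the pole \<open>v = 0\<close>.\<close>
      then show "v ^ Suc (n + L) * moebius u v e \<eta> \<noteq> 0" using v0 by (simp del: power_Suc)
      show "\<rho> ^ (L + e + 1) > 0" using \<rho> by simp
      fix t r
      show "(poly (v ^ Suc (n + L) * moebius u v e \<eta>) t)\<^sup>2 * (1 + r\<^sup>2) ^ d
          \<le> \<rho> ^ (L + e + 1) * (1 + t\<^sup>2) ^ (L + e + 1) * ev F' t r"
      proof (cases "poly v t = 0")
        case True
        then show ?thesis using psd' \<rho> by (simp add: poly_power psd2_def)
      next
        case False
        define b where "b = poly v t"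
        define \<tau> where "\<tau> = poly u t / b"
        define q where "q = \<rho> * (1 + t\<^sup>2)"
        have b: "b \<noteq> 0" using False by (simp add: b_def)
        have bq: "b\<^sup>2 * (1 + \<tau>\<^sup>2) = q"
          using uv[of t] b by (simp add: \<tau>_def b_def q_def power_divide distrib_left)
        have b2: "b\<^sup>2 \<le> q" using v2[of t] by (simp add: b_def q_def)
        have f0: "b ^ (2 * n) * ev F \<tau> r \<ge> 0" using psd by (simp add: psd2_def)
        have "poly (v ^ Suc (n + L) * moebius u v e \<eta>) t = b ^ (Suc (n + L) + e) * poly \<eta> \<tau>"
          using poly_moebius[of \<eta> e v t u] False by (simp add: e_def poly_power b_def \<tau>_def power_add)
        then have "(poly (v ^ Suc (n + L) * moebius u v e \<eta>) t)\<^sup>2 * (1 + r\<^sup>2) ^ d =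
            (b\<^sup>2) ^ (Suc (n + L) + e) * ((poly \<eta> \<tau>)\<^sup>2 * (1 + r\<^sup>2) ^ d)"
          by (simp add: power_mult_distrib mult.commute mult.left_commute flip: power_mult)
        also have "\<dots> \<le> (b\<^sup>2) ^ (Suc (n + L) + e) * ((1 + \<tau>\<^sup>2) ^ L * ev F \<tau> r)"
          by (intro mult_left_mono \<eta>) simp
        also have "\<dots> = (b\<^sup>2) ^ Suc e * (b\<^sup>2 * (1 + \<tau>\<^sup>2)) ^ L * (b ^ (2 * n) * ev F \<tau> r)"
          by (simp add: power_add power_mult_distrib power_mult)
        also have "\<dots> \<le> q ^ Suc e * q ^ L * (b ^ (2 * n) * ev F \<tau> r)"
          unfolding bq using b2 f0 by (intro mult_right_mono power_mono) (auto simp: q_def \<rho>_def)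
        also have "\<dots> = \<rho> ^ (L + e + 1) * (1 + t\<^sup>2) ^ (L + e + 1) * ev F' t r"
          unfolding evF'[OF False] by (simp add: q_def power_mult_distrib power_add \<tau>_def b_def)
        finally show ?thesis .
      qed
    qed
  qed
  then show ?thesis unfolding F'_def u_def v_def by (rule cyl_sos_rotate_back[OF tF])
qed

theorem psd_cyl_sos:
  assumes "psd2 F"
  shows "cyl_sos F"
  using assms
proof (induction "degree F" arbitrary: F rule: less_induct)
  case less
  show ?case
  proof (cases "degree F = 0")
    case True
    then obtain a where a: "F = [:a:]" by (rule degree_eq_zeroE)
    have "poly a t \<ge> 0" for t using less.prems unfolding psd2_def a by (metis ev_pCons ev.zero add_0_right mult_zero_right)
    from nonneg_poly_two_squares[OF this] obtain b c where "a = b\<^sup>2 + c\<^sup>2" by blast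
    then have "F = [:b:]\<^sup>2 + [:c:]\<^sup>2" by (simp add: a power2_eq_square)
    then show ?thesis by (simp only: cyl_sosI sum_squares_add sum_squares_square)
  next
    case False
    consider \<pi> where "degree \<pi> > 0" "\<pi>\<^sup>2 dvd F" | u v \<delta> where "\<delta> \<noteq> 0" "u * F + v * pderiv F = [:\<delta>:]"
      using square_factor_or_bezout[of F] False by auto
    then show ?thesis
    proof cases
      case 1
      then obtain G where G: "F = \<pi>\<^sup>2 * G" by blast
      have p0: "\<pi> \<noteq> 0" using 1 by auto
      have "psd2 G"
        by (rule psd2_cofactor[of "\<pi>\<^sup>2"]) (use p0 less.prems G in \<open>auto simp: psd2_def ev.power\<close>)
      moreover have "G \<noteq> 0" using False G by auto
      then have "degree G < degree F" using 1(1) p0 by (simp add: G degree_mult_eq degree_power_eq)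
      ultimately have "cyl_sos G" using less.hyps by blast
      then show ?thesis unfolding G by (rule cyl_sos_mult_sum_squares[OF sum_squares_square])
    next
      case 2
      have "F \<noteq> 0" using False by auto
      then obtain d where d: "degree F = 2 * d" using psd2_lead(1)[OF less.prems] by blast
      then have "lower_bounded F d" using False by (intro lower_bounded_bezout[OF less.prems d _ 2(2,1)]) simp
      then show ?thesis using less.prems d by (intro lower_bounded_cyl_sos) auto
    qed
  qed
qed

subsection \<open>Weights\<close>

text \<open>With \<open>N = 2 * k\<close> these are the numerators over \<open>(1 + t^2)^k\<close>
  of elements of \<open>B\<close>.\<close>

definition wt_le :: "real poly poly \<Rightarrow> nat \<Rightarrow> bool"
  where "wt_le F N \<longleftrightarrow> (\<forall>i. degree (coeff F i) \<le> N + i)"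

lemma wt_le_add: "wt_le F N \<Longrightarrow> wt_le G N \<Longrightarrow> wt_le (F + G) N"
  by (simp add: wt_le_def degree_add_le)

lemma wt_le_mult:
  assumes "wt_le F M" "wt_le G N"
  shows "wt_le (F * G) (M + N)"
  unfolding wt_le_def coeff_mult
proof (intro allI degree_sum_le finite_atMost)
  fix i a :: nat assume a: "a \<in> {..i}"
  have "degree (coeff F a * coeff G (i - a)) \<le> (M + a) + (N + (i - a))"
    using assms by (intro order.trans[OF degree_mult_le] add_mono) (auto simp: wt_le_def)
  then show "degree (coeff F a * coeff G (i - a)) \<le> M + N + i" using a by simp
qed

lemma wt_le_const: "degree a \<le> N \<Longrightarrow> wt_le [:a:] N"
  by (auto simp: wt_le_def coeff_pCons split: nat.splits)

text \<open>The leading form for the grading in which \<open>t\<close> has weight 1 and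
  \<open>r\<close> has weight -1, recorded as a univariate polynomial.\<close>

definition wt_top :: "nat \<Rightarrow> real poly poly \<Rightarrow> real poly"
  where "wt_top M g = (\<Sum>i\<le>degree g. monom (coeff (coeff g i) (M + i)) i)"

lemma coeff_wt_top: "coeff (wt_top M g) i = coeff (coeff g i) (M + i)"
  by (cases "i \<le> degree g") (simp_all add: wt_top_def coeff_sum coeff_eq_0)

lemma wt_top_add: "wt_top M (g + h) = wt_top M g + wt_top M h"
  by (simp add: poly_eq_iff coeff_wt_top)

lemma wt_top_square:
  assumes "wt_le g M"
  shows "wt_top (2 * M) (g\<^sup>2) = (wt_top M g)\<^sup>2"
proof (rule poly_eqI)
  fix i
  have "coeff (wt_top (2 * M) (g\<^sup>2)) i = (\<Sum>a\<le>i. coeff (coeff g a * coeff g (i - a)) ((M + a) + (M + (i - a))))"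
    by (simp add: coeff_wt_top power2_eq_square coeff_mult[of g g] coeff_sum mult_2 add.assoc)
  also have "\<dots> = (\<Sum>a\<le>i. coeff (wt_top M g) a * coeff (wt_top M g) (i - a))"
    unfolding coeff_wt_top
    by (intro sum.cong refl coeff_mult_top assms[unfolded wt_le_def, rule_format])
  finally show "coeff (wt_top (2 * M) (g\<^sup>2)) i = coeff ((wt_top M g)\<^sup>2) i"
    by (simp add: power2_eq_square coeff_mult)
qed

lemma sum_squares_real_poly_eq_0:
  fixes ps :: "real poly list"
  assumes "(\<Sum>p\<leftarrow>ps. p\<^sup>2) = 0" "p \<in> set ps"
  shows "p = 0"
proof -
  have "poly p x = 0" for x
  proof -
    have "(\<Sum>p\<leftarrow>ps. (poly p x)\<^sup>2) = poly (\<Sum>p\<leftarrow>ps. p\<^sup>2) x"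
      by (induction ps) (simp_all add: poly_power)
    then have "(\<Sum>p\<leftarrow>ps. (poly p x)\<^sup>2) = 0" using assms(1) by simp
    then have "(poly p x)\<^sup>2 = 0" using assms(2) by (subst (asm) sum_list_nonneg_eq_0_iff) auto
    then show ?thesis by simp
  qed
  then show ?thesis using poly_all_0_iff_0 by blast
qed

text \<open>Leading forms of squares cannot cancel over the reals.\<close>

lemma wt_le_sum_squares:
  assumes "wt_le (\<Sum>g\<leftarrow>gs. g\<^sup>2) (2 * N)" "g \<in> set gs"
  shows "wt_le g N"
proof -
  \<comment> \<open>A crude common bound exists because there are finitely many summands; it is
    lowered by one at a time.\<close>
  have "\<forall>g\<in>set gs. wt_le g N" if "\<forall>g\<in>set gs. wt_le g (N + M)" for M
    using that
  proof (induction M)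
    case (Suc M)
    let ?M = "Suc (N + M)"
    have "(\<Sum>p\<leftarrow>map (wt_top ?M) gs. p\<^sup>2) = wt_top (2 * ?M) (\<Sum>g\<leftarrow>gs. g\<^sup>2)"
      using Suc.prems
      by (induction gs) (auto simp: wt_top_add wt_top_square poly_eq_iff coeff_wt_top simp del: mult_Suc_right)
    also have "\<dots> = 0"
    proof (rule poly_eqI)
      fix i
      have "degree (coeff (\<Sum>g\<leftarrow>gs. g\<^sup>2) i) \<le> 2 * N + i" using assms(1) by (simp add: wt_le_def)
      then show "coeff (wt_top (2 * ?M) (\<Sum>g\<leftarrow>gs. g\<^sup>2)) i = coeff 0 i"
        by (simp add: coeff_wt_top coeff_eq_0)
    qed
    finally have "wt_top ?M g = 0" if "g \<in> set gs" for g
      using that sum_squares_real_poly_eq_0 by (metis image_eqI set_map)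
    then have z: "coeff (coeff g i) (?M + i) = 0" if "g \<in> set gs" for g i
      using that by (metis coeff_0 coeff_wt_top)
    have "wt_le g (N + M)" if g: "g \<in> set gs" for g
      unfolding wt_le_def
    proof (intro allI degree_le impI)
      fix i j assume j: "N + M + i < j"
      have "degree (coeff g i) \<le> ?M + i" using Suc.prems g by (simp add: wt_le_def)
      then show "coeff (coeff g i) j = 0"
        using j z[OF g, of i] by (cases "j = ?M + i") (auto simp: coeff_eq_0)
    qed
    then show ?case by (intro Suc.IH) blast
  qed simp
  moreover have "\<exists>M. \<forall>g\<in>set gs. wt_le g (N + M)"
  proof -
    obtain n where n: "\<And>g. tdeg_le g (n g)" using tdeg_le_exists by metis
    have "wt_le g (N + (\<Sum>g\<leftarrow>gs. n g))" if "g \<in> set gs" for g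
    proof -
      have "n g \<le> (\<Sum>g\<leftarrow>gs. n g)" using that by (intro member_le_sum_list) auto
      then show ?thesis using n[of g] unfolding wt_le_def tdeg_le_def
        by (meson le_add1 le_add2 le_trans trans_le_add1 add_le_mono)
    qed
    then show ?thesis by blast
  qed
  ultimately show ?thesis using assms(2) by blast
qed

subsection \<open>The algebra B in the coordinates r = x and t = y/x\<close>

interpretation rf: unital_hom rf_const
proof
  show "rf_const 1 = 1" by (simp add: rf_const_def flip: one_pCons)
qed (simp_all add: rf_const_def flip: to_fract_add to_fract_mult)

definition rf_t :: ratfun where "rf_t = rf_y / rf_x"

definition rf_inner :: "real poly \<Rightarrow> ratfun" where "rf_inner a = poly (map_poly rf_const a) rf_t"

interpretation inner: unital_hom rf_inner
  unfolding rf_inner_def by (rule rf.poly_hom)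

definition chart :: "real poly poly \<Rightarrow> ratfun" where "chart F = poly (map_poly rf_inner F) rf_x"

interpretation chart: unital_hom chart
  unfolding chart_def by (rule inner.poly_hom)

lemma rf_inner_pCons [simp]: "rf_inner (pCons c a) = rf_const c + rf_t * rf_inner a"
  by (simp add: rf_inner_def map_poly_pCons)

lemma chart_pCons [simp]: "chart (pCons a F) = rf_inner a + rf_x * chart F"
  by (simp add: chart_def map_poly_pCons)

lemma rf_x_nz [simp]: "rf_x \<noteq> 0"
  by (simp add: rf_x_def)

abbreviation rf_q :: ratfun where "rf_q \<equiv> 1 + rf_t\<^sup>2"

lemma rf_q: "rf_q = (rf_x\<^sup>2 + rf_y\<^sup>2) / rf_x\<^sup>2"
  by (simp add: rf_t_def power_divide add_divide_distrib)

lemma rf_q_nz [simp]: "rf_q \<noteq> 0"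
  unfolding rf_q using rf_denominator_nonzero by simp

lemma rf_inner_qt: "rf_inner qt = rf_q"
  by (simp add: power2_eq_square)

lemma algB_generators:
  shows "1 / rf_q \<in> algB" "rf_t / rf_q \<in> algB" "rf_t\<^sup>2 / rf_q \<in> algB"
proof -
  have "1 / rf_q = rf_x\<^sup>2 / (rf_x\<^sup>2 + rf_y\<^sup>2)" unfolding rf_q by simp
  then show 1: "1 / rf_q \<in> algB" using algB.xx by simp
  have "rf_t / rf_q = rf_x * rf_y / (rf_x\<^sup>2 + rf_y\<^sup>2)"
    unfolding rf_q by (simp add: rf_t_def power2_eq_square)
  then show "rf_t / rf_q \<in> algB" using algB.xy by simp
  have "rf_q / rf_q = 1" by simp
  then have "rf_t\<^sup>2 / rf_q = rf_const 1 + - (1 / rf_q)"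
    by (simp only: add_divide_distrib rf.one)
  then show "rf_t\<^sup>2 / rf_q \<in> algB" using algB.add[OF algB.const[of 1] algB.uminus[OF 1]] by simp
qed

lemma algB_0 [simp]: "0 \<in> algB" and algB_1 [simp]: "1 \<in> algB"
  using algB.const[of 0] algB.const[of 1] by simp_all

lemma algB_power: "f \<in> algB \<Longrightarrow> f ^ n \<in> algB"
  by (induction n) (auto intro: algB.mult)

lemma algB_sum: "(\<And>i. i \<in> I \<Longrightarrow> f i \<in> algB) \<Longrightarrow> sum f I \<in> algB"
  by (induction I rule: infinite_finite_induct) (auto intro: algB.add)

lemma algB_sum_list: "(\<And>g. g \<in> set gs \<Longrightarrow> f g \<in> algB) \<Longrightarrow> (\<Sum>g\<leftarrow>gs. f g) \<in> algB"
  by (induction gs) (auto intro: algB.add)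

text \<open>Each factor \<open>1 / rf_q\<close> carries up to two powers of \<open>t\<close>, by the
  generators, and each factor \<open>x\<close> carries one, because
  \<open>t * x = y\<close>.\<close>

lemma algB_monomial:
  "j \<le> 2 * k + i \<Longrightarrow> rf_t ^ j * rf_x ^ i / rf_q ^ k \<in> algB"
proof (induction i arbitrary: j)
  case 0
  then have "j \<le> 2 * k" by simp
  then have "rf_t ^ j / rf_q ^ k \<in> algB"
  proof (induction k arbitrary: j)
    case (Suc k)
    consider "j = 0" | "j = 1" | l where "j = Suc (Suc l)" by (metis One_nat_def not0_implies_Suc)
    then show ?case
    proof cases
      case 1
      have "(1 / rf_q) * (rf_t ^ 0 / rf_q ^ k) \<in> algB"
        using algB_generators(1) Suc.IH[of 0] by (intro algB.mult) auto
      then show ?thesis by (simp add: 1)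
    next
      case 2
      have "(rf_t / rf_q) * (rf_t ^ 0 / rf_q ^ k) \<in> algB"
        using algB_generators(2) Suc.IH[of 0] by (intro algB.mult) auto
      then show ?thesis by (simp add: 2)
    next
      case 3
      have "(rf_t\<^sup>2 / rf_q) * (rf_t ^ l / rf_q ^ k) \<in> algB"
        using algB_generators(3) Suc.IH[of l] Suc.prems 3 by (intro algB.mult) auto
      then show ?thesis by (simp add: 3 power2_eq_square mult.assoc)
    qed
  qed simp
  then show ?case by simp
next
  case (Suc i)
  show ?case
  proof (cases "j \<le> 2 * k + i")
    case True
    from algB.mult[OF algB.x Suc.IH[OF this]] show ?thesis by (simp add: mult_ac)
  next
    case False
    with Suc.prems have j: "j = Suc (2 * k + i)" by simp
    have "rf_y * (rf_t ^ (2 * k + i) * rf_x ^ i / rf_q ^ k) \<in> algB"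
      by (intro algB.mult algB.y Suc.IH) simp
    moreover have "rf_y = rf_t * rf_x" by (simp add: rf_t_def)
    then have "rf_t ^ j * rf_x ^ Suc i = rf_y * (rf_t ^ (2 * k + i) * rf_x ^ i)"
      by (simp add: j)
    ultimately show ?thesis by (simp only: times_divide_eq_right)
  qed
qed

lemma (in unital_hom) poly_map_poly_conv_sum:
  "poly (map_poly h p) x = (\<Sum>i\<le>degree p. h (coeff p i) * x ^ i)"
proof -
  have "poly (map_poly h p) x = (\<Sum>i\<le>degree p. coeff (map_poly h p) i * x ^ i)"
    unfolding poly_altdef using map_poly_degree_leq[of h p]
    by (intro sum.mono_neutral_left) (auto simp: coeff_eq_0)
  then show ?thesis by (simp add: coeff_map_poly)
qed

lemma chart_in_algB:
  assumes "wt_le G (2 * k)"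
  shows "chart G / rf_q ^ k \<in> algB"
proof -
  have "chart G / rf_q ^ k =
      (\<Sum>i\<le>degree G. \<Sum>j\<le>degree (coeff G i). rf_const (coeff (coeff G i) j) * (rf_t ^ j * rf_x ^ i / rf_q ^ k))"
    unfolding chart_def inner.poly_map_poly_conv_sum
    unfolding rf_inner_def rf.poly_map_poly_conv_sum
    unfolding sum_divide_distrib sum_distrib_right by (intro sum.cong refl) simp
  also have "\<dots> \<in> algB"
    using assms unfolding wt_le_def
    by (intro algB_sum algB.mult algB.const algB_monomial) (meson atMost_iff le_trans)
  finally show ?thesis .
qed

lemma algB_chart:
  assumes "b \<in> algB"
  shows "\<exists>F k. rf_q ^ k * b = chart F \<and> wt_le F (2 * k)"
  using assms
proof induction
  case (const c)
  show ?case by (intro exI[of _ "[:[:c:]:]"] exI[of _ 0]) (simp add: wt_le_const)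
next
  case x
  show ?case by (intro exI[of _ "[:0, 1:]"] exI[of _ 0]) (auto simp: wt_le_def coeff_pCons split: nat.splits)
next
  case y
  show ?case by (intro exI[of _ "[:0, [:0, 1:]:]"] exI[of _ 0])
      (auto simp: wt_le_def coeff_pCons rf_t_def split: nat.splits)
next
  case xx
  have "rf_q * (rf_x\<^sup>2 / (rf_x\<^sup>2 + rf_y\<^sup>2)) = 1"
    unfolding rf_q using rf_denominator_nonzero by simp
  then show ?case by (intro exI[of _ 1] exI[of _ 1]) (simp add: wt_le_const one_pCons)
next
  case xy
  have "rf_q * (rf_x * rf_y / (rf_x\<^sup>2 + rf_y\<^sup>2)) = rf_t"
    unfolding rf_q using rf_denominator_nonzero by (simp add: rf_t_def power2_eq_square)
  then show ?case by (intro exI[of _ "[:[:0, 1:]:]"] exI[of _ 1]) (simp add: wt_le_const)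
next
  case (add f g)
  then obtain F G k l where F: "rf_q ^ k * f = chart F" "wt_le F (2 * k)"
    and G: "rf_q ^ l * g = chart G" "wt_le G (2 * l)" by blast
  have c: "chart [:qt ^ m:] = rf_q ^ m" for m by (simp only: chart_pCons chart.zero mult_zero_right add_0_right inner.power rf_inner_qt)
  have w: "wt_le [:qt ^ m:] (2 * m)" for m by (intro wt_le_const) (simp add: degree_qt_power)
  have "rf_q ^ (k + l) * (f + g) = rf_q ^ l * (rf_q ^ k * f) + rf_q ^ k * (rf_q ^ l * g)"
    by (simp add: power_add algebra_simps)
  also have "\<dots> = chart ([:qt ^ l:] * F + [:qt ^ k:] * G)"
    unfolding F G chart.add chart.mult c ..
  finally have "rf_q ^ (k + l) * (f + g) = chart ([:qt ^ l:] * F + [:qt ^ k:] * G)" .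
  moreover have "wt_le ([:qt ^ l:] * F + [:qt ^ k:] * G) (2 * (k + l))"
    using wt_le_mult[OF w[of l] F(2)] wt_le_mult[OF w[of k] G(2)]
    by (intro wt_le_add) (simp_all only: distrib_left add.commute)
  ultimately show ?case by blast
next
  case (uminus f)
  then obtain F k where F: "rf_q ^ k * f = chart F" "wt_le F (2 * k)" by blast
  then have "rf_q ^ k * (- f) = chart (- F)" "wt_le (- F) (2 * k)"
    by (simp_all add: chart.uminus wt_le_def)
  then show ?case by blast
next
  case (mult f g)
  then obtain F G k l where F: "rf_q ^ k * f = chart F" "wt_le F (2 * k)"
    and G: "rf_q ^ l * g = chart G" "wt_le G (2 * l)" by blast
  have "rf_q ^ (k + l) * (f * g) = chart (F * G)"
    unfolding chart.mult F(1)[symmetric] G(1)[symmetric] by (simp add: power_add mult_ac)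
  moreover have "wt_le (F * G) (2 * (k + l))"
    using wt_le_mult[OF F(2) G(2)] by (simp add: distrib_left)
  ultimately show ?case by blast
qed

subsection \<open>Evaluation characters\<close>

text \<open>Here \<open>ev\<close> is applied to \<open>\<real>[x][y]\<close>, so its first argument stands for \<open>x\<close> and its second for \<open>y\<close>.\<close>

definition has_value :: "real \<Rightarrow> real \<Rightarrow> ratfun \<Rightarrow> real \<Rightarrow> bool"
  where "has_value x0 y0 f v \<longleftrightarrow>
    (\<exists>P S. f * to_fract S = to_fract P \<and> ev S x0 y0 \<noteq> 0 \<and> v * ev S x0 y0 = ev P x0 y0)"

lemma has_value_unique:
  assumes "has_value x0 y0 f v" "has_value x0 y0 f w"
  shows "v = w"
proof -
  obtain P S where P: "f * to_fract S = to_fract P" "ev S x0 y0 \<noteq> 0" "v * ev S x0 y0 = ev P x0 y0"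
    using assms(1) by (auto simp: has_value_def)
  obtain Q T where Q: "f * to_fract T = to_fract Q" "ev T x0 y0 \<noteq> 0" "w * ev T x0 y0 = ev Q x0 y0"
    using assms(2) by (auto simp: has_value_def)
  have "to_fract (P * T) = to_fract (Q * S)"
    unfolding to_fract_mult P(1)[symmetric] Q(1)[symmetric] by (simp add: mult_ac)
  then have "P * T = Q * S" by (simp only: to_fract_eq_iff)
  from arg_cong[OF this, of "\<lambda>F. ev F x0 y0"] have "v * (ev S x0 y0 * ev T x0 y0) = w * (ev S x0 y0 * ev T x0 y0)"
    by (simp add: ev.mult P(3)[symmetric] Q(3)[symmetric] mult_ac)
  with P(2) Q(2) show ?thesis by simp
qed

lemma has_value_add:
  assumes "has_value x0 y0 f v" "has_value x0 y0 g w"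
  shows "has_value x0 y0 (f + g) (v + w)"
proof -
  obtain P S where P: "f * to_fract S = to_fract P" "ev S x0 y0 \<noteq> 0" "v * ev S x0 y0 = ev P x0 y0"
    using assms(1) by (auto simp: has_value_def)
  obtain Q T where Q: "g * to_fract T = to_fract Q" "ev T x0 y0 \<noteq> 0" "w * ev T x0 y0 = ev Q x0 y0"
    using assms(2) by (auto simp: has_value_def)
  have "(f + g) * to_fract (S * T) = to_fract (P * T + Q * S)"
    unfolding to_fract_mult to_fract_add P(1)[symmetric] Q(1)[symmetric] by (simp add: algebra_simps)
  moreover have "(v + w) * ev (S * T) x0 y0 = ev (P * T + Q * S) x0 y0"
    by (simp add: ev.mult ev.add P(3)[symmetric] Q(3)[symmetric] algebra_simps)
  moreover have "ev (S * T) x0 y0 \<noteq> 0" using P(2) Q(2) by (simp add: ev.mult)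
  ultimately show ?thesis unfolding has_value_def by blast
qed

lemma has_value_mult:
  assumes "has_value x0 y0 f v" "has_value x0 y0 g w"
  shows "has_value x0 y0 (f * g) (v * w)"
proof -
  obtain P S where P: "f * to_fract S = to_fract P" "ev S x0 y0 \<noteq> 0" "v * ev S x0 y0 = ev P x0 y0"
    using assms(1) by (auto simp: has_value_def)
  obtain Q T where Q: "g * to_fract T = to_fract Q" "ev T x0 y0 \<noteq> 0" "w * ev T x0 y0 = ev Q x0 y0"
    using assms(2) by (auto simp: has_value_def)
  have "(f * g) * to_fract (S * T) = to_fract (P * Q)"
    unfolding to_fract_mult P(1)[symmetric] Q(1)[symmetric] by (simp add: mult_ac)
  moreover have "(v * w) * ev (S * T) x0 y0 = ev (P * Q) x0 y0"
    by (simp add: ev.mult P(3)[symmetric] Q(3)[symmetric] mult_ac)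
  moreover have "ev (S * T) x0 y0 \<noteq> 0" using P(2) Q(2) by (simp add: ev.mult)
  ultimately show ?thesis unfolding has_value_def by blast
qed

lemma has_value_divide:
  assumes "has_value x0 y0 f v" "has_value x0 y0 g w" "w \<noteq> 0"
  shows "has_value x0 y0 (f / g) (v / w)"
proof -
  obtain Q T where Q: "g * to_fract T = to_fract Q" "ev T x0 y0 \<noteq> 0" "w * ev T x0 y0 = ev Q x0 y0"
    using assms(2) by (auto simp: has_value_def)
  have Q0: "ev Q x0 y0 \<noteq> 0" using Q(2,3) assms(3) by (metis mult_eq_0_iff)
  then have "Q \<noteq> 0" by auto
  then have "g \<noteq> 0" using Q(1) by auto
  then have "(1 / g) * to_fract Q = to_fract T" by (simp flip: Q(1))
  moreover have "(1 / w) * ev Q x0 y0 = ev T x0 y0" using assms(3) by (simp flip: Q(3))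
  ultimately have "has_value x0 y0 (1 / g) (1 / w)" unfolding has_value_def using Q0 by blast
  from has_value_mult[OF assms(1) this] show ?thesis by simp
qed

lemma has_value_const: "has_value x0 y0 (rf_const c) c"
  unfolding has_value_def by (intro exI[of _ "[:[:c:]:]"] exI[of _ 1]) (simp add: rf_const_def)

lemma has_value_x: "has_value x0 y0 rf_x x0"
  unfolding has_value_def by (intro exI[of _ "[:[:0, 1:]:]"] exI[of _ 1]) (simp add: rf_x_def)

lemma has_value_y: "has_value x0 y0 rf_y y0"
  unfolding has_value_def by (intro exI[of _ "[:0, 1:]"] exI[of _ 1]) (simp add: rf_y_def)

text \<open>For \<open>x0 \<noteq> 0\<close> the denominator \<open>x^2 + y^2\<close> does not
  vanish at the point, so both fractional generators are defined there.\<close>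

lemma has_value_algB:
  assumes "b \<in> algB" "x0 \<noteq> 0"
  shows "\<exists>v. has_value x0 y0 b v"
  using assms(1)
proof induction
  have den: "has_value x0 y0 (rf_x\<^sup>2 + rf_y\<^sup>2) (x0\<^sup>2 + y0\<^sup>2)"
    unfolding power2_eq_square by (intro has_value_add has_value_mult has_value_x has_value_y)
  have nz: "x0\<^sup>2 + y0\<^sup>2 \<noteq> 0" using assms(2) by (simp add: sum_power2_eq_zero_iff)
  {
    case xx
    have "has_value x0 y0 (rf_x\<^sup>2) (x0\<^sup>2)"
      unfolding power2_eq_square by (intro has_value_mult has_value_x)
    from has_value_divide[OF this den nz] show ?case by blast
  next
    case xy
    have "has_value x0 y0 (rf_x * rf_y) (x0 * y0)" by (intro has_value_mult has_value_x has_value_y)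
    from has_value_divide[OF this den nz] show ?case by blast
  }
next
  case (uminus f)
  then obtain v where "has_value x0 y0 f v" by blast
  from has_value_mult[OF has_value_const[of _ _ "-1"] this] show ?case by (auto simp: rf.uminus)
qed (blast intro: has_value_const has_value_x has_value_y has_value_add has_value_mult)+

lemma evaluation_character:
  assumes "x0 \<noteq> 0"
  shows "character algB (\<lambda>b. THE v. has_value x0 y0 b v)"
proof -
  define \<chi> where "\<chi> = (\<lambda>b. THE v. has_value x0 y0 b v)"
  have eq: "\<chi> b = v" if "has_value x0 y0 b v" for b v
    unfolding \<chi>_def using that has_value_unique by (intro the_equality)
  have val: "has_value x0 y0 b (\<chi> b)" if "b \<in> algB" for b
    using has_value_algB[OF that assms, of y0] eq by auto
  have "\<chi> 1 = 1" using eq[OF has_value_const[of x0 y0 1]] by simp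
  moreover have "\<chi> (f + g) = \<chi> f + \<chi> g" "\<chi> (f * g) = \<chi> f * \<chi> g"
    if "f \<in> algB" "g \<in> algB" for f g
    using that by (auto intro: eq has_value_add has_value_mult val)
  moreover have "\<chi> (rf_const c * f) = c * \<chi> f" if "f \<in> algB" for c f
    using that by (intro eq has_value_mult has_value_const val)
  ultimately show ?thesis unfolding character_def \<chi>_def[symmetric] by blast
qed

lemma has_value_chart:
  assumes "x0 \<noteq> 0"
  shows "has_value x0 (t0 * x0) (chart F) (ev F t0 x0)"
proof -
  have t: "has_value x0 (t0 * x0) rf_t t0"
    using has_value_divide[OF has_value_y has_value_x assms, of "t0 * x0"] assms by (simp add: rf_t_def)
  have const: "has_value x0 (t0 * x0) 0 0" using has_value_const[of _ _ 0] by simp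
  have inner: "has_value x0 (t0 * x0) (rf_inner a) (poly a t0)" for a
    by (induction a) (auto intro: const has_value_add has_value_mult has_value_const t)
  show ?thesis
    by (induction F) (auto intro: const has_value_add has_value_mult inner has_value_x)
qed

text \<open>The point \<open>(r, t * r)\<close> of the plane lies over \<open>(t, r)\<close> as long
  as \<open>r \<noteq> 0\<close>. The line \<open>r = 0\<close>, which is contracted to the origin,
  is reached by density, so no characters over the origin have to be constructed.\<close>

lemma psd_chart:
  assumes b: "b \<in> psd algB" and F: "rf_q ^ k * b = chart F"
  shows "psd2 F"
  unfolding psd2_def
proof (intro allI)
  fix t r
  have nz: "ev F t r \<ge> 0" if r: "r \<noteq> 0" for r
  proof -
    let ?\<chi> = "\<lambda>b. THE v. has_value r (t * r) b v"
    have "?\<chi> b \<ge> 0" using b evaluation_character[OF r, of "t * r"] unfolding psd_def by blast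
    moreover obtain v where v: "has_value r (t * r) b v"
      using has_value_algB[OF _ r] b unfolding psd_def by blast
    then have "?\<chi> b = v" using has_value_unique by (intro the_equality)
    ultimately have v0: "v \<ge> 0" by simp
    have "rf_q ^ k = chart [:qt ^ k:]"
      by (simp only: chart_pCons chart.zero mult_zero_right add_0_right inner.power rf_inner_qt)
    then have "has_value r (t * r) (rf_q ^ k) ((1 + t\<^sup>2) ^ k)"
      using has_value_chart[OF r, of t "[:qt ^ k:]"] by (simp add: poly_power power2_eq_square)
    from has_value_mult[OF this v] have "has_value r (t * r) (chart F) ((1 + t\<^sup>2) ^ k * v)" by (simp add: F)
    then have "ev F t r = (1 + t\<^sup>2) ^ k * v" using has_value_chart[OF r, of t F] has_value_unique by blast
    with v0 show ?thesis by simp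
  qed
  show "ev F t r \<ge> 0"
    unfolding ev_conv_map_poly
    by (rule poly_nonneg_dense[of "[:0, 1:]"]) (use nz in \<open>auto simp: ev_conv_map_poly\<close>)
qed

theorem theorem16:
  shows "psd algB = sos algB"
proof
  show "psd algB \<subseteq> sos algB"
  proof
    fix b assume b: "b \<in> psd algB"
    then have "b \<in> algB" by (simp add: psd_def)
    then obtain F k where F: "rf_q ^ k * b = chart F" "wt_le F (2 * k)" using algB_chart by blast
    obtain l where l: "sum_squares ([:qt ^ l:] * F)"
      using psd_cyl_sos[OF psd_chart[OF b F(1)]] by (auto simp: cyl_sos_def)
    \<comment> \<open>An even total power of \<open>rf_q\<close> is a square and can be divided into
      the summands. A missing factor \<open>qt\<close> may be supplied because it is a sum of
      squares itself.\<close>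
    have "\<exists>l. even (k + l) \<and> sum_squares ([:qt ^ l:] * F)"
    proof (cases "even (k + l)")
      case False
      have "[:qt ^ Suc l:] * F = [:qt ^ 1:] * ([:qt ^ l:] * F)" by simp
      then have "sum_squares ([:qt ^ Suc l:] * F)"
        using sum_squares_mult[OF sum_squares_qt[of 1] l] by metis
      with False show ?thesis by (intro exI[of _ "Suc l"]) auto
    qed (use l in blast)
    then obtain l' m gs where m: "k + l' = 2 * m" and gs: "[:qt ^ l':] * F = (\<Sum>g\<leftarrow>gs. g\<^sup>2)"
      unfolding sum_squares_def by (metis evenE)
    have "wt_le [:qt ^ l':] (2 * l')" by (intro wt_le_const) (simp add: degree_qt_power)
    \<comment> \<open>The weight \<open>2 * (2 * m)\<close> of the sum yields \<open>2 * m\<close>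
      for each summand, which is exactly what a numerator over \<open>rf_q ^ m\<close> may
      have.\<close>
    from wt_le_mult[OF this F(2)] have "wt_le (\<Sum>g\<leftarrow>gs. g\<^sup>2) (2 * (2 * m))"
      unfolding gs by (simp add: m[symmetric] add.commute)
    then have "wt_le g (2 * m)" if "g \<in> set gs" for g using wt_le_sum_squares that by blast
    then have B: "chart g / rf_q ^ m \<in> algB" if "g \<in> set gs" for g
      using that by (intro chart_in_algB) auto
    have cq: "chart [:qt ^ l':] = rf_q ^ l'"
      by (simp only: chart_pCons chart.zero mult_zero_right add_0_right inner.power rf_inner_qt)
    have "(rf_q ^ m)\<^sup>2 * b = rf_q ^ l' * (rf_q ^ k * b)"
      by (simp add: m mult.commute[of m] flip: power_mult mult.assoc power_add add.commute[of k])
    also have "\<dots> = chart ([:qt ^ l':] * F)" unfolding chart.mult cq F(1) ..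
    also have "\<dots> = (\<Sum>g\<leftarrow>gs. (chart g)\<^sup>2)"
      unfolding gs by (induction gs) (simp_all add: chart.add chart.power)
    finally have "b = (\<Sum>g\<leftarrow>gs. (chart g)\<^sup>2) / (rf_q ^ m)\<^sup>2" by (simp add: eq_divide_eq mult.commute)
    also have "\<dots> = (\<Sum>h\<leftarrow>map (\<lambda>g. chart g / rf_q ^ m) gs. h\<^sup>2)"
      by (induction gs) (simp_all add: add_divide_distrib power_divide)
    finally show "b \<in> sos algB" unfolding sos_def using B by (auto intro!: exI[of _ "map (\<lambda>g. chart g / rf_q ^ m) gs"])
  qed
  show "sos algB \<subseteq> psd algB"
  proof
    fix b assume "b \<in> sos algB"
    then obtain gs where gs: "set gs \<subseteq> algB" "b = (\<Sum>g\<leftarrow>gs. g\<^sup>2)" by (auto simp: sos_def)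
    have mem: "(\<Sum>g\<leftarrow>hs. g\<^sup>2) \<in> algB" if "set hs \<subseteq> algB" for hs
      using that by (intro algB_sum_list algB_power) auto
    have "\<chi> (\<Sum>g\<leftarrow>hs. g\<^sup>2) \<ge> 0" if \<chi>: "character algB \<chi>" and "set hs \<subseteq> algB" for \<chi> hs
      using that(2)
    proof (induction hs)
      case Nil
      \<comment> \<open>The value at 0 is not prescribed by \<open>character\<close>; additivity
        forces it to be 0.\<close>
      have "\<chi> (0 + 0) = \<chi> 0 + \<chi> 0" using \<chi> algB_0 unfolding character_def by blast
      then show ?case by simp
    next
      case (Cons g hs)
      have "\<chi> (g * g + (\<Sum>g\<leftarrow>hs. g\<^sup>2)) = \<chi> g * \<chi> g + \<chi> (\<Sum>g\<leftarrow>hs. g\<^sup>2)"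
        using \<chi> Cons.prems mem[of hs] algB.mult[of g g] unfolding character_def by auto
      then show ?case using Cons by (simp add: power2_eq_square)
    qed
    then show "b \<in> psd algB" unfolding psd_def gs(2) using gs(1) mem by blast
  qed
qed

end
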